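(* Let $\theta=(\psi,\phi)$ be the true value of a $d$-dimensional parameter, with $\psi=\theta^1$ a scalar interest parameter and $\phi$ a nuisance parameter. Let $T(\psi)$ and $\breve T(\psi)$ be two asymptotically standard normal pivots of the form $$T(\psi)=\eta^{1/2}(T_1+T_2)+O_p(n^{-1}),\qquad \breve T(\psi)=\eta^{1/2}(T_1+\breve T_2)+O_p(n^{-1}),$$ where $T_1=-\lambda^{1r}l_r$, $T_2=\xi^{rst}l_{rs}l_t-\xi^{rs}l_rl_s$, $\breve T_2=\breve\xi^{rst}l_{rs}l_t-\breve\xi^{rs}l_rl_s$, and the constants $\xi^{rst},\xi^{rs},\breve\xi^{rst},\breve\xi^{rs}$ are of order $O(n^{-2})$. If, for all $r,s,t$ in the first condition and all $r,s$ in the second, $$\breve\xi^{rst}=\xi^{rst}+O(n^{-5/2}),$$ $$\breve\xi^{rs}+\breve\xi^{tu}\lambda_{tu}\tau^{rs}=\xi^{rs}+\xi^{tu}\lambda_{tu}\tau^{rs}+O(n^{-5/2}),$$ then, under the standing assumptions listed in the context, the $p$-value derived from the pivot $T(\psi)$ agrees with that derived from the pivot $\breve T(\psi)$ to error of order $O_p(n^{-1})$.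
   Context: Setting. $Y=(Y_1,\dots,Y_n)$ is a continuous random vector whose distribution depends on an unknown $d$-dimensional parameter $\theta=(\psi,\phi)$, and $L(\theta)$ is the loglikelihood based on $Y$. All distributions and expectations are under the true value $\theta=(\psi,\phi)$, i.e. under the null hypothesis that $\psi$ is the true interest parameter value, and asymptotics are as $n\to\infty$. Notation and assumptions. Indices $r,s,t,u,\dots$ range over $1,\dots,d$; an index appearing both as a subscript and as a superscript is summed over; an index $1$ refers to $\psi=\theta^1$. Subscripts on $L$ denote derivatives with respect to components of $\theta$. Put $\lambda_{rs}=E\{L_{rs}(\theta)\}$, $\lambda_{rst}=E\{L_{rst}(\theta)\}$, etc., $l_r=L_r(\theta)$ (with $E(l_r)=0$), $l_{rs}=L_{rs}(\theta)-\lambda_{rs}$, etc., and $\lambda_{rs,t}=E(L_{rs}L_t)$. The matrix $(\lambda^{rs})$ is the inverse of $(\lambda_{rs})$, $\eta=-1/\lambda^{11}$, and $\tau^{rs}=\eta\lambda^{1r}\lambda^{1s}$. The constants $\lambda_{rs},\lambda_{rst},\dots$ are of order $O(n)$; $\lambda^{rs}$ and $\tau^{rs}$ are of order $O(n^{-1})$ and $\eta$ of order $O(n)$; the variables $l_r,l_{rs},\dots$ are of order $O_p(n^{1/2})$; the joint cumulants of $l_r,l_{rs},\dots$ are of order $O(n)$. The quantities $\xi^{rst},\xi^{rs},\breve\xi^{rst},\breve\xi^{rs}$ are nonrandom (they may depend on $\theta$ and $n$). $p$-values. The $p$-value derived from a pivot (for testing the value $\psi$ against alternatives greater than $\psi$)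 is the right-hand tail probability of the observed value of the pivot, computed from the exact sampling distribution of the pivot under $\theta$, or any approximation to this quantity accurate to $O_p(n^{-1})$. Regularity convention. The problem is regular in the usual sense of higher-order likelihood asymptotics: differentiation and integration may be interchanged, orders of remainder terms are preserved on taking expectations and cumulants, and the distributions of the pivots admit Edgeworth and Cornish-Fisher expansions determined by the cumulants to the stated order. *)

theory Defs
  imports
    "HOL-Analysis.Analysis"
    "HOL-Probability.Probability"
    "HOL-Library.Landau_Symbols"
    "HOL-Library.Disjoint_Sets"
begin

section \<open>The model and its loglikelihood\<close>

text \<open>
  A parametric model is given by densities \<open>f n \<theta> y\<close>, for sample size \<open>n\<close>, parameter \<open>\<theta>\<close> in
  \<open>d\<close>-dimensional space (\<open>d = CARD('d)\<close>), and \<open>y = (y 1, \<dots>, y n)\<close>, with respect to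
  Lebesgue measure on \<open>n\<close>-dimensional space.
\<close>

type_synonym 'd model = "nat \<Rightarrow> real^'d \<Rightarrow> (nat \<Rightarrow> real) \<Rightarrow> real"

definition leb :: "nat \<Rightarrow> (nat \<Rightarrow> real) measure" where
  "leb n = PiM {1..n} (\<lambda>_. lborel)"

definition law :: "'d model \<Rightarrow> real^'d \<Rightarrow> nat \<Rightarrow> (nat \<Rightarrow> real) measure" where
  "law f \<theta> n = density (leb n) (\<lambda>y. ennreal (f n \<theta> y))"

definition pd :: "'d::finite \<Rightarrow> (real^'d \<Rightarrow> real) \<Rightarrow> real^'d \<Rightarrow> real" where
  "pd r g \<theta> = deriv (\<lambda>h. g (\<theta> + h *\<^sub>R axis r 1)) 0"

text \<open>Iterated partial derivatives; the list is the string of subscripts.\<close>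

primrec dpart :: "'d::finite list \<Rightarrow> (real^'d \<Rightarrow> real) \<Rightarrow> real^'d \<Rightarrow> real" where
  "dpart [] g = g"
| "dpart (r # rs) g = pd r (dpart rs g)"

definition Ck_on :: "nat \<Rightarrow> (real^'d::finite) set \<Rightarrow> (real^'d \<Rightarrow> real) \<Rightarrow> bool" where
  "Ck_on k S g \<longleftrightarrow>
     (\<forall>rs. length rs \<le> k \<longrightarrow> continuous_on S (dpart rs g)) \<and>
     (\<forall>rs r. length rs < k \<longrightarrow>
        (\<forall>\<theta>\<in>S. (\<lambda>h. dpart rs g (\<theta> + h *\<^sub>R axis r 1)) differentiable (at 0)))"

definition loglik :: "'d model \<Rightarrow> nat \<Rightarrow> (nat \<Rightarrow> real) \<Rightarrow> real^'d \<Rightarrow> real" where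
  "loglik f n y \<theta> = ln (f n \<theta> y)"

definition Ld :: "'d::finite model \<Rightarrow> real^'d \<Rightarrow> nat \<Rightarrow> 'd list \<Rightarrow> (nat \<Rightarrow> real) \<Rightarrow> real" where
  "Ld f \<theta> n rs y = dpart rs (loglik f n y) \<theta>"

definition lam :: "'d::finite model \<Rightarrow> real^'d \<Rightarrow> nat \<Rightarrow> 'd list \<Rightarrow> real" where
  "lam f \<theta> n rs = (LINT y|law f \<theta> n. Ld f \<theta> n rs y)"

text \<open>
  For a single subscript the subtracted constant \<open>lam f \<theta> n [r]\<close> is the mean of the score, which
  is assumed to vanish in \<open>standing_orders\<close> below; so \<open>lc f \<theta> n [r]\<close> is the score itself.
\<close>

definition lc :: "'d::finite model \<Rightarrow> real^'d \<Rightarrow> nat \<Rightarrow> 'd list \<Rightarrow> (nat \<Rightarrow> real) \<Rightarrow> real" where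
  "lc f \<theta> n rs y = Ld f \<theta> n rs y - lam f \<theta> n rs"

definition lam_mat :: "'d::finite model \<Rightarrow> real^'d \<Rightarrow> nat \<Rightarrow> real^'d^'d" where
  "lam_mat f \<theta> n = (\<chi> r s. lam f \<theta> n [r, s])"

definition lam_inv :: "'d::finite model \<Rightarrow> real^'d \<Rightarrow> nat \<Rightarrow> 'd \<Rightarrow> 'd \<Rightarrow> real" where
  "lam_inv f \<theta> n r s = matrix_inv (lam_mat f \<theta> n) $ r $ s"

text \<open>In the following \<open>i1\<close> is the index of the scalar interest parameter.\<close>

definition eta :: "'d::finite model \<Rightarrow> real^'d \<Rightarrow> 'd \<Rightarrow> nat \<Rightarrow> real" where
  "eta f \<theta> i1 n = - 1 / lam_inv f \<theta> n i1 i1"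

definition tau :: "'d::finite model \<Rightarrow> real^'d \<Rightarrow> 'd \<Rightarrow> nat \<Rightarrow> 'd \<Rightarrow> 'd \<Rightarrow> real" where
  "tau f \<theta> i1 n r s = eta f \<theta> i1 n * lam_inv f \<theta> n i1 r * lam_inv f \<theta> n i1 s"


section \<open>Cumulants and stochastic order\<close>

text \<open>Joint cumulant of a list of random variables, by the moment formula over set partitions.\<close>

definition joint_cumulant :: "'a measure \<Rightarrow> ('a \<Rightarrow> real) list \<Rightarrow> real" where
  "joint_cumulant M Xs =
     (\<Sum>p | partition_on {..<length Xs} p.
        (- 1) ^ (card p - 1) * fact (card p - 1) *
        (\<Prod>B\<in>p. LINT x|M. (\<Prod>i\<in>B. (Xs ! i) x)))"

definition cumulant :: "'a measure \<Rightarrow> nat \<Rightarrow> ('a \<Rightarrow> real) \<Rightarrow> real" where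
  "cumulant M k X = joint_cumulant M (replicate k X)"

text \<open>\<open>Op P X a\<close>: under \<open>P n\<close>, the variable \<open>X n\<close> is of order \<open>O\<^sub>p(a n)\<close> as \<open>n\<close> tends to infinity.\<close>

definition Op :: "(nat \<Rightarrow> 'a measure) \<Rightarrow> (nat \<Rightarrow> 'a \<Rightarrow> real) \<Rightarrow> (nat \<Rightarrow> real) \<Rightarrow> bool" where
  "Op P X a \<longleftrightarrow>
     (\<forall>\<^sub>F n in sequentially. X n \<in> borel_measurable (P n)) \<and>
     (\<forall>\<epsilon>>0. \<exists>C. \<forall>\<^sub>F n in sequentially.
        measure (P n) {y \<in> space (P n). \<bar>X n y\<bar> > C * a n} \<le> \<epsilon>)"


section \<open>Standing assumptions on the model\<close>

text \<open>
  \<open>K\<close> is the number of loglikelihood derivatives in play. The last clause is the interchange of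
  differentiation and integration for the density at the true parameter value.
\<close>

definition regular_model ::
  "'d::finite model \<Rightarrow> (real^'d) set \<Rightarrow> real^'d \<Rightarrow> nat \<Rightarrow> bool" where
  "regular_model f \<Theta> \<theta> K \<longleftrightarrow>
     open \<Theta> \<and> \<theta> \<in> \<Theta> \<and>
     (\<forall>n\<ge>1. \<forall>\<theta>'\<in>\<Theta>.
        f n \<theta>' \<in> borel_measurable (leb n) \<and> (\<forall>y\<in>space (leb n). f n \<theta>' y \<ge> 0) \<and> prob_space (law f \<theta>' n)) \<and>
     (\<forall>n\<ge>1. \<forall>y\<in>space (leb n). \<forall>\<theta>'\<in>\<Theta>. f n \<theta>' y > 0 \<longleftrightarrow> f n \<theta> y > 0) \<and>
     (\<forall>n\<ge>1. \<forall>y\<in>space (leb n). f n \<theta> y > 0 \<longrightarrow> Ck_on K \<Theta> (loglik f n y)) \<and>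
     (\<forall>rs. length rs \<le> K \<longrightarrow> (\<forall>\<^sub>F n in sequentially.
        integrable (leb n) (\<lambda>y. dpart rs (\<lambda>\<theta>'. f n \<theta>' y) \<theta>) \<and>
        (LINT y|leb n. dpart rs (\<lambda>\<theta>'. f n \<theta>' y) \<theta>) =
          dpart rs (\<lambda>\<theta>'. LINT y|leb n. f n \<theta>' y) \<theta>))"

definition standing_orders ::
  "'d::finite model \<Rightarrow> real^'d \<Rightarrow> 'd \<Rightarrow> nat \<Rightarrow> bool" where
  "standing_orders f \<theta> i1 K \<longleftrightarrow>
     (\<forall>\<^sub>F n in sequentially. invertible (lam_mat f \<theta> n)) \<and>
     (\<forall>\<^sub>F n in sequentially. \<forall>r. lam f \<theta> n [r] = 0) \<and>
     (\<forall>rs. 1 \<le> length rs \<and> length rs \<le> K \<longrightarrow> (\<lambda>n. lam f \<theta> n rs) \<in> O(\<lambda>n. real n)) \<and>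
     (\<forall>r s. (\<lambda>n. lam_inv f \<theta> n r s) \<in> O(\<lambda>n. real n powr (- 1))) \<and>
     (\<forall>r s. (\<lambda>n. tau f \<theta> i1 n r s) \<in> O(\<lambda>n. real n powr (- 1))) \<and>
     (\<lambda>n. eta f \<theta> i1 n) \<in> O(\<lambda>n. real n) \<and>
     (\<forall>rs. 1 \<le> length rs \<and> length rs \<le> K \<longrightarrow>
        Op (law f \<theta>) (\<lambda>n. lc f \<theta> n rs) (\<lambda>n. real n powr (1/2))) \<and>
     (\<forall>rss. rss \<noteq> [] \<and> (\<forall>rs\<in>set rss. 1 \<le> length rs \<and> length rs \<le> K) \<longrightarrow>
        (\<forall>\<^sub>F n in sequentially.
           integrable (law f \<theta> n) (\<lambda>y. \<Prod>i<length rss. lc f \<theta> n (rss ! i) y)) \<and>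
        (\<lambda>n. joint_cumulant (law f \<theta> n) (map (lc f \<theta> n) rss)) \<in> O(\<lambda>n. real n))"


section \<open>Pivots\<close>

definition T1 :: "'d::finite model \<Rightarrow> real^'d \<Rightarrow> 'd \<Rightarrow> nat \<Rightarrow> (nat \<Rightarrow> real) \<Rightarrow> real" where
  "T1 f \<theta> i1 n y = - (\<Sum>r\<in>UNIV. lam_inv f \<theta> n i1 r * lc f \<theta> n [r] y)"

definition T2 ::
  "'d::finite model \<Rightarrow> real^'d \<Rightarrow> (nat \<Rightarrow> 'd \<Rightarrow> 'd \<Rightarrow> 'd \<Rightarrow> real) \<Rightarrow> (nat \<Rightarrow> 'd \<Rightarrow> 'd \<Rightarrow> real) \<Rightarrow>
   nat \<Rightarrow> (nat \<Rightarrow> real) \<Rightarrow> real" where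
  "T2 f \<theta> \<xi>3 \<xi>2 n y =
     (\<Sum>r\<in>UNIV. \<Sum>s\<in>UNIV. \<Sum>t\<in>UNIV. \<xi>3 n r s t * lc f \<theta> n [r, s] y * lc f \<theta> n [t] y) -
     (\<Sum>r\<in>UNIV. \<Sum>s\<in>UNIV. \<xi>2 n r s * lc f \<theta> n [r] y * lc f \<theta> n [s] y)"

definition expansion ::
  "'d::finite model \<Rightarrow> real^'d \<Rightarrow> 'd \<Rightarrow>
   (nat \<Rightarrow> 'd \<Rightarrow> 'd \<Rightarrow> 'd \<Rightarrow> real) \<Rightarrow> (nat \<Rightarrow> 'd \<Rightarrow> 'd \<Rightarrow> real) \<Rightarrow>
   nat \<Rightarrow> (nat \<Rightarrow> real) \<Rightarrow> real" where
  "expansion f \<theta> i1 \<xi>3 \<xi>2 n y =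
     sqrt (eta f \<theta> i1 n) * (T1 f \<theta> i1 n y + T2 f \<theta> \<xi>3 \<xi>2 n y)"

definition asymptotically_standard_normal ::
  "(nat \<Rightarrow> 'a measure) \<Rightarrow> (nat \<Rightarrow> 'a \<Rightarrow> real) \<Rightarrow> bool" where
  "asymptotically_standard_normal P X \<longleftrightarrow>
     (\<forall>n\<ge>1. X n \<in> borel_measurable (P n)) \<and>
     weak_conv_m (\<lambda>n. distr (P n) borel (X n)) std_normal_distribution"

text \<open>
  Orders of remainder terms are preserved on taking cumulants (the first of which is the
  expectation), for the cumulants that enter an Edgeworth expansion with error \<open>O(n\<^sup>-\<^sup>1)\<close>:
  \<open>E\<close> is a stochastic expansion of \<open>X\<close> with error of order \<open>O\<^sub>p(n\<^sup>-\<^sup>1)\<close>.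
\<close>

definition cumulants_preserved ::
  "(nat \<Rightarrow> 'a measure) \<Rightarrow> (nat \<Rightarrow> 'a \<Rightarrow> real) \<Rightarrow> (nat \<Rightarrow> 'a \<Rightarrow> real) \<Rightarrow> bool" where
  "cumulants_preserved P X E \<longleftrightarrow>
     (\<forall>k\<in>{1, 2, 3}.
        (\<forall>\<^sub>F n in sequentially. integrable (P n) (\<lambda>y. X n y ^ k)) \<and>
        (\<lambda>n. cumulant (P n) k (X n) - cumulant (P n) k (E n)) \<in> O(\<lambda>n. real n powr (- 1)))"

text \<open>
  The Edgeworth expansion about the standard normal distribution, in terms of the first three
  cumulants: the corrections are the Hermite polynomials \<open>1\<close>, \<open>x\<close>, \<open>x\<^sup>2 - 1\<close>.
\<close>

definition edgeworth_cdf :: "real \<Rightarrow> real \<Rightarrow> real \<Rightarrow> real \<Rightarrow> real" where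
  "edgeworth_cdf k1 k2 k3 x =
     cdf std_normal_distribution x -
     std_normal_density x * (k1 + (k2 - 1) / 2 * x + k3 / 6 * (x\<^sup>2 - 1))"

definition admits_edgeworth ::
  "(nat \<Rightarrow> 'a measure) \<Rightarrow> (nat \<Rightarrow> 'a \<Rightarrow> real) \<Rightarrow> bool" where
  "admits_edgeworth P X \<longleftrightarrow>
     (\<exists>C. \<forall>\<^sub>F n in sequentially. \<forall>x.
        \<bar>measure (P n) {y \<in> space (P n). X n y \<le> x} -
         edgeworth_cdf (cumulant (P n) 1 (X n)) (cumulant (P n) 2 (X n)) (cumulant (P n) 3 (X n)) x\<bar>
        \<le> C * real n powr (- 1))"

text \<open>
  A \<open>p\<close>-value derived from a pivot: the exact right-hand tail probability of its observed
  value, or any approximation to this that is accurate to \<open>O\<^sub>p(n\<^sup>-\<^sup>1)\<close>.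
\<close>

definition right_tail :: "'a measure \<Rightarrow> ('a \<Rightarrow> real) \<Rightarrow> 'a \<Rightarrow> real" where
  "right_tail M X y = measure M {y' \<in> space M. X y' \<ge> X y}"

definition is_p_value ::
  "(nat \<Rightarrow> 'a measure) \<Rightarrow> (nat \<Rightarrow> 'a \<Rightarrow> real) \<Rightarrow> (nat \<Rightarrow> 'a \<Rightarrow> real) \<Rightarrow> bool" where
  "is_p_value P X p \<longleftrightarrow>
     Op P (\<lambda>n y. p n y - right_tail (P n) (X n) y) (\<lambda>n. real n powr (- 1))"

end

theory Submission
  imports Defs
begin

text \<open>
  Write \<open>V = S + Q\<close> for the expansion of the first pivot, with \<open>S\<close> its leading term, linear in the
  scores, and \<open>Q\<close> its quadratic term, and write \<open>V'\<close> for that of the second pivot. The two conditions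
  on the coefficients say that \<open>V' = V + a S\<^sup>2 + R\<close>, where \<open>a\<close> is a constant of order \<open>n\<^sup>-\<^sup>1\<^sup>/\<^sup>2\<close> and \<open>R\<close> is of
  order \<open>n\<^sup>-\<^sup>1\<close> in every moment: the only freedom that they leave in the quadratic term is a multiple of
  the matrix \<open>\<tau>\<close>, and \<open>\<Sum> \<tau>\<^sup>r\<^sup>s l\<^sub>r l\<^sub>s = S\<^sup>2\<close> (\<open>expansion_difference\<close>). So the second pivot is, to the order
  considered, the function \<open>t + a t\<^sup>2\<close> of the first one. On a bounded set this function is increasing for
  large \<open>n\<close>, and an increasing transformation of the pivot does not change a p-value.

  This last step cannot be made on the level of random variables, because an error that is
  \<open>O\<^sub>p(n\<^sup>-\<^sup>1)\<close> may change probabilities by more than \<open>O(n\<^sup>-\<^sup>1)\<close>. It goes through the cumulants. The second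
  Bartlett identity gives \<open>S\<close> variance 1, and since the joint cumulants of the scores are of order
  \<open>n\<close>, the moments of \<open>S\<close> agree with those of a standard normal variable up to \<open>O(n\<^sup>-\<^sup>1\<^sup>/\<^sup>2)\<close>
  (\<open>moments_of_leading\<close>). Hence the perturbation \<open>a S\<^sup>2 + R\<close> adds \<open>a\<close>, 0 and
  \<open>6 a\<close> to the first three cumulants, up to \<open>O(n\<^sup>-\<^sup>1)\<close> (\<open>cumulants_of_quadratic_perturbation\<close>). In the Edgeworth
  expansion this changes the distribution function at \<open>t\<close> by \<open>- a t\<^sup>2 \<phi>(t)\<close>, which is exactly cancelled by
  moving the argument from \<open>t\<close> to \<open>t + a t\<^sup>2\<close>
  (\<open>edgeworth_invariant_under_quadratic_perturbation\<close>). The Edgeworth expansions at the observed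
  values are therefore equal up to \<open>O\<^sub>p(n\<^sup>-\<^sup>1)\<close>, and so are the tail probabilities and the p-values.

  The argument needs all moments of the loglikelihood derivatives, while the assumptions
  control their cumulants; \<open>product_moments_from_cumulants\<close> passes from one to the other.
\<close>

section \<open>Cumulants of low order\<close>

text \<open>
  The weight \<open>c\<close> is a parameter because removing one block from a partition shifts its argument by
  one; with \<open>c\<close> free the sum satisfies a recursion over the underlying set.
\<close>

definition partition_sum :: "(nat \<Rightarrow> real) \<Rightarrow> ('i set \<Rightarrow> real) \<Rightarrow> 'i set \<Rightarrow> real" where
  "partition_sum c m A = (\<Sum>p | partition_on A p. c (card p) * (\<Prod>B\<in>p. m B))"

text \<open>
  A partition of \<open>insert x A\<close> is determined by the block \<open>insert x B\<close> that contains \<open>x\<close> and a partition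
  of the rest of \<open>A\<close>. Used as a rewrite rule, this enumerates the partitions of a small set.
\<close>

lemma partition_sum_insert:
  fixes c :: "nat \<Rightarrow> real" and m :: "'i set \<Rightarrow> real"
  assumes A: "finite A" and x: "x \<notin> A"
  shows "partition_sum c m (insert x A) =
         (\<Sum>B\<in>Pow A. m (insert x B) * partition_sum (\<lambda>k. c (Suc k)) m (A - B))"
proof -
  let ?g = "\<lambda>(B, p). insert (insert x B) p"
  let ?S = "Sigma (Pow A) (\<lambda>B. {p. partition_on (A - B) p})"
  have notin: "insert x B \<notin> p" "finite p" if "partition_on (A - B) p" for B p
    using that x finite_elements[OF _ that] A by (auto dest!: partition_onD1)
  have dis: "disjnt (insert x B) (\<Union>p)" if "partition_on (A - B) p" for B p
    using that x by (auto dest!: partition_onD1 simp: disjnt_iff)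
  have inj: "inj_on ?g ?S"
  proof (rule inj_onI, clarify)
    fix B p B' p'
    assume *: "B \<subseteq> A" "partition_on (A - B) p" "B' \<subseteq> A" "partition_on (A - B') p'"
      and eq: "insert (insert x B) p = insert (insert x B') p'"
    have "insert x B \<notin> p'" "insert x B' \<notin> p"
      using * x by (auto dest!: partition_onD1)
    then have **: "insert x B = insert x B'" using eq by blast
    then have "B = B'" using *(1,3) x by auto
    moreover have "p = p'" using eq ** notin(1)[OF *(2)] notin(1)[OF *(4)] by (metis Diff_insert_absorb)
    ultimately show "B = B' \<and> p = p'" by simp
  qed
  have img: "?g ` ?S = {p. partition_on (insert x A) p}"
  proof (intro set_eqI iffI)
    fix p assume "p \<in> ?g ` ?S"
    then obtain B q where q: "B \<subseteq> A" "partition_on (A - B) q" "p = insert (insert x B) q" by auto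
    have "insert x A - insert x B = A - B" using x by auto
    then show "p \<in> {p. partition_on (insert x A) p}"
      using q partition_on_insert[OF dis[OF q(2)], of "insert x A"] by auto
  next
    fix p assume "p \<in> {p. partition_on (insert x A) p}"
    then have p: "partition_on (insert x A) p" by simp
    then obtain C where C: "C \<in> p" "x \<in> C" using partition_onD1[OF p] by blast
    define B where "B = C - {x}"
    define q where "q = p - {C}"
    have CB: "C = insert x B" "p = insert C q" using C by (auto simp: B_def q_def)
    have "disjnt C (\<Union>q)"
      using partition_onD2[OF p] C(1) by (fastforce simp: q_def disjnt_def pairwise_def)
    then have "partition_on (insert x A - C) q \<and> C \<subseteq> insert x A"
      using p partition_on_insert[of C q "insert x A"] CB(2) by metis
    moreover have "insert x A - C = A - B" "B = C - {x}" using x CB B_def by auto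
    ultimately have "(B, q) \<in> ?S" by auto
    then show "p \<in> ?g ` ?S" using CB by (auto simp: image_iff)
  qed
  have "(\<Sum>p | partition_on (insert x A) p. c (card p) * (\<Prod>B\<in>p. m B)) =
      (\<Sum>(B, p)\<in>?S. c (card (insert (insert x B) p)) * (\<Prod>B\<in>insert (insert x B) p. m B))"
    unfolding img[symmetric] by (subst sum.reindex[OF inj]) (simp add: case_prod_unfold)
  also have "\<dots> = (\<Sum>(B, p)\<in>?S. m (insert x B) * (c (Suc (card p)) * (\<Prod>B\<in>p. m B)))"
    using notin by (intro sum.cong) (auto simp: card_insert_disjoint)
  also have "\<dots> = (\<Sum>B\<in>Pow A. \<Sum>p | partition_on (A - B) p. m (insert x B) * (c (Suc (card p)) * (\<Prod>B\<in>p. m B)))"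
    using A by (subst sum.Sigma) (auto intro!: finitely_many_partition_on)
  finally show ?thesis by (simp add: partition_sum_def sum_distrib_left)
qed

lemma partition_sum_empty: "partition_sum c m {} = c 0"
  by (simp add: partition_sum_def partition_on_empty)

lemma sum_Pow_insert:
  fixes h :: "'i set \<Rightarrow> real"
  assumes "finite A" "x \<notin> A"
  shows "(\<Sum>B\<in>Pow (insert x A). h B) = (\<Sum>B\<in>Pow A. h B) + (\<Sum>B\<in>Pow A. h (insert x B))"
proof -
  have "inj_on (insert x) (Pow A)" using assms by (auto simp: inj_on_def)
  moreover have "Pow A \<inter> insert x ` Pow A = {}" using assms by auto
  ultimately show ?thesis
    using assms by (simp add: Pow_insert sum.union_disjoint sum.reindex)
qed

lemma joint_cumulant_as_partition_sum:
  "joint_cumulant M Xs = partition_sum (\<lambda>k. (- 1) ^ (k - 1) * fact (k - 1))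
     (\<lambda>B. LINT x|M. (\<Prod>i\<in>B. (Xs ! i) x)) {..<length Xs}"
  by (simp add: joint_cumulant_def partition_sum_def)

lemma lessThan_numerals: "{..<3::nat} = {0,1,2}" "{..<2::nat} = {0,1}" "{..<4::nat} = {0,1,2,3}"  by auto

lemma cumulant_1: "cumulant M 1 X = (LINT x|M. X x)"
  unfolding cumulant_def joint_cumulant_as_partition_sum
  by (simp add: partition_sum_insert partition_sum_empty lessThan_Suc)

lemma cumulant_2: "cumulant M 2 X = (LINT x|M. X x ^ 2) - (LINT x|M. X x) ^ 2"
  unfolding cumulant_def joint_cumulant_as_partition_sum length_replicate lessThan_numerals
  by (simp add: partition_sum_insert partition_sum_empty sum_Pow_insert insert_Diff_if power2_eq_square)

lemma cumulant_3: "cumulant M 3 X =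
   (LINT x|M. X x ^ 3) - 3 * (LINT x|M. X x ^ 2) * (LINT x|M. X x) + 2 * (LINT x|M. X x) ^ 3"
  unfolding cumulant_def joint_cumulant_as_partition_sum length_replicate lessThan_numerals
  by (simp add: partition_sum_insert partition_sum_empty sum_Pow_insert insert_Diff_if
        power2_eq_square power3_eq_cube numeral_3_eq_3 fact_numeral) (simp add: algebra_simps)

text \<open>
  For centred variables every partition with a singleton block contributes zero. Of the
  partitions of three points only the trivial one has no singleton; of those of four points, the
  trivial one and the three pairings.
\<close>

lemma joint_cumulant_3_centred:
  assumes "\<And>i. i < 3 \<Longrightarrow> (LINT x|M. ([X,Y,Z] ! i) x) = 0"
  shows "joint_cumulant M [X, Y, Z] = (LINT x|M. X x * Y x * Z x)"
proof -
  have 0: "(LINT x|M. X x) = 0" "(LINT x|M. Y x) = 0" "(LINT x|M. Z x) = 0"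
    using assms[of 0] assms[of 1] assms[of 2] by simp_all
  have l: "length [X,Y,Z] = 3" by simp
  show ?thesis unfolding joint_cumulant_as_partition_sum l lessThan_numerals
    by (simp add: partition_sum_insert partition_sum_empty sum_Pow_insert insert_Diff_if 0 mult.assoc)
qed

lemma joint_cumulant_4_centred:
  assumes "\<And>i. i < 4 \<Longrightarrow> (LINT x|M. ([X,Y,Z,W] ! i) x) = 0"
  shows "joint_cumulant M [X, Y, Z, W] = (LINT x|M. X x * Y x * Z x * W x)
     - (LINT x|M. X x * Y x) * (LINT x|M. Z x * W x)
     - (LINT x|M. X x * Z x) * (LINT x|M. Y x * W x)
     - (LINT x|M. X x * W x) * (LINT x|M. Y x * Z x)"
proof -
  have 0: "(LINT x|M. X x) = 0" "(LINT x|M. Y x) = 0" "(LINT x|M. Z x) = 0" "(LINT x|M. W x) = 0"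
    using assms[of 0] assms[of 1] assms[of 2] assms[of 3] by simp_all
  have l: "length [X,Y,Z,W] = 4" by simp
  show ?thesis unfolding joint_cumulant_as_partition_sum l lessThan_numerals
    by (simp add: partition_sum_insert partition_sum_empty sum_Pow_insert insert_Diff_if 0 mult.assoc)
qed

section \<open>Powers of the sample size\<close>

lemma powr_bigo_mono: "\<alpha> \<le> \<beta> \<Longrightarrow> (\<lambda>n. real n powr \<alpha>) \<in> O(\<lambda>n. real n powr \<beta>)"
  by (intro landau_o.big_mono eventually_sequentiallyI[of 1]) (auto intro: powr_mono)

lemma bigo_powr_weaken: "f \<in> O(\<lambda>n. real n powr \<alpha>) \<Longrightarrow> \<alpha> \<le> \<beta> \<Longrightarrow> f \<in> O(\<lambda>n. real n powr \<beta>)"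
  using landau_o.big_trans powr_bigo_mono by blast

lemma bigo_powr_mult:
  fixes f g :: "nat \<Rightarrow> real"
  assumes "f \<in> O(\<lambda>n. real n powr \<alpha>)" "g \<in> O(\<lambda>n. real n powr \<beta>)" "\<alpha> + \<beta> \<le> \<gamma>"
  shows "(\<lambda>n. f n * g n) \<in> O(\<lambda>n. real n powr \<gamma>)"
  using landau_o.big_mult[OF assms(1,2)] assms(3) by (auto simp: powr_add[symmetric] intro: bigo_powr_weaken)

lemma bigo_const_powr: "0 \<le> \<alpha> \<Longrightarrow> (\<lambda>n. c :: real) \<in> O(\<lambda>n. real n powr \<alpha>)"
proof -
  assume "0 \<le> \<alpha>"
  then have "(\<lambda>n. real n powr 0) \<in> O(\<lambda>n. real n powr \<alpha>)" by (rule powr_bigo_mono)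
  moreover have "(\<lambda>n. c) \<in> O(\<lambda>n. real n powr 0)"
    by (rule bigoI[of _ "norm c"], rule eventually_sequentiallyI[of 1]) simp
  ultimately show ?thesis using landau_o.big_trans by blast
qed

lemma bigo_powr_iff:
  "f \<in> O(\<lambda>n. real n powr \<alpha>) \<longleftrightarrow> (\<exists>C\<ge>0. \<forall>\<^sub>F n in sequentially. \<bar>f n :: real\<bar> \<le> C * real n powr \<alpha>)"
proof
  assume "f \<in> O(\<lambda>n. real n powr \<alpha>)"
  then obtain c where "c > 0" "\<forall>\<^sub>F n in sequentially. norm (f n) \<le> c * norm (real n powr \<alpha>)"
    by (rule landau_o.bigE)
  then show "\<exists>C\<ge>0. \<forall>\<^sub>F n in sequentially. \<bar>f n\<bar> \<le> C * real n powr \<alpha>"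
    by (intro exI[of _ c]) auto
next
  assume "\<exists>C\<ge>0. \<forall>\<^sub>F n in sequentially. \<bar>f n :: real\<bar> \<le> C * real n powr \<alpha>"
  then show "f \<in> O(\<lambda>n. real n powr \<alpha>)" by (auto intro: bigoI)
qed

lemma bigo_eq:
  fixes f g h :: "nat \<Rightarrow> real"
  shows "g \<in> O(h) \<Longrightarrow> (\<And>n. f n = g n) \<Longrightarrow> f \<in> O(h)"
  by (metis ext)

lemma bigo_eventually_eq:
  fixes f g h :: "nat \<Rightarrow> real"
  assumes "g \<in> O(h)" "\<forall>\<^sub>F n in sequentially. f n = g n"
  shows "f \<in> O(h)"
  using assms(1) landau_o.big.in_cong[OF assms(2)] by blast

section \<open>Stochastic order\<close>

text \<open>
  The measures are required to be probability measures for large sample sizes only: at sample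
  size 0 the model imposes nothing.
\<close>

locale prob_sequence =
  fixes P :: "nat \<Rightarrow> 'a measure"
  assumes ev_prob: "\<forall>\<^sub>F n in sequentially. prob_space (P n)"
begin

abbreviation OpP where "OpP X \<alpha> \<equiv> Op P X (\<lambda>n. real n powr \<alpha>)"

lemma OpP_measurable: "OpP X \<alpha> \<Longrightarrow> \<forall>\<^sub>F n in sequentially. X n \<in> borel_measurable (P n)"
  by (simp add: Op_def)

text \<open>
  A nonnegative constant makes the bounds on two variables combine under products.
\<close>

lemma OpP_bound:
  assumes "OpP X \<alpha>" "\<epsilon> > 0"
  obtains C where "C \<ge> 0" "\<forall>\<^sub>F n in sequentially.
    measure (P n) {y \<in> space (P n). \<bar>X n y\<bar> > C * real n powr \<alpha>} \<le> \<epsilon>"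
proof -
  obtain C where C: "\<forall>\<^sub>F n in sequentially.
    measure (P n) {y \<in> space (P n). \<bar>X n y\<bar> > C * real n powr \<alpha>} \<le> \<epsilon>"
    using assms unfolding Op_def by blast
  have "\<forall>\<^sub>F n in sequentially.
    measure (P n) {y \<in> space (P n). \<bar>X n y\<bar> > max C 0 * real n powr \<alpha>} \<le> \<epsilon>"
    using C OpP_measurable[OF assms(1)] ev_prob
  proof eventually_elim
    case (elim n)
    interpret prob_space "P n" by fact
    have "C * real n powr \<alpha> \<le> max C 0 * real n powr \<alpha>" by (intro mult_right_mono) auto
    then have "measure (P n) {y \<in> space (P n). \<bar>X n y\<bar> > max C 0 * real n powr \<alpha>} \<le>
        measure (P n) {y \<in> space (P n). \<bar>X n y\<bar> > C * real n powr \<alpha>}"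
      using elim(2) by (intro finite_measure_mono) (auto intro: order.strict_trans1)
    then show ?case using elim(1) by linarith
  qed
  then show ?thesis by (intro that[of "max C 0"]) auto
qed

text \<open>
  The common pattern behind sums, products and domination: outside of two events of small
  probability both variables satisfy their bounds, and there the bound on \<open>Z\<close> is deterministic.
\<close>

lemma OpP_combine:
  assumes X: "OpP X \<alpha>" and Y: "OpP Y \<beta>"
    and Z: "\<forall>\<^sub>F n in sequentially. Z n \<in> borel_measurable (P n)"
    and le: "\<And>C D. C \<ge> 0 \<Longrightarrow> D \<ge> 0 \<Longrightarrow> \<exists>B. \<forall>\<^sub>F n in sequentially. \<forall>y\<in>space (P n).
       \<bar>X n y\<bar> \<le> C * real n powr \<alpha> \<longrightarrow> \<bar>Y n y\<bar> \<le> D * real n powr \<beta> \<longrightarrow> \<bar>Z n y\<bar> \<le> B * real n powr \<gamma>"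
  shows "OpP Z \<gamma>"
  unfolding Op_def
proof (intro conjI allI impI Z)
  fix \<epsilon> :: real assume "\<epsilon> > 0"
  then have e: "\<epsilon>/2 > 0" by simp
  obtain C where C: "C \<ge> 0" "\<forall>\<^sub>F n in sequentially.
    measure (P n) {y \<in> space (P n). \<bar>X n y\<bar> > C * real n powr \<alpha>} \<le> \<epsilon>/2"
    using OpP_bound[OF X e] by blast
  obtain D where D: "D \<ge> 0" "\<forall>\<^sub>F n in sequentially.
    measure (P n) {y \<in> space (P n). \<bar>Y n y\<bar> > D * real n powr \<beta>} \<le> \<epsilon>/2"
    using OpP_bound[OF Y e] by blast
  obtain B where B: "\<forall>\<^sub>F n in sequentially. \<forall>y\<in>space (P n).
       \<bar>X n y\<bar> \<le> C * real n powr \<alpha> \<longrightarrow> \<bar>Y n y\<bar> \<le> D * real n powr \<beta> \<longrightarrow> \<bar>Z n y\<bar> \<le> B * real n powr \<gamma>"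
    using le[OF C(1) D(1)] by blast
  show "\<exists>B. \<forall>\<^sub>F n in sequentially. measure (P n) {y \<in> space (P n). \<bar>Z n y\<bar> > B * real n powr \<gamma>} \<le> \<epsilon>"
  proof (intro exI[of _ B])
    show "\<forall>\<^sub>F n in sequentially. measure (P n) {y \<in> space (P n). \<bar>Z n y\<bar> > B * real n powr \<gamma>} \<le> \<epsilon>"
      using C(2) D(2) B OpP_measurable[OF X] OpP_measurable[OF Y] ev_prob
    proof eventually_elim
      case (elim n)
      interpret prob_space "P n" by fact
      define U where "U = {y \<in> space (P n). \<bar>X n y\<bar> > C * real n powr \<alpha>}"
      define V where "V = {y \<in> space (P n). \<bar>Y n y\<bar> > D * real n powr \<beta>}"
      note [measurable] = elim(4,5)
      have m: "U \<in> sets (P n)" "V \<in> sets (P n)" unfolding U_def V_def by measurable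
      have sub: "{y \<in> space (P n). \<bar>Z n y\<bar> > B * real n powr \<gamma>} \<subseteq> U \<union> V"
      proof (rule subsetI, rule ccontr)
        fix y assume y: "y \<in> {y \<in> space (P n). \<bar>Z n y\<bar> > B * real n powr \<gamma>}" "y \<notin> U \<union> V"
        then have "\<bar>X n y\<bar> \<le> C * real n powr \<alpha>" "\<bar>Y n y\<bar> \<le> D * real n powr \<beta>"
          by (simp_all add: U_def V_def not_less)
        then have "\<bar>Z n y\<bar> \<le> B * real n powr \<gamma>" using bspec[OF elim(3), of y] y(1) by simp
        then show False using y(1) by simp
      qed
      have "measure (P n) {y \<in> space (P n). \<bar>Z n y\<bar> > B * real n powr \<gamma>} \<le> measure (P n) (U \<union> V)"
        using m by (intro finite_measure_mono[OF sub]) simp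
      also have "\<dots> \<le> measure (P n) U + measure (P n) V"
        using m by (rule measure_Un_le)
      finally show ?case using elim(1,2) unfolding U_def V_def by linarith
    qed
  qed
qed

lemma OpP_add:
  assumes X: "OpP X \<alpha>" and Y: "OpP Y \<alpha>"
  shows "OpP (\<lambda>n y. X n y + Y n y) \<alpha>"
proof (rule OpP_combine[OF X Y])
  show "\<forall>\<^sub>F n in sequentially. (\<lambda>y. X n y + Y n y) \<in> borel_measurable (P n)"
    using OpP_measurable[OF X] OpP_measurable[OF Y] by eventually_elim measurable
  fix C D :: real
  have "\<bar>X n y + Y n y\<bar> \<le> (C + D) * real n powr \<alpha>"
    if "\<bar>X n y\<bar> \<le> C * real n powr \<alpha>" "\<bar>Y n y\<bar> \<le> D * real n powr \<alpha>" for n y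
    using that by (simp add: distrib_right)
  note bd = this
  show "\<exists>B. \<forall>\<^sub>F n in sequentially. \<forall>y\<in>space (P n).
       \<bar>X n y\<bar> \<le> C * real n powr \<alpha> \<longrightarrow> \<bar>Y n y\<bar> \<le> D * real n powr \<alpha> \<longrightarrow> \<bar>X n y + Y n y\<bar> \<le> B * real n powr \<alpha>"
    by (intro exI[of _ "C + D"] always_eventually allI ballI impI bd)
qed

lemma OpP_mult:
  assumes X: "OpP X \<alpha>" and Y: "OpP Y \<beta>"
  shows "OpP (\<lambda>n y. X n y * Y n y) (\<alpha> + \<beta>)"
proof (rule OpP_combine[OF X Y])
  show "\<forall>\<^sub>F n in sequentially. (\<lambda>y. X n y * Y n y) \<in> borel_measurable (P n)"
    using OpP_measurable[OF X] OpP_measurable[OF Y] by eventually_elim measurable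
  fix C D :: real
  have "\<bar>X n y * Y n y\<bar> \<le> (C * D) * real n powr (\<alpha> + \<beta>)"
    if "\<bar>X n y\<bar> \<le> C * real n powr \<alpha>" "\<bar>Y n y\<bar> \<le> D * real n powr \<beta>" for n y
  proof -
    have "\<bar>X n y\<bar> * \<bar>Y n y\<bar> \<le> (C * real n powr \<alpha>) * (D * real n powr \<beta>)"
      by (rule mult_mono[OF that]) (use order.trans[OF abs_ge_zero that(1)] in simp_all)
    also have "\<dots> = (C * D) * real n powr (\<alpha> + \<beta>)" by (simp only: powr_add mult_ac)
    finally show ?thesis by (simp only: abs_mult)
  qed
  note bd = this
  show "\<exists>B. \<forall>\<^sub>F n in sequentially. \<forall>y\<in>space (P n).
       \<bar>X n y\<bar> \<le> C * real n powr \<alpha> \<longrightarrow> \<bar>Y n y\<bar> \<le> D * real n powr \<beta> \<longrightarrow> \<bar>X n y * Y n y\<bar> \<le> B * real n powr (\<alpha> + \<beta>)"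
    by (intro exI[of _ "C * D"] always_eventually allI ballI impI bd)
qed

lemma OpP_dominated:
  assumes X: "OpP X \<alpha>" and Z: "\<forall>\<^sub>F n in sequentially. Z n \<in> borel_measurable (P n)"
    and le: "\<forall>\<^sub>F n in sequentially. \<forall>y\<in>space (P n). \<bar>Z n y\<bar> \<le> \<bar>X n y\<bar>"
  shows "OpP Z \<alpha>"
proof (rule OpP_combine[OF X X Z])
  fix C D :: real
  show "\<exists>B. \<forall>\<^sub>F n in sequentially. \<forall>y\<in>space (P n).
       \<bar>X n y\<bar> \<le> C * real n powr \<alpha> \<longrightarrow> \<bar>X n y\<bar> \<le> D * real n powr \<alpha> \<longrightarrow> \<bar>Z n y\<bar> \<le> B * real n powr \<alpha>"
  proof (intro exI[of _ C] eventually_mono[OF le] ballI impI)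
    fix n y assume "\<forall>y\<in>space (P n). \<bar>Z n y\<bar> \<le> \<bar>X n y\<bar>" "y \<in> space (P n)" "\<bar>X n y\<bar> \<le> C * real n powr \<alpha>"
    then show "\<bar>Z n y\<bar> \<le> C * real n powr \<alpha>" by (meson order.trans)
  qed
qed

lemma OpP_const:
  assumes "c \<in> O(\<lambda>n. real n powr \<alpha>)"
  shows "OpP (\<lambda>n y. c n) \<alpha>"
proof -
  obtain C where C: "\<forall>\<^sub>F n in sequentially. \<bar>c n\<bar> \<le> C * real n powr \<alpha>"
    using assms bigo_powr_iff by blast
  then have "\<forall>\<^sub>F n in sequentially. measure (P n) {y \<in> space (P n). \<bar>c n\<bar> > C * real n powr \<alpha>} = 0"
    by eventually_elim (simp add: leD)
  then have "\<forall>\<^sub>F n in sequentially. measure (P n) {y \<in> space (P n). \<bar>c n\<bar> > C * real n powr \<alpha>} \<le> \<epsilon>"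
    if "\<epsilon> > 0" for \<epsilon> using that by (auto elim: eventually_mono)
  then show ?thesis unfolding Op_def by auto
qed

lemma OpP_weaken:
  assumes X: "OpP X \<alpha>" and "\<alpha> \<le> \<beta>"
  shows "OpP X \<beta>"
proof (rule OpP_combine[OF X X OpP_measurable[OF X]])
  fix C D :: real assume "C \<ge> 0"
  then have "C * real n powr \<alpha> \<le> C * real n powr \<beta>" if "n \<ge> 1" for n
    using that assms(2) by (intro mult_left_mono powr_mono) auto
  then show "\<exists>B. \<forall>\<^sub>F n in sequentially. \<forall>y\<in>space (P n).
       \<bar>X n y\<bar> \<le> C * real n powr \<alpha> \<longrightarrow> \<bar>X n y\<bar> \<le> D * real n powr \<alpha> \<longrightarrow> \<bar>X n y\<bar> \<le> B * real n powr \<beta>"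
    by (intro exI[of _ C] eventually_sequentiallyI[of 1] ballI impI) (rule order.trans)
qed

lemma OpP_cmult:
  assumes "c \<in> O(\<lambda>n. real n powr \<alpha>)" "OpP X \<beta>" "\<alpha> + \<beta> \<le> \<gamma>"
  shows "OpP (\<lambda>n y. c n * X n y) \<gamma>"
  using OpP_weaken[OF OpP_mult[OF OpP_const[OF assms(1)] assms(2)] assms(3)] .

lemma OpP_uminus: "OpP X \<alpha> \<Longrightarrow> OpP (\<lambda>n y. - X n y) \<alpha>"
  using OpP_cmult[of "\<lambda>_. - 1" 0 X \<alpha> \<alpha>] by (simp add: bigo_const_powr)

lemma OpP_diff: "OpP X \<alpha> \<Longrightarrow> OpP Y \<alpha> \<Longrightarrow> OpP (\<lambda>n y. X n y - Y n y) \<alpha>"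
  using OpP_add[OF _ OpP_uminus, of X \<alpha> Y] by simp

end

section \<open>Orders that hold for all moments\<close>

context prob_sequence
begin

text \<open>
  Unlike stochastic order, an order in \<open>L\<^sup>k\<close> is inherited by expectations; required for every \<open>k\<close> at
  once, it is closed under products.
\<close>

definition moment_order :: "(nat \<Rightarrow> 'a \<Rightarrow> real) \<Rightarrow> real \<Rightarrow> bool" where
  "moment_order X \<alpha> \<longleftrightarrow>
     (\<forall>\<^sub>F n in sequentially. X n \<in> borel_measurable (P n)) \<and>
     (\<forall>k. (\<forall>\<^sub>F n in sequentially. integrable (P n) (\<lambda>y. \<bar>X n y\<bar> ^ k)) \<and>
          (\<lambda>n. LINT y|P n. \<bar>X n y\<bar> ^ k) \<in> O(\<lambda>n. real n powr (\<alpha> * real k)))"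

lemma moment_orderD:
  assumes "moment_order X \<alpha>"
  shows "\<forall>\<^sub>F n in sequentially. X n \<in> borel_measurable (P n)"
    and "\<forall>\<^sub>F n in sequentially. integrable (P n) (\<lambda>y. \<bar>X n y\<bar> ^ k)"
    and "(\<lambda>n. LINT y|P n. \<bar>X n y\<bar> ^ k) \<in> O(\<lambda>n. real n powr (\<alpha> * real k))"
  using assms unfolding moment_order_def by auto

lemma moment_orderI_dominated:
  fixes g :: "nat \<Rightarrow> nat \<Rightarrow> 'a \<Rightarrow> real"
  assumes Z: "\<forall>\<^sub>F n in sequentially. Z n \<in> borel_measurable (P n)"
    and int: "\<And>k. \<forall>\<^sub>F n in sequentially. integrable (P n) (g k n)"
    and bound: "\<And>k. (\<lambda>n. LINT y|P n. g k n y) \<in> O(\<lambda>n. real n powr (\<alpha> * real k))"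
    and le: "\<And>k. \<forall>\<^sub>F n in sequentially. \<forall>y. \<bar>Z n y\<bar> ^ k \<le> g k n y"
  shows "moment_order Z \<alpha>"
  unfolding moment_order_def
proof (intro conjI allI Z)
  fix k
  show i: "\<forall>\<^sub>F n in sequentially. integrable (P n) (\<lambda>y. \<bar>Z n y\<bar> ^ k)"
    using Z int[of k] le[of k]
  proof eventually_elim
    case (elim n)
    note [measurable] = elim(1)
    show ?case
      by (rule Bochner_Integration.integrable_bound[OF elim(2)])
         (measurable, use elim(3) in \<open>auto intro: order.trans[OF _ abs_ge_self]\<close>)
  qed
  show "(\<lambda>n. LINT y|P n. \<bar>Z n y\<bar> ^ k) \<in> O(\<lambda>n. real n powr (\<alpha> * real k))"
  proof (rule landau_o.big_trans[OF _ bound])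
    show "(\<lambda>n. LINT y|P n. \<bar>Z n y\<bar> ^ k) \<in> O(\<lambda>n. LINT y|P n. g k n y)"
    proof (rule landau_o.big_mono)
      show "\<forall>\<^sub>F n in sequentially. norm (LINT y|P n. \<bar>Z n y\<bar> ^ k) \<le> norm (LINT y|P n. g k n y)"
        using i int[of k] le[of k]
      proof eventually_elim
        case (elim n)
        have "(LINT y|P n. \<bar>Z n y\<bar> ^ k) \<le> (LINT y|P n. g k n y)"
          using elim by (intro integral_mono) auto
        moreover have "0 \<le> (LINT y|P n. \<bar>Z n y\<bar> ^ k)" by (intro integral_nonneg_AE) auto
        ultimately show ?case by simp
      qed
    qed
  qed
qed

lemma moment_order_cong:
  assumes X: "moment_order X \<alpha>" and eq: "\<forall>\<^sub>F n in sequentially. \<forall>y. Y n y = X n y"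
  shows "moment_order Y \<alpha>"
proof (rule moment_orderI_dominated[where g = "\<lambda>k n y. \<bar>X n y\<bar> ^ k"])
  show "\<forall>\<^sub>F n in sequentially. Y n \<in> borel_measurable (P n)"
    using moment_orderD(1)[OF X] eq
  proof eventually_elim
    case (elim n)
    then have "Y n = X n" by blast
    then show ?case using elim by simp
  qed
  show "\<forall>\<^sub>F n in sequentially. \<forall>y. \<bar>Y n y\<bar> ^ k \<le> \<bar>X n y\<bar> ^ k" for k
    using eq by eventually_elim simp
qed (rule moment_orderD[OF X])+

lemma moment_order_add:
  assumes X: "moment_order X \<alpha>" and Y: "moment_order Y \<alpha>"
  shows "moment_order (\<lambda>n y. X n y + Y n y) \<alpha>"
proof (rule moment_orderI_dominated[where g = "\<lambda>k n y. 2 ^ k * (\<bar>X n y\<bar> ^ k + \<bar>Y n y\<bar> ^ k)"])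
  show "\<forall>\<^sub>F n in sequentially. (\<lambda>y. X n y + Y n y) \<in> borel_measurable (P n)"
    using moment_orderD(1)[OF X] moment_orderD(1)[OF Y] by eventually_elim measurable
  fix k
  note iX = moment_orderD(2)[OF X, of k] and iY = moment_orderD(2)[OF Y, of k]
  show "\<forall>\<^sub>F n in sequentially. integrable (P n) (\<lambda>y. 2 ^ k * (\<bar>X n y\<bar> ^ k + \<bar>Y n y\<bar> ^ k))"
    using iX iY by eventually_elim auto
  have eq: "\<forall>\<^sub>F n in sequentially. 2 ^ k * ((LINT y|P n. \<bar>X n y\<bar> ^ k) + (LINT y|P n. \<bar>Y n y\<bar> ^ k)) =
    (LINT y|P n. 2 ^ k * (\<bar>X n y\<bar> ^ k + \<bar>Y n y\<bar> ^ k))"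
    using iX iY by eventually_elim auto
  have "(\<lambda>n. 2 ^ k * ((LINT y|P n. \<bar>X n y\<bar> ^ k) + (LINT y|P n. \<bar>Y n y\<bar> ^ k))) \<in> O(\<lambda>n. real n powr (\<alpha> * real k))"
    using sum_in_bigo(1)[OF moment_orderD(3)[OF X, of k] moment_orderD(3)[OF Y, of k]] by simp
  then show "(\<lambda>n. LINT y|P n. 2 ^ k * (\<bar>X n y\<bar> ^ k + \<bar>Y n y\<bar> ^ k)) \<in> O(\<lambda>n. real n powr (\<alpha> * real k))"
    using landau_o.big.in_cong[OF eq] by simp
  have "\<bar>x + y\<bar> ^ k \<le> 2 ^ k * (\<bar>x\<bar> ^ k + \<bar>y\<bar> ^ k)" for x y :: real
  proof -
    have "\<bar>x + y\<bar> \<le> 2 * max \<bar>x\<bar> \<bar>y\<bar>" by auto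
    then have "\<bar>x + y\<bar> ^ k \<le> (2 * max \<bar>x\<bar> \<bar>y\<bar>) ^ k" by (intro power_mono) auto
    also have "\<dots> = 2 ^ k * max \<bar>x\<bar> \<bar>y\<bar> ^ k" by (simp add: power_mult_distrib)
    also have "max \<bar>x\<bar> \<bar>y\<bar> ^ k \<le> \<bar>x\<bar> ^ k + \<bar>y\<bar> ^ k" by (auto simp: max_def)
    finally show ?thesis by simp
  qed
  then show "\<forall>\<^sub>F n in sequentially. \<forall>y. \<bar>X n y + Y n y\<bar> ^ k \<le> 2 ^ k * (\<bar>X n y\<bar> ^ k + \<bar>Y n y\<bar> ^ k)"
    by simp
qed

text \<open>
  The inequality \<open>2 u v \<le> u\<^sup>2 + v\<^sup>2\<close> takes the place of the Cauchy-Schwarz inequality; it is applied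
  after rescaling both factors to the same order.
\<close>

lemma moment_order_mult:
  assumes X: "moment_order X \<alpha>" and Y: "moment_order Y \<beta>"
  shows "moment_order (\<lambda>n y. X n y * Y n y) (\<alpha> + \<beta>)"
proof (rule moment_orderI_dominated[where
    g = "\<lambda>k n y. real n powr ((\<beta> - \<alpha>) * real k) * \<bar>X n y\<bar> ^ (2 * k) + real n powr ((\<alpha> - \<beta>) * real k) * \<bar>Y n y\<bar> ^ (2 * k)"])
  show "\<forall>\<^sub>F n in sequentially. (\<lambda>y. X n y * Y n y) \<in> borel_measurable (P n)"
    using moment_orderD(1)[OF X] moment_orderD(1)[OF Y] by eventually_elim measurable
  fix k
  let ?g = "\<lambda>n y. real n powr ((\<beta> - \<alpha>) * real k) * \<bar>X n y\<bar> ^ (2 * k) + real n powr ((\<alpha> - \<beta>) * real k) * \<bar>Y n y\<bar> ^ (2 * k)"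
  note iX = moment_orderD(2)[OF X, of "2*k"] and iY = moment_orderD(2)[OF Y, of "2*k"]
  show "\<forall>\<^sub>F n in sequentially. integrable (P n) (?g n)"
    using iX iY by eventually_elim auto
  have eq: "\<forall>\<^sub>F n in sequentially. real n powr ((\<beta> - \<alpha>) * real k) * (LINT y|P n. \<bar>X n y\<bar> ^ (2 * k)) + real n powr ((\<alpha> - \<beta>) * real k) * (LINT y|P n. \<bar>Y n y\<bar> ^ (2 * k)) =
    (LINT y|P n. ?g n y)"
    using iX iY by eventually_elim auto
  have "(\<lambda>n. real n powr ((\<beta> - \<alpha>) * real k) * (LINT y|P n. \<bar>X n y\<bar> ^ (2 * k)) + real n powr ((\<alpha> - \<beta>) * real k) * (LINT y|P n. \<bar>Y n y\<bar> ^ (2 * k)))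
      \<in> O(\<lambda>n. real n powr ((\<alpha> + \<beta>) * real k))"
    by (rule sum_in_bigo(1)[OF bigo_powr_mult[OF landau_o.big_refl moment_orderD(3)[OF X, of "2 * k"]]
          bigo_powr_mult[OF landau_o.big_refl moment_orderD(3)[OF Y, of "2 * k"]]])
       (simp_all add: algebra_simps)
  then show "(\<lambda>n. LINT y|P n. ?g n y) \<in> O(\<lambda>n. real n powr ((\<alpha> + \<beta>) * real k))"
    using landau_o.big.in_cong[OF eq] by simp
  show "\<forall>\<^sub>F n in sequentially. \<forall>y. \<bar>X n y * Y n y\<bar> ^ k \<le> ?g n y"
  proof (intro eventually_sequentiallyI[of 1] allI)
    fix n :: nat and y assume n: "1 \<le> n"
    \<comment> \<open>this factor brings the two powers to the same order\<close>
    define w where "w = real n powr ((\<beta> - \<alpha>) * real k / 2)"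
    have w: "w > 0" using n by (simp add: w_def)
    have w2: "real n powr ((\<beta> - \<alpha>) * real k) = w ^ 2"
      by (simp only: w_def power2_eq_square powr_add[symmetric] field_sum_of_halves)
    have "(\<alpha> - \<beta>) * real k = - ((\<beta> - \<alpha>) * real k)" by (simp add: left_diff_distrib)
    then have w3: "real n powr ((\<alpha> - \<beta>) * real k) = (1 / w) ^ 2"
      by (simp only: powr_minus_divide w2 power_one_over)
    have "0 \<le> (w * \<bar>X n y\<bar> ^ k - \<bar>Y n y\<bar> ^ k / w) ^ 2" by simp
    also have "\<dots> = ?g n y - 2 * (\<bar>X n y\<bar> ^ k * \<bar>Y n y\<bar> ^ k)"
      unfolding w2 w3 using w by (simp add: power2_diff power_mult_distrib power_mult[symmetric] power_divide mult.commute[of 2 k])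
    finally have "2 * (\<bar>X n y\<bar> ^ k * \<bar>Y n y\<bar> ^ k) \<le> ?g n y" by simp
    moreover have "0 \<le> \<bar>X n y\<bar> ^ k * \<bar>Y n y\<bar> ^ k" by simp
    ultimately show "\<bar>X n y * Y n y\<bar> ^ k \<le> ?g n y"
      unfolding abs_mult power_mult_distrib by linarith
  qed
qed

text \<open>
  Even moments suffice because \<open>2 t \<le> w + t\<^sup>2 / w\<close>, applied with \<open>t\<close> the power \<open>k\<close> of the variable and
  with \<open>w\<close> the power \<open>k\<close> of its order. Even moments are moments of products, without absolute values.
\<close>

lemma moment_order_even:
  assumes X: "\<forall>\<^sub>F n in sequentially. X n \<in> borel_measurable (P n)"
    and i: "\<And>k. \<forall>\<^sub>F n in sequentially. integrable (P n) (\<lambda>y. X n y ^ (2 * k))"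
    and b: "\<And>k. (\<lambda>n. LINT y|P n. X n y ^ (2 * k)) \<in> O(\<lambda>n. real n powr (\<alpha> * (2 * real k)))"
  shows "moment_order X \<alpha>"
proof (rule moment_orderI_dominated[OF X, where
    g = "\<lambda>k n y. real n powr (\<alpha> * real k) + real n powr (- \<alpha> * real k) * X n y ^ (2 * k)"])
  fix k
  let ?g = "\<lambda>n y. real n powr (\<alpha> * real k) + real n powr (- \<alpha> * real k) * X n y ^ (2 * k)"
  show "\<forall>\<^sub>F n in sequentially. integrable (P n) (?g n)"
    using i[of k] ev_prob
  proof eventually_elim
    case (elim n)
    interpret prob_space "P n" by fact
    show ?case using elim by auto
  qed
  have eq: "\<forall>\<^sub>F n in sequentially. real n powr (\<alpha> * real k) + real n powr (- \<alpha> * real k) * (LINT y|P n. X n y ^ (2 * k)) = (LINT y|P n. ?g n y)"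
    using i[of k] ev_prob
  proof eventually_elim
    case (elim n)
    interpret prob_space "P n" by fact
    show ?case using elim by (subst Bochner_Integration.integral_add) (auto simp: prob_space)
  qed
  have "(\<lambda>n. real n powr (\<alpha> * real k) + real n powr (- \<alpha> * real k) * (LINT y|P n. X n y ^ (2 * k))) \<in> O(\<lambda>n. real n powr (\<alpha> * real k))"
    by (rule sum_in_bigo(1)[OF landau_o.big_refl bigo_powr_mult[OF landau_o.big_refl b[of k]]])
       (simp add: algebra_simps)
  then show "(\<lambda>n. LINT y|P n. ?g n y) \<in> O(\<lambda>n. real n powr (\<alpha> * real k))"
    using landau_o.big.in_cong[OF eq] by simp
  show "\<forall>\<^sub>F n in sequentially. \<forall>y. \<bar>X n y\<bar> ^ k \<le> ?g n y"
  proof (intro eventually_sequentiallyI[of 1] allI)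
    fix n :: nat and y assume n: "1 \<le> n"
    define w where "w = real n powr (\<alpha> * real k)"
    have w: "w > 0" using n by (simp add: w_def)
    have w2: "real n powr (- \<alpha> * real k) = 1 / w"
      by (simp add: w_def powr_minus divide_inverse)
    define t where "t = \<bar>X n y\<bar> ^ k"
    have t: "t \<ge> 0" "X n y ^ (2 * k) = t * t"
      by (simp_all add: t_def power_mult power_mult_distrib[symmetric] power2_eq_square)
    have "0 \<le> (w - t)\<^sup>2 / w" using w by simp
    also have "\<dots> = w + t * t / w - 2 * t" using w by (simp add: power2_eq_square field_simps)
    finally show "\<bar>X n y\<bar> ^ k \<le> ?g n y"
      unfolding w2 t(2) t_def[symmetric] w_def[symmetric] using t(1) by (simp add: algebra_simps)
  qed
qed

lemma moment_order_const:
  assumes "c \<in> O(\<lambda>n. real n powr \<alpha>)"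
  shows "moment_order (\<lambda>n y. c n) \<alpha>"
proof (rule moment_order_even)
  fix k
  show "\<forall>\<^sub>F n in sequentially. integrable (P n) (\<lambda>y. c n ^ (2 * k))"
    using ev_prob by eventually_elim (auto intro: finite_measure.integrable_const simp: prob_space_def)
  have eq: "\<forall>\<^sub>F n in sequentially. c n ^ (2 * k) = (LINT y|P n. c n ^ (2 * k))"
    using ev_prob by eventually_elim (simp add: prob_space.prob_space)
  have 2: "\<forall>\<^sub>F n in sequentially. (real n powr \<alpha>) ^ (2 * k) = real n powr (\<alpha> * (2 * real k))"
    by (intro eventually_sequentiallyI[of 1]) (simp add: powr_power mult.commute)
  have "(\<lambda>n. c n ^ (2 * k)) \<in> O(\<lambda>n. (real n powr \<alpha>) ^ (2 * k))"
    using assms by (rule landau_o.big_power)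
  then show "(\<lambda>n. LINT y|P n. c n ^ (2 * k)) \<in> O(\<lambda>n. real n powr (\<alpha> * (2 * real k)))"
    using landau_o.big.in_cong[OF eq] landau_o.big.cong[OF 2] by simp
qed auto

lemma moment_order_cmult:
  assumes "c \<in> O(\<lambda>n. real n powr \<alpha>)" "moment_order X \<beta>"
  shows "moment_order (\<lambda>n y. c n * X n y) (\<alpha> + \<beta>)"
  using moment_order_mult[OF moment_order_const[OF assms(1)] assms(2)] .

lemma moment_order_weaken:
  assumes X: "moment_order X \<alpha>" and le: "\<alpha> \<le> \<beta>"
  shows "moment_order X \<beta>"
  unfolding moment_order_def
proof (intro conjI allI moment_orderD[OF X])
  fix k :: nat
  have "\<alpha> * real k \<le> \<beta> * real k" using le by (simp add: mult_right_mono)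
  then show "(\<lambda>n. LINT y|P n. \<bar>X n y\<bar> ^ k) \<in> O(\<lambda>n. real n powr (\<beta> * real k))"
    by (rule bigo_powr_weaken[OF moment_orderD(3)[OF X]])
qed

lemma moment_order_uminus: "moment_order X \<alpha> \<Longrightarrow> moment_order (\<lambda>n y. - X n y) \<alpha>"
  using moment_order_cmult[of "\<lambda>_. - 1" 0 X \<alpha>] by (simp add: bigo_const_powr)

lemma moment_order_diff:
  "moment_order X \<alpha> \<Longrightarrow> moment_order Y \<alpha> \<Longrightarrow> moment_order (\<lambda>n y. X n y - Y n y) \<alpha>"
  using moment_order_add[OF _ moment_order_uminus, of X \<alpha> Y] by simp

lemma moment_order_sum:
  assumes "finite I" "\<And>i. i \<in> I \<Longrightarrow> moment_order (X i) \<alpha>"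
  shows "moment_order (\<lambda>n y. \<Sum>i\<in>I. X i n y) \<alpha>"
  using assms
proof (induction I)
  case empty
  then show ?case using moment_order_const[of "\<lambda>_. 0" \<alpha>] by simp
next
  case (insert i I)
  have "moment_order (X i) \<alpha>" "moment_order (\<lambda>n y. \<Sum>i\<in>I. X i n y) \<alpha>"
    using insert.prems insert.IH by simp_all
  from moment_order_add[OF this] show ?case using insert.hyps by simp
qed

lemma moment_order_power: "moment_order X \<alpha> \<Longrightarrow> moment_order (\<lambda>n y. X n y ^ k) (real k * \<alpha>)"
proof (induction k)
  case 0
  then show ?case using moment_order_const[of "\<lambda>_. 1" 0] by (simp add: bigo_const_powr)
next
  case (Suc k)
  show ?case using moment_order_mult[OF Suc.prems Suc.IH[OF Suc.prems]]
    by (simp only: power_Suc of_nat_Suc distrib_right mult_1)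
qed

lemma moment_order_integrable:
  assumes "moment_order X \<alpha>"
  shows "\<forall>\<^sub>F n in sequentially. integrable (P n) (X n)"
  using moment_orderD(1)[OF assms] moment_orderD(2)[OF assms, of 1]
  by eventually_elim (simp only: power_one_right integrable_abs_iff)

lemma moment_order_expectation:
  assumes "moment_order X \<alpha>"
  shows "(\<lambda>n. LINT y|P n. X n y) \<in> O(\<lambda>n. real n powr \<alpha>)"
proof -
  have "(\<lambda>n. LINT y|P n. X n y) \<in> O(\<lambda>n. LINT y|P n. \<bar>X n y\<bar> ^ 1)"
  proof (intro landau_o.big_mono always_eventually allI)
    fix n
    have "\<bar>LINT y|P n. X n y\<bar> \<le> (LINT y|P n. \<bar>X n y\<bar>)" by (rule integral_abs_bound)
    then show "norm (LINT y|P n. X n y) \<le> norm (LINT y|P n. \<bar>X n y\<bar> ^ 1)" by simp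
  qed
  from landau_o.big_trans[OF this moment_orderD(3)[OF assms, of 1]] show ?thesis
    by (simp only: of_nat_1 mult_1_right)
qed

text \<open>
  Markov's inequality for the first absolute moment.
\<close>

lemma moment_order_imp_OpP:
  assumes X: "moment_order X \<alpha>"
  shows "OpP X \<alpha>"
  unfolding Op_def
proof (intro conjI allI impI moment_orderD(1)[OF X])
  fix \<epsilon> :: real assume e: "\<epsilon> > 0"
  obtain C where C: "C \<ge> 0" "\<forall>\<^sub>F n in sequentially. \<bar>LINT y|P n. \<bar>X n y\<bar>\<bar> \<le> C * real n powr \<alpha>"
    using moment_orderD(3)[OF X, of 1] unfolding bigo_powr_iff by auto
  have "\<forall>\<^sub>F n in sequentially. measure (P n) {y \<in> space (P n). \<bar>X n y\<bar> > (C+1)/\<epsilon> * real n powr \<alpha>} \<le> \<epsilon>"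
    using C(2) moment_orderD(1)[OF X] moment_order_integrable[OF X] ev_prob eventually_ge_at_top[of 1]
  proof eventually_elim
    case (elim n)
    interpret prob_space "P n" by fact
    let ?c = "(C+1)/\<epsilon> * real n powr \<alpha>"
    have c: "?c > 0" using elim(5) e C(1) by simp
    have "measure (P n) {y \<in> space (P n). \<bar>X n y\<bar> > ?c} \<le> measure (P n) {y \<in> space (P n). \<bar>X n y\<bar> \<ge> ?c}"
    proof (rule finite_measure_mono)
      note [measurable] = elim(2)
      show "{y \<in> space (P n). \<bar>X n y\<bar> \<ge> ?c} \<in> sets (P n)" by measurable
    qed (auto simp: less_imp_le)
    also have "\<dots> \<le> (LINT y|P n. \<bar>X n y\<bar>) / ?c"
      by (rule integral_Markov_inequality_measure[where A = "{}"]) (use elim(3) c in simp_all)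
    also have "\<dots> \<le> C * real n powr \<alpha> / ?c"
      using elim(1) c by (intro divide_right_mono) linarith+
    also have "\<dots> = C / (C + 1) * \<epsilon>" using e C(1) elim(5) by simp
    also have "\<dots> \<le> 1 * \<epsilon>" using e C(1) by (intro mult_right_mono) auto
    also have "\<dots> = \<epsilon>" by simp
    finally show ?case .
  qed
  then show "\<exists>C. \<forall>\<^sub>F n in sequentially. measure (P n) {y \<in> space (P n). \<bar>X n y\<bar> > C * real n powr \<alpha>} \<le> \<epsilon>"
    by blast
qed

end

section \<open>Moments from cumulants\<close>

lemma prod_nth_eq_prod_index_set:
  fixes g :: "'i \<Rightarrow> real"
  assumes "finite B"
  shows "(\<Prod>j<length (map ((!) xs) (sorted_list_of_set B)). g (map ((!) xs) (sorted_list_of_set B) ! j)) = (\<Prod>j\<in>(B::nat set). g (xs ! j))"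
proof -
  have "(\<Prod>j<length ys. g (ys ! j)) = prod_list (map g ys)" for ys
  proof (induction ys)
    case (Cons a ys)
    then show ?case by (simp add: prod.lessThan_Suc_shift del: prod.lessThan_Suc)
  qed simp
  note prod_nth = this
  show ?thesis
    unfolding prod_nth
    using prod.distinct_set_conv_list[of "sorted_list_of_set B" "\<lambda>j. g (xs ! j)"] assms
    by (simp add: comp_def)
qed

text \<open>
  Instead of inverting the formula that defines cumulants, solve it for the term of the trivial
  partition, which is the moment in question. In the other terms all blocks are smaller, so
  induction gives order \<open>n\<close> to the power half the number of factors; a block of one element vanishes
  because the variables are centred, and the cumulant itself is of order \<open>n\<close>, which is small enough
  from two factors on.
\<close>

lemma product_moments_from_cumulants:
  fixes X :: "'i \<Rightarrow> nat \<Rightarrow> 'a \<Rightarrow> real"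
  assumes cum: "\<And>is. is \<noteq> [] \<Longrightarrow> set is \<subseteq> I \<Longrightarrow>
      (\<lambda>n. joint_cumulant (P n) (map (\<lambda>i. X i n) is)) \<in> O(\<lambda>n. real n)"
    and mean: "\<And>i. i \<in> I \<Longrightarrow> \<forall>\<^sub>F n in sequentially. (LINT y|P n. X i n y) = 0"
  shows "is \<noteq> [] \<Longrightarrow> set is \<subseteq> I \<Longrightarrow>
     (\<lambda>n. LINT y|P n. (\<Prod>j<length is. X (is ! j) n y)) \<in> O(\<lambda>n. real n powr (real (length is) / 2))"
proof (induction "is" rule: length_induct)
  case (1 xs)
  define m where "m = length xs"
  show ?case
  proof (cases "m = 1")
    case True
    then obtain i where i: "xs = [i]" unfolding m_def by (metis One_nat_def length_0_conv length_Suc_conv)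
    have "(\<lambda>n. LINT y|P n. (\<Prod>j<length xs. X (xs ! j) n y)) \<in> O(\<lambda>n. 0)"
      using mean[of i] 1(3) by (simp add: i)
    then show ?thesis by (rule landau_o.big_trans) simp
  next
    case False
    moreover have "m \<noteq> 0" using 1(2) by (simp add: m_def)
    ultimately have m: "m \<ge> 2" by linarith
    define S where "S = {p. partition_on {..<m} p}"
    define p0 where "p0 = {{..<m}}"
    define c :: "nat set set \<Rightarrow> real" where "c p = (- 1) ^ (card p - 1) * fact (card p - 1)" for p
    define w where "w B n = (LINT y|P n. (\<Prod>j\<in>B. X (xs ! j) n y))" for B n
    have finS: "finite S" unfolding S_def by (intro finitely_many_partition_on) simp
    have "0 \<in> {..<m}" using m by simp
    then have "{..<m} \<noteq> {}" by blast
    then have p0: "p0 \<in> S" by (simp add: S_def p0_def partition_on_space)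
    have cum_eq: "joint_cumulant (P n) (map (\<lambda>i. X i n) xs) = (\<Sum>p\<in>S. c p * (\<Prod>B\<in>p. w B n))" for n
    proof -
      have "(\<Prod>j\<in>B. (map (\<lambda>i. X i n) xs ! j) y) = (\<Prod>j\<in>B. X (xs ! j) n y)"
        if "p \<in> S" "B \<in> p" for p B y
      proof (rule prod.cong)
        fix j assume "j \<in> B"
        then have "j \<in> {..<length xs}" using that partition_onD1[of "{..<length xs}" p] by (auto simp: S_def m_def)
        then show "(map (\<lambda>i. X i n) xs ! j) y = X (xs ! j) n y" by simp
      qed simp
      then show ?thesis unfolding joint_cumulant_def
        by (intro sum.cong) (auto simp: S_def m_def c_def w_def intro!: prod.cong)
    qed
    have rest: "(\<lambda>n. c p * (\<Prod>B\<in>p. w B n)) \<in> O(\<lambda>n. real n powr (real m / 2))" if p: "p \<in> S - {p0}" for p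
    proof -
      have part: "partition_on {..<m} p" using p by (simp add: S_def)
      have wB: "w B \<in> O(\<lambda>n. real n powr (real (card B) / 2))" if B: "B \<in> p" for B
      proof -
        have Bsub: "B \<subseteq> {..<m}" "B \<noteq> {}" using part B by (auto simp: partition_on_def)
        have finB: "finite B" using Bsub finite_subset by blast
        have "B \<noteq> {..<m}"
        proof
          assume Bm: "B = {..<m}"
          have "C = B" if "C \<in> p" for C
          proof (rule ccontr)
            assume "C \<noteq> B"
            then have "disjnt C B" using partition_onD2[OF part] that B by (auto simp: pairwise_def)
            moreover have "C \<subseteq> B" "C \<noteq> {}" using part that Bm by (auto simp: partition_on_def)
            ultimately show False by (auto simp: disjnt_def)
          qed
          then have "p = {B}" using B by blast
          then show False using p Bm by (simp add: p0_def)
        qed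
        then have cardB: "card B < m" using Bsub psubset_card_mono[of "{..<m}" B] by auto
        let ?js = "map ((!) xs) (sorted_list_of_set B)"
        have len: "length ?js = card B" by simp
        have "xs ! j \<in> I" if "j \<in> B" for j
        proof -
          have "j < length xs" using that Bsub(1) by (auto simp: m_def)
          then show ?thesis using 1(3) nth_mem by blast
        qed
        then have "set ?js \<subseteq> I" using finB by auto
        moreover have "?js \<noteq> []" using Bsub(2) finB by simp
        moreover have "length ?js < length xs" using cardB len by (simp only: m_def)
        ultimately have "(\<lambda>n. LINT y|P n. (\<Prod>j<length ?js. X (?js ! j) n y)) \<in> O(\<lambda>n. real n powr (real (length ?js) / 2))"
          using 1(1) by blast
        moreover have "(\<Prod>j<length ?js. X (?js ! j) n y) = (\<Prod>j\<in>B. X (xs ! j) n y)" for n y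
          by (rule prod_nth_eq_prod_index_set[OF finB])
        ultimately have "(\<lambda>n. LINT y|P n. (\<Prod>j\<in>B. X (xs ! j) n y)) \<in> O(\<lambda>n. real n powr (real (length ?js) / 2))"
          by (simp only:)
        then show ?thesis unfolding w_def[abs_def] len .
      qed
      have a: "(\<lambda>n. \<Prod>B\<in>p. w B n) \<in> O(\<lambda>n. \<Prod>B\<in>p. real n powr (real (card B) / 2))"
        using wB by (rule landau_o.big_prod)
      have b: "\<forall>\<^sub>F n in sequentially. (\<Prod>B\<in>p. real n powr (real (card B) / 2)) = real n powr (real m / 2)"
      proof (rule eventually_sequentiallyI[of 1])
        fix n :: nat assume "1 \<le> n"
        have "finite p" using part by (rule finite_elements[rotated]) simp
        have "\<And>B. B \<in> p \<Longrightarrow> finite B" using part by (metis Sup_upper finite_lessThan finite_subset partition_onD1)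
        then have "m = (\<Sum>B\<in>p. card B)" using product_partition[OF part] by simp
        then have "real m / 2 = (\<Sum>B\<in>p. real (card B) / 2)" by (simp add: sum_divide_distrib)
        then show "(\<Prod>B\<in>p. real n powr (real (card B) / 2)) = real n powr (real m / 2)"
          using \<open>1 \<le> n\<close> \<open>finite p\<close> by (simp add: powr_sum)
      qed
      have "(\<lambda>n. \<Prod>B\<in>p. w B n) \<in> O(\<lambda>n. real n powr (real m / 2))"
        using a unfolding landau_o.big.cong[OF b] .
      then show ?thesis by (simp only: cmult_in_bigo_iff simp_thms)
    qed
    have "(\<lambda>n. real n) \<in> O(\<lambda>n. real n powr (real m / 2))"
    proof -
      have "real n powr 1 = real n" for n by simp
      moreover have "1 \<le> real m / 2" using m by simp
      ultimately show ?thesis using powr_bigo_mono[of 1 "real m / 2"] by (simp only:)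
    qed
    with cum[OF 1(2) 1(3)] have cumO: "(\<lambda>n. joint_cumulant (P n) (map (\<lambda>i. X i n) xs)) \<in> O(\<lambda>n. real n powr (real m / 2))"
      by (rule landau_o.big_trans)
    have "c p0 * (\<Prod>B\<in>p0. w B n) = w {..<m} n" for n by (simp add: p0_def c_def)
    then have "w {..<m} n = joint_cumulant (P n) (map (\<lambda>i. X i n) xs) - (\<Sum>p\<in>S - {p0}. c p * (\<Prod>B\<in>p. w B n))" for n
      unfolding cum_eq using sum.remove[OF finS p0, of "\<lambda>p. c p * (\<Prod>B\<in>p. w B n)"] by simp
    then have "w {..<m} = (\<lambda>n. joint_cumulant (P n) (map (\<lambda>i. X i n) xs) - (\<Sum>p\<in>S - {p0}. c p * (\<Prod>B\<in>p. w B n)))" by auto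
    then have "w {..<m} \<in> O(\<lambda>n. real n powr (real m / 2))"
      using sum_in_bigo(2)[OF cumO big_sum_in_bigo[OF rest]] by (simp only:)
    then show ?thesis unfolding w_def[abs_def] m_def .
  qed
qed

section \<open>The second Bartlett identity\<close>

lemma pd_eqI: "((\<lambda>h. g (\<theta> + h *\<^sub>R axis r 1)) has_real_derivative D) (at 0) \<Longrightarrow> pd r g \<theta> = D"
  unfolding pd_def by (rule DERIV_imp_deriv)

text \<open>
  Partial derivatives at a point of an open set depend only on the values in that set; this is
  what allows the density to be replaced by the exponential of the loglikelihood.
\<close>

lemma eventually_line_in_open:
  fixes \<theta> :: "real^'d::finite"
  assumes "open S" "\<theta> \<in> S"
  shows "\<forall>\<^sub>F h in nhds 0. \<theta> + h *\<^sub>R axis r 1 \<in> S"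
proof -
  have "((\<lambda>h::real. \<theta> + h *\<^sub>R axis r 1) \<longlongrightarrow> \<theta> + 0 *\<^sub>R axis r 1) (nhds 0)"
    by (intro tendsto_add tendsto_const tendsto_scaleR filterlim_ident)
  from topological_tendstoD[OF this assms(1)] assms(2) show ?thesis by simp
qed

lemma pd_cong_open:
  assumes "open S" "\<theta> \<in> S" "\<And>x. x \<in> S \<Longrightarrow> g x = h x"
  shows "pd r g \<theta> = pd r h \<theta>"
  unfolding pd_def
  by (rule deriv_cong_ev[OF eventually_mono[OF eventually_line_in_open[OF assms(1,2)]]]) (auto intro: assms(3))

lemma pd_const: "pd r (\<lambda>_. c) \<theta> = 0"
  by (intro pd_eqI) simp

lemma second_derivative_zero:
  assumes "open S" "\<theta> \<in> S" "\<And>x. x \<in> S \<Longrightarrow> g x = c"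
  shows "dpart [r, s] g \<theta> = 0"
proof -
  have "pd s g x = 0" if "x \<in> S" for x
    using pd_cong_open[OF assms(1) that, of g "\<lambda>_. c"] assms(3) by (simp add: pd_const)
  then show ?thesis
    using pd_cong_open[OF assms(1,2), of "pd s g" "\<lambda>_. 0"] by (simp add: pd_const)
qed

text \<open>
  Differentiate \<open>g = exp (ln g)\<close> twice.
\<close>

lemma second_derivative_of_density:
  fixes g :: "real^'d::finite \<Rightarrow> real"
  assumes S: "open S" "\<theta> \<in> S" and pos: "\<And>x. x \<in> S \<Longrightarrow> g x > 0"
    and Ck: "Ck_on K S (\<lambda>x. ln (g x))" and K: "K \<ge> 2"
  shows "dpart [r, s] g \<theta> = g \<theta> * (dpart [r] (\<lambda>x. ln (g x)) \<theta> * dpart [s] (\<lambda>x. ln (g x)) \<theta> + dpart [r, s] (\<lambda>x. ln (g x)) \<theta>)"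
proof -
  let ?l = "\<lambda>x. ln (g x)"
  have diff: "((\<lambda>h. dpart rs ?l (x + h *\<^sub>R axis r 1)) has_real_derivative dpart (r # rs) ?l x) (at 0)"
    if "x \<in> S" "length rs < K" for x r rs
  proof -
    have "(\<lambda>h. dpart rs ?l (x + h *\<^sub>R axis r 1)) differentiable (at 0)"
      using Ck that unfolding Ck_on_def by blast
    then show ?thesis unfolding dpart.simps pd_def
      using DERIV_deriv_iff_real_differentiable by blast
  qed
  have g_exp: "\<forall>\<^sub>F h in nhds 0. g (x + h *\<^sub>R axis r 1) = exp (?l (x + h *\<^sub>R axis r 1))"
    if "x \<in> S" for x r
    using eventually_line_in_open[OF S(1) that, of r] by eventually_elim (simp add: pos)
  have dg: "((\<lambda>h. g (x + h *\<^sub>R axis r 1)) has_real_derivative g x * dpart [r] ?l x) (at 0)"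
    if "x \<in> S" for x r
  proof -
    have "((\<lambda>h. exp (?l (x + h *\<^sub>R axis r 1))) has_real_derivative exp (?l (x + 0 *\<^sub>R axis r 1)) * dpart [r] ?l x) (at 0)"
      using DERIV_chain2[OF DERIV_exp diff[OF that, of "[]" r]] K by simp
    then show ?thesis
      using DERIV_cong_ev[OF refl g_exp[OF that] refl] that by (simp add: pos)
  qed
  have "dpart [r, s] g \<theta> = pd r (\<lambda>x. g x * dpart [s] ?l x) \<theta>"
    using pd_cong_open[OF S, of "pd s g" "\<lambda>x. g x * dpart [s] ?l x"] pd_eqI[OF dg] by simp
  also have "\<dots> = g \<theta> * dpart [r] ?l \<theta> * dpart [s] ?l \<theta> + dpart [r, s] ?l \<theta> * g \<theta>"
    by (rule pd_eqI) (use DERIV_mult[OF dg[OF S(2), of r] diff[OF S(2), of "[s]" r]] K in \<open>simp add: mult.commute\<close>)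
  finally show ?thesis by (simp add: algebra_simps)
qed

lemma integrable_Ld_and_mean_lc:
  assumes "prob_space (law f \<theta> n)" "integrable (law f \<theta> n) (lc f \<theta> n rs)"
  shows "integrable (law f \<theta> n) (Ld f \<theta> n rs)" "(LINT y|law f \<theta> n. lc f \<theta> n rs y) = 0"
proof -
  interpret prob_space "law f \<theta> n" by fact
  have "integrable (law f \<theta> n) (\<lambda>y. lc f \<theta> n rs y + lam f \<theta> n rs)" using assms(2) by simp
  then show "integrable (law f \<theta> n) (Ld f \<theta> n rs)" by (simp add: lc_def)
  then show "(LINT y|law f \<theta> n. lc f \<theta> n rs y) = 0"
    by (simp add: lc_def lam_def prob_space)
qed

lemma integral_density_eq_1:
  assumes "f n \<theta> \<in> borel_measurable (leb n)" "\<forall>y\<in>space (leb n). f n \<theta> y \<ge> 0" "prob_space (law f \<theta> n)"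
  shows "(LINT y|leb n. f n \<theta> y) = 1"
proof -
  interpret prob_space "law f \<theta> n" by fact
  have "(LINT y|law f \<theta> n. (1::real)) = (LINT y|leb n. f n \<theta> y *\<^sub>R 1)"
    unfolding law_def using assms(1,2) by (intro integral_density) auto
  then show ?thesis by (simp add: prob_space)
qed

text \<open>
  The second derivative of the density integrates to zero, since the total mass is constantly 1 and
  integration and differentiation may be interchanged. By \<open>second_derivative_of_density\<close> its
  integral is also the expectation of \<open>L\<^sub>r L\<^sub>s + L\<^sub>r\<^sub>s\<close>. Outside of the support of the density both
  sides of that formula are zero, because the support does not depend on the parameter.
\<close>

lemma second_bartlett_identity:
  fixes f :: "'d::finite model"
  assumes model: "regular_model f \<Theta> \<theta> K" and orders: "standing_orders f \<theta> i1 K" and K: "K \<ge> 2"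
  shows "\<forall>\<^sub>F n in sequentially. (LINT y|law f \<theta> n. lc f \<theta> n [r] y * lc f \<theta> n [s] y) = - lam f \<theta> n [r, s]"
proof -
  have \<Theta>: "open \<Theta>" "\<theta> \<in> \<Theta>" using model unfolding regular_model_def by auto
  have int: "\<forall>\<^sub>F n in sequentially. integrable (law f \<theta> n) (\<lambda>y. \<Prod>i<length rss. lc f \<theta> n (rss ! i) y)"
    if "rss \<noteq> []" "\<forall>rs\<in>set rss. 1 \<le> length rs \<and> length rs \<le> K" for rss
    using orders that unfolding standing_orders_def by blast
  have i1: "\<forall>\<^sub>F n in sequentially. integrable (law f \<theta> n) (lc f \<theta> n rs)" if "1 \<le> length rs" "length rs \<le> K" for rs
    using int[of "[rs]"] that by simp
  have i2: "\<forall>\<^sub>F n in sequentially. integrable (law f \<theta> n) (\<lambda>y. lc f \<theta> n [r] y * lc f \<theta> n [s] y)"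
    using int[of "[[r], [s]]"] K by (simp add: lessThan_Suc mult.commute)
  have zero: "\<forall>\<^sub>F n in sequentially. \<forall>r. lam f \<theta> n [r] = 0" using orders unfolding standing_orders_def by blast
  have swap: "\<forall>\<^sub>F n in sequentially. (LINT y|leb n. dpart [r, s] (\<lambda>\<theta>'. f n \<theta>' y) \<theta>) =
          dpart [r, s] (\<lambda>\<theta>'. LINT y|leb n. f n \<theta>' y) \<theta>"
  proof -
    have "\<forall>rs. length rs \<le> K \<longrightarrow> (\<forall>\<^sub>F n in sequentially.
        integrable (leb n) (\<lambda>y. dpart rs (\<lambda>\<theta>'. f n \<theta>' y) \<theta>) \<and>
        (LINT y|leb n. dpart rs (\<lambda>\<theta>'. f n \<theta>' y) \<theta>) =
          dpart rs (\<lambda>\<theta>'. LINT y|leb n. f n \<theta>' y) \<theta>)"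
      using model unfolding regular_model_def by (elim conjE) assumption
    from spec[OF this, of "[r, s]"] have "\<forall>\<^sub>F n in sequentially.
        integrable (leb n) (\<lambda>y. dpart [r, s] (\<lambda>\<theta>'. f n \<theta>' y) \<theta>) \<and>
        (LINT y|leb n. dpart [r, s] (\<lambda>\<theta>'. f n \<theta>' y) \<theta>) =
          dpart [r, s] (\<lambda>\<theta>'. LINT y|leb n. f n \<theta>' y) \<theta>"
      using K by (simp only: length_Cons list.size)
    then show ?thesis by eventually_elim blast
  qed
  have i1': "\<forall>\<^sub>F n in sequentially. integrable (law f \<theta> n) (lc f \<theta> n [r])"
    "\<forall>\<^sub>F n in sequentially. integrable (law f \<theta> n) (lc f \<theta> n [s])"
    "\<forall>\<^sub>F n in sequentially. integrable (law f \<theta> n) (lc f \<theta> n [r, s])"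
    using K by (auto intro!: i1)
  show ?thesis
    using i1' i2 zero swap eventually_ge_at_top[of 1]
  proof eventually_elim
    case (elim n)
    have n: "n \<ge> 1" and i2: "integrable (law f \<theta> n) (\<lambda>y. lc f \<theta> n [r] y * lc f \<theta> n [s] y)" using elim by auto
    have i1: "integrable (law f \<theta> n) (lc f \<theta> n [r])" "integrable (law f \<theta> n) (lc f \<theta> n [s])"
      "integrable (law f \<theta> n) (lc f \<theta> n [r, s])" using elim K by auto
    have meas: "f n x \<in> borel_measurable (leb n)" and nonneg: "\<forall>y\<in>space (leb n). f n x y \<ge> 0"
      and prob: "prob_space (law f x n)" if "x \<in> \<Theta>" for x
      using model n that unfolding regular_model_def by blast+
    have supp: "f n x y > 0 \<longleftrightarrow> f n \<theta> y > 0" if "x \<in> \<Theta>" "y \<in> space (leb n)" for x y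
      using model n that unfolding regular_model_def by blast
    have Ck: "Ck_on K \<Theta> (\<lambda>x. ln (f n x y))" if "y \<in> space (leb n)" "f n \<theta> y > 0" for y
      using model n that unfolding regular_model_def loglik_def[abs_def] by blast
    interpret prob_space "law f \<theta> n" using prob[OF \<Theta>(2)] .
    have lc1: "lc f \<theta> n [r] = Ld f \<theta> n [r]" "lc f \<theta> n [s] = Ld f \<theta> n [s]"
      using elim(5) by (auto simp: lc_def)
    have iL: "integrable (law f \<theta> n) (Ld f \<theta> n [r, s])"
      using integrable_Ld_and_mean_lc(1)[OF prob[OF \<Theta>(2)] i1(3)] .
    let ?H = "\<lambda>y. Ld f \<theta> n [r] y * Ld f \<theta> n [s] y + Ld f \<theta> n [r, s] y"
    have Hm: "?H \<in> borel_measurable (leb n)"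
      using borel_measurable_integrable[OF i2] borel_measurable_integrable[OF iL]
      unfolding lc1 by (simp add: law_def)
    have "dpart [r, s] (\<lambda>x. f n x y) \<theta> = f n \<theta> y * ?H y" if y: "y \<in> space (leb n)" for y
    proof (cases "f n \<theta> y > 0")
      case True
      then show ?thesis
        using second_derivative_of_density[OF \<Theta>, of "\<lambda>x. f n x y" K r s] supp[OF _ y] Ck[OF y True] K
        by (simp add: Ld_def loglik_def[abs_def])
    next
      case False
      then have "f n x y = 0" if "x \<in> \<Theta>" for x
        using supp[OF that y] nonneg[OF that] y by force
      then show ?thesis using second_derivative_zero[OF \<Theta>, of "\<lambda>x. f n x y" 0] \<Theta>(2) by simp
    qed
    then have "(LINT y|leb n. dpart [r, s] (\<lambda>x. f n x y) \<theta>) = (LINT y|leb n. f n \<theta> y *\<^sub>R ?H y)"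
      by (intro Bochner_Integration.integral_cong) auto
    also have "\<dots> = (LINT y|law f \<theta> n. ?H y)"
      unfolding law_def using meas[OF \<Theta>(2)] nonneg[OF \<Theta>(2)] Hm by (intro integral_density[symmetric]) auto
    also have "\<dots> = (LINT y|law f \<theta> n. Ld f \<theta> n [r] y * Ld f \<theta> n [s] y) + lam f \<theta> n [r, s]"
      using i2 iL unfolding lc1 lam_def by simp
    finally have 1: "(LINT y|leb n. dpart [r, s] (\<lambda>x. f n x y) \<theta>) =
      (LINT y|law f \<theta> n. Ld f \<theta> n [r] y * Ld f \<theta> n [s] y) + lam f \<theta> n [r, s]" .
    have "dpart [r, s] (\<lambda>x. LINT y|leb n. f n x y) \<theta> = 0"
      by (rule second_derivative_zero[OF \<Theta>, of _ 1]) (rule integral_density_eq_1[OF meas nonneg prob])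
    then show ?case using 1 elim(6) unfolding lc1 by linarith
  qed
qed

section \<open>Moments of a linear form\<close>

lemma sum_power_2:
  fixes b :: "'i::finite \<Rightarrow> real"
  shows "(\<Sum>r\<in>UNIV. b r) ^ 2 = (\<Sum>(r,s)\<in>UNIV. b r * b s)"
  by (simp add: power2_eq_square sum_product sum.cartesian_product)

lemma sum_power_3:
  fixes b :: "'i::finite \<Rightarrow> real"
  shows "(\<Sum>r\<in>UNIV. b r) ^ 3 = (\<Sum>(r,s,t)\<in>UNIV. b r * b s * b t)"
proof -
  have "(\<Sum>r\<in>UNIV. b r) ^ 3 = (\<Sum>r\<in>UNIV. b r) * (\<Sum>r\<in>UNIV. b r) ^ 2" by (simp add: eval_nat_numeral)
  also have "\<dots> = (\<Sum>r\<in>UNIV. \<Sum>(s,t)\<in>UNIV. b r * (b s * b t))"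
    unfolding sum_power_2 by (simp add: sum_product case_prod_unfold)
  also have "\<dots> = (\<Sum>(r,s,t)\<in>UNIV. b r * b s * b t)"
    by (simp add: sum.cartesian_product case_prod_unfold mult.assoc)
  finally show ?thesis .
qed

lemma sum_power_4:
  fixes b :: "'i::finite \<Rightarrow> real"
  shows "(\<Sum>r\<in>UNIV. b r) ^ 4 = (\<Sum>(r,s,t,u)\<in>UNIV. b r * b s * b t * b u)"
proof -
  have "(\<Sum>r\<in>UNIV. b r) ^ 4 = (\<Sum>r\<in>UNIV. b r) * (\<Sum>r\<in>UNIV. b r) ^ 3" by (simp add: eval_nat_numeral)
  also have "\<dots> = (\<Sum>r\<in>UNIV. \<Sum>(s,t,u)\<in>UNIV. b r * (b s * b t * b u))"
    unfolding sum_power_3 by (simp add: sum_product case_prod_unfold)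
  also have "\<dots> = (\<Sum>(r,s,t,u)\<in>UNIV. b r * b s * b t * b u)"
    by (simp add: sum.cartesian_product case_prod_unfold mult.assoc)
  finally show ?thesis .
qed

text \<open>
  The pairings of four indices that occur in a fourth moment: relabelling the summation indices
  turns the second and the third one into the first.
\<close>

lemma sum_pairings:
  fixes B :: "'i::finite \<Rightarrow> 'i \<Rightarrow> real"
  shows "(\<Sum>(r,s,t,u)\<in>UNIV. B r s * B t u) = (\<Sum>r\<in>UNIV. \<Sum>s\<in>UNIV. B r s) ^ 2"
    and "(\<Sum>(r,s,t,u)\<in>UNIV. B r t * B s u) = (\<Sum>r\<in>UNIV. \<Sum>s\<in>UNIV. B r s) ^ 2"
    and "(\<Sum>(r,s,t,u)\<in>UNIV. B r u * B s t) = (\<Sum>r\<in>UNIV. \<Sum>s\<in>UNIV. B r s) ^ 2"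
proof -
  have nest: "(\<Sum>(r,s,t,u)\<in>UNIV. h r s t u) = (\<Sum>r\<in>UNIV. \<Sum>s\<in>UNIV. \<Sum>t\<in>UNIV. \<Sum>u\<in>UNIV. h r s t u)"
    for h :: "'i \<Rightarrow> 'i \<Rightarrow> 'i \<Rightarrow> 'i \<Rightarrow> real"
    by (simp add: sum.cartesian_product case_prod_unfold)
  have sq: "(\<Sum>r\<in>UNIV. \<Sum>s\<in>UNIV. B r s) ^ 2 = (\<Sum>r\<in>UNIV. \<Sum>s\<in>UNIV. \<Sum>t\<in>UNIV. \<Sum>u\<in>UNIV. B r s * B t u)"
  proof -
    have 1: "(\<Sum>r\<in>UNIV. \<Sum>s\<in>UNIV. B r s) * x = (\<Sum>r\<in>UNIV. \<Sum>s\<in>UNIV. B r s * x)" for x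
      by (simp only: sum_distrib_right)
    have 2: "x * (\<Sum>t\<in>UNIV. \<Sum>u\<in>UNIV. B t u) = (\<Sum>t\<in>UNIV. \<Sum>u\<in>UNIV. x * B t u)" for x
      by (simp only: sum_distrib_left)
    show ?thesis unfolding power2_eq_square 1 unfolding 2 ..
  qed
  show "(\<Sum>(r,s,t,u)\<in>UNIV. B r s * B t u) = (\<Sum>r\<in>UNIV. \<Sum>s\<in>UNIV. B r s) ^ 2"
    by (simp only: sq nest)
  show "(\<Sum>(r,s,t,u)\<in>UNIV. B r t * B s u) = (\<Sum>r\<in>UNIV. \<Sum>s\<in>UNIV. B r s) ^ 2"
    unfolding sq nest
    by (rule sum.cong[OF refl sum.swap])
  show "(\<Sum>(r,s,t,u)\<in>UNIV. B r u * B s t) = (\<Sum>r\<in>UNIV. \<Sum>s\<in>UNIV. B r s) ^ 2"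
    unfolding sq nest
  proof (rule sum.cong[OF refl])
    fix r
    have "(\<Sum>s\<in>UNIV. \<Sum>t\<in>UNIV. \<Sum>u\<in>UNIV. B r u * B s t) = (\<Sum>s\<in>UNIV. \<Sum>u\<in>UNIV. \<Sum>t\<in>UNIV. B r u * B s t)"
      by (rule sum.cong[OF refl sum.swap])
    also have "\<dots> = (\<Sum>u\<in>UNIV. \<Sum>s\<in>UNIV. \<Sum>t\<in>UNIV. B r u * B s t)" by (rule sum.swap)
    finally show "(\<Sum>s\<in>UNIV. \<Sum>t\<in>UNIV. \<Sum>u\<in>UNIV. B r u * B s t) = (\<Sum>s\<in>UNIV. \<Sum>t\<in>UNIV. \<Sum>u\<in>UNIV. B r s * B t u)" .
  qed
qed

context prob_sequence
begin

lemma expectation_of_combination: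
  fixes Z :: "'i::finite \<Rightarrow> nat \<Rightarrow> 'a \<Rightarrow> real"
  assumes "\<And>i. moment_order (Z i) \<alpha>"
  shows "\<forall>\<^sub>F n in sequentially. (LINT y|P n. (\<Sum>i\<in>UNIV. w i n * Z i n y)) = (\<Sum>i\<in>UNIV. w i n * (LINT y|P n. Z i n y))"
proof -
  have "\<forall>\<^sub>F n in sequentially. \<forall>i. integrable (P n) (Z i n)"
    using assms moment_order_integrable by (intro eventually_all_finite) blast
  then show ?thesis
    by eventually_elim (simp add: Bochner_Integration.integral_sum)
qed

text \<open>
  For centred variables the third moment is the third cumulant, so the third moment of the form
  is of order \<open>n\<close> times the cube of the order of its coefficients.
\<close>

lemma third_moment_of_linear_form:
  fixes l :: "'i::finite \<Rightarrow> nat \<Rightarrow> 'a \<Rightarrow> real"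
  assumes c: "\<And>r. c r \<in> O(\<lambda>n. real n powr (- 1 / 2))" and l: "\<And>r. moment_order (l r) (1 / 2)"
    and mean: "\<And>r. \<forall>\<^sub>F n in sequentially. (LINT y|P n. l r n y) = 0"
    and cum: "\<And>r s t. (\<lambda>n. joint_cumulant (P n) [l r n, l s n, l t n]) \<in> O(\<lambda>n. real n)"
  shows "(\<lambda>n. LINT y|P n. (\<Sum>r\<in>UNIV. c r n * l r n y) ^ 3) \<in> O(\<lambda>n. real n powr (- 1 / 2))"
proof (rule bigo_eventually_eq)
  let ?w = "\<lambda>(r, s, t) n. c r n * c s n * c t n" and ?Z = "\<lambda>(r, s, t) n y. l r n y * l s n y * l t n y"
  let ?k = "\<lambda>(r, s, t) n. joint_cumulant (P n) [l r n, l s n, l t n]"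
  have Z: "moment_order (?Z i) (1/2 + 1/2 + 1/2)" for i
    by (cases i, hypsubst, unfold prod.case) (rule moment_order_mult[OF moment_order_mult[OF l l] l])
  have mean': "\<forall>\<^sub>F n in sequentially. \<forall>r. (LINT y|P n. l r n y) = 0"
    using mean by (rule eventually_all_finite)
  show "\<forall>\<^sub>F n in sequentially. (LINT y|P n. (\<Sum>r\<in>UNIV. c r n * l r n y) ^ 3) = (\<Sum>i\<in>UNIV. ?w i n * ?k i n)"
    using expectation_of_combination[of ?Z _ ?w, OF Z] mean'
  proof eventually_elim
    case (elim n)
    have "(LINT y|P n. (\<Sum>r\<in>UNIV. c r n * l r n y) ^ 3) = (LINT y|P n. (\<Sum>i\<in>UNIV. ?w i n * ?Z i n y))"
      unfolding sum_power_3 by (simp add: case_prod_unfold mult_ac)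
    also have "\<dots> = (\<Sum>i\<in>UNIV. ?w i n * (LINT y|P n. ?Z i n y))" by (rule elim(1))
    also have "\<dots> = (\<Sum>i\<in>UNIV. ?w i n * ?k i n)"
    proof (intro sum.cong refl)
      fix i :: "'i \<times> 'i \<times> 'i"
      obtain r s t where i: "i = (r, s, t)" by (cases i)
      have "(LINT y|P n. ([l r n, l s n, l t n] ! j) y) = 0" if "j < 3" for j
        using elim(2) that by (auto simp: less_Suc_eq numeral_3_eq_3)
      then show "?w i n * (LINT y|P n. ?Z i n y) = ?w i n * ?k i n"
        unfolding i using joint_cumulant_3_centred[of "P n" "l r n" "l s n" "l t n"] by simp
    qed
    finally show ?case .
  qed
  show "(\<lambda>n. \<Sum>i\<in>UNIV. ?w i n * ?k i n) \<in> O(\<lambda>n. real n powr (- 1 / 2))"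
  proof (rule big_sum_in_bigo)
    fix i :: "'i \<times> 'i \<times> 'i"
    obtain r s t where i: "i = (r, s, t)" by (cases i)
    have 1: "(\<lambda>n. joint_cumulant (P n) [l r n, l s n, l t n]) \<in> O(\<lambda>n. real n powr 1)"
      by (rule landau_o.big_trans[OF cum]) (rule bigo_eq[OF landau_o.big_refl], simp)
    have "(\<lambda>n. c r n * c s n) \<in> O(\<lambda>n. real n powr (- 1))"
      by (rule bigo_powr_mult[OF c c]) simp
    then have "(\<lambda>n. c r n * c s n * c t n) \<in> O(\<lambda>n. real n powr (- 3 / 2))"
      by (rule bigo_powr_mult[OF _ c]) simp
    then show "(\<lambda>n. ?w i n * ?k i n) \<in> O(\<lambda>n. real n powr (- 1 / 2))"
      unfolding i prod.case by (rule bigo_powr_mult[OF _ 1]) simp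
  qed
qed

text \<open>
  The fourth cumulant of the form is of order \<open>n\<^sup>-\<^sup>1\<close>, and the three pairings contribute three
  times the square of the variance: the fourth moment is asymptotically that of a normal variable
  with the same variance.
\<close>

lemma fourth_moment_of_linear_form:
  fixes l :: "'i::finite \<Rightarrow> nat \<Rightarrow> 'a \<Rightarrow> real"
  assumes c: "\<And>r. c r \<in> O(\<lambda>n. real n powr (- 1 / 2))" and l: "\<And>r. moment_order (l r) (1 / 2)"
    and mean: "\<And>r. \<forall>\<^sub>F n in sequentially. (LINT y|P n. l r n y) = 0"
    and cum: "\<And>r s t u. (\<lambda>n. joint_cumulant (P n) [l r n, l s n, l t n, l u n]) \<in> O(\<lambda>n. real n)"
  shows "(\<lambda>n. (LINT y|P n. (\<Sum>r\<in>UNIV. c r n * l r n y) ^ 4)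
      - 3 * (\<Sum>r\<in>UNIV. \<Sum>s\<in>UNIV. c r n * c s n * (LINT y|P n. l r n y * l s n y)) ^ 2)
      \<in> O(\<lambda>n. real n powr (- 1))"
proof (rule bigo_eventually_eq)
  let ?w = "\<lambda>(r, s, t, u) n. c r n * c s n * c t n * c u n"
  let ?Z = "\<lambda>(r, s, t, u) n y. l r n y * l s n y * l t n y * l u n y"
  let ?k = "\<lambda>(r, s, t, u) n. joint_cumulant (P n) [l r n, l s n, l t n, l u n]"
  define B where "B n r s = c r n * c s n * (LINT y|P n. l r n y * l s n y)" for n r s
  have Z: "moment_order (?Z i) (1/2 + 1/2 + 1/2 + 1/2)" for i
    by (cases i, hypsubst, unfold prod.case)
       (rule moment_order_mult[OF moment_order_mult[OF moment_order_mult[OF l l] l] l])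
  have mean': "\<forall>\<^sub>F n in sequentially. \<forall>r. (LINT y|P n. l r n y) = 0"
    using mean by (rule eventually_all_finite)
  show "\<forall>\<^sub>F n in sequentially. (LINT y|P n. (\<Sum>r\<in>UNIV. c r n * l r n y) ^ 4)
      - 3 * (\<Sum>r\<in>UNIV. \<Sum>s\<in>UNIV. c r n * c s n * (LINT y|P n. l r n y * l s n y)) ^ 2 = (\<Sum>i\<in>UNIV. ?w i n * ?k i n)"
    using expectation_of_combination[of ?Z _ ?w, OF Z] mean'
  proof eventually_elim
    case (elim n)
    have "(LINT y|P n. (\<Sum>r\<in>UNIV. c r n * l r n y) ^ 4) = (LINT y|P n. (\<Sum>i\<in>UNIV. ?w i n * ?Z i n y))"
      unfolding sum_power_4 by (simp add: case_prod_unfold mult_ac)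
    also have "\<dots> = (\<Sum>i\<in>UNIV. ?w i n * (LINT y|P n. ?Z i n y))" by (rule elim(1))
    also have "\<dots> = (\<Sum>(r,s,t,u)\<in>UNIV. ?w (r,s,t,u) n * ?k (r,s,t,u) n + B n r s * B n t u + B n r t * B n s u + B n r u * B n s t)"
    proof (intro sum.cong refl)
      fix i :: "'i \<times> 'i \<times> 'i \<times> 'i"
      obtain r s t u where i: "i = (r, s, t, u)" by (cases i)
      have "(LINT y|P n. ([l r n, l s n, l t n, l u n] ! j) y) = 0" if "j < 4" for j
        using elim(2) that by (auto simp: less_Suc_eq eval_nat_numeral)
      then have "joint_cumulant (P n) [l r n, l s n, l t n, l u n] =
          (LINT y|P n. l r n y * l s n y * l t n y * l u n y)
          - (LINT y|P n. l r n y * l s n y) * (LINT y|P n. l t n y * l u n y)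
          - (LINT y|P n. l r n y * l t n y) * (LINT y|P n. l s n y * l u n y)
          - (LINT y|P n. l r n y * l u n y) * (LINT y|P n. l s n y * l t n y)"
        by (rule joint_cumulant_4_centred)
      then have E: "(LINT y|P n. l r n y * l s n y * l t n y * l u n y) =
          joint_cumulant (P n) [l r n, l s n, l t n, l u n]
          + (LINT y|P n. l r n y * l s n y) * (LINT y|P n. l t n y * l u n y)
          + (LINT y|P n. l r n y * l t n y) * (LINT y|P n. l s n y * l u n y)
          + (LINT y|P n. l r n y * l u n y) * (LINT y|P n. l s n y * l t n y)" by linarith
      show "?w i n * (LINT y|P n. ?Z i n y) = (case i of (r,s,t,u) \<Rightarrow> ?w (r,s,t,u) n * ?k (r,s,t,u) n + B n r s * B n t u + B n r t * B n s u + B n r u * B n s t)"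
        unfolding i prod.case B_def E by (simp only: distrib_left mult_ac)
    qed
    also have "\<dots> = (\<Sum>i\<in>UNIV. ?w i n * ?k i n) + (\<Sum>(r,s,t,u)\<in>UNIV. B n r s * B n t u)
        + (\<Sum>(r,s,t,u)\<in>UNIV. B n r t * B n s u) + (\<Sum>(r,s,t,u)\<in>UNIV. B n r u * B n s t)"
      by (simp add: case_prod_unfold sum.distrib)
    also have "\<dots> = (\<Sum>i\<in>UNIV. ?w i n * ?k i n) + 3 * (\<Sum>r\<in>UNIV. \<Sum>s\<in>UNIV. B n r s) ^ 2"
      unfolding sum_pairings by simp
    finally show ?case unfolding B_def by simp
  qed
  show "(\<lambda>n. \<Sum>i\<in>UNIV. ?w i n * ?k i n) \<in> O(\<lambda>n. real n powr (- 1))"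
  proof (rule big_sum_in_bigo)
    fix i :: "'i \<times> 'i \<times> 'i \<times> 'i"
    obtain r s t u where i: "i = (r, s, t, u)" by (cases i)
    have 1: "(\<lambda>n. joint_cumulant (P n) [l r n, l s n, l t n, l u n]) \<in> O(\<lambda>n. real n powr 1)"
      by (rule landau_o.big_trans[OF cum]) (rule bigo_eq[OF landau_o.big_refl], simp)
    have "(\<lambda>n. c r n * c s n) \<in> O(\<lambda>n. real n powr (- 1))"
      by (rule bigo_powr_mult[OF c c]) simp
    then have "(\<lambda>n. c r n * c s n * c t n) \<in> O(\<lambda>n. real n powr (- 3 / 2))"
      by (rule bigo_powr_mult[OF _ c]) simp
    then have "(\<lambda>n. c r n * c s n * c t n * c u n) \<in> O(\<lambda>n. real n powr (- 2))"
      by (rule bigo_powr_mult[OF _ c]) simp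
    then show "(\<lambda>n. ?w i n * ?k i n) \<in> O(\<lambda>n. real n powr (- 1))"
      unfolding i prod.case by (rule bigo_powr_mult[OF _ 1]) simp
  qed
qed

lemma second_moment_of_linear_form:
  fixes l :: "'i::finite \<Rightarrow> nat \<Rightarrow> 'a \<Rightarrow> real"
  assumes l: "\<And>r. moment_order (l r) (1 / 2)"
  shows "\<forall>\<^sub>F n in sequentially. (LINT y|P n. (\<Sum>r\<in>UNIV. c r n * l r n y) ^ 2) =
      (\<Sum>r\<in>UNIV. \<Sum>s\<in>UNIV. c r n * c s n * (LINT y|P n. l r n y * l s n y))"
proof -
  let ?w = "\<lambda>(r, s) n. c r n * c s n" and ?Z = "\<lambda>(r, s) n y. l r n y * l s n y"
  have Z: "moment_order (?Z i) (1/2 + 1/2)" for i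
    by (cases i, hypsubst, unfold prod.case) (rule moment_order_mult[OF l l])
  show ?thesis
    using expectation_of_combination[of ?Z _ ?w, OF Z]
    by eventually_elim
       (simp add: power2_eq_square sum_product sum.cartesian_product case_prod_unfold mult_ac)
qed

lemma expectation_of_perturbation:
  assumes Y: "moment_order Y \<alpha>" and Z: "moment_order Z \<beta>" and R: "moment_order R \<gamma>"
    and X: "\<And>n y. X n y = Y n y + c n * Z n y + R n y"
  shows "(\<lambda>n. (LINT y|P n. X n y) - (LINT y|P n. Y n y) - c n * (LINT y|P n. Z n y)) \<in> O(\<lambda>n. real n powr \<gamma>)"
proof (rule bigo_eventually_eq[OF moment_order_expectation[OF R]])
  show "\<forall>\<^sub>F n in sequentially. (LINT y|P n. X n y) - (LINT y|P n. Y n y) - c n * (LINT y|P n. Z n y) = (LINT y|P n. R n y)"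
    using moment_order_integrable[OF Y] moment_order_integrable[OF Z] moment_order_integrable[OF R]
    by eventually_elim (simp add: X)
qed

end

section \<open>Cumulants under a quadratic perturbation\<close>

context prob_sequence
begin

text \<open>
  Only the moments of \<open>S\<close> up to order four enter, and they are those of a standard normal variable
  up to \<open>O(n\<^sup>-\<^sup>1\<^sup>/\<^sup>2)\<close>. The quadratic term therefore changes the first three moments by \<open>a\<close>, 0 and
  \<open>3 a \<cdot> 3 = 9 a\<close>, up to \<open>O(n\<^sup>-\<^sup>1)\<close>; terms with two factors of order \<open>n\<^sup>-\<^sup>1\<^sup>/\<^sup>2\<close> are negligible. In the
  third cumulant the product of the first two moments takes away \<open>3 a\<close>, which leaves \<open>6 a\<close>.
\<close>

lemma cumulants_of_quadratic_perturbation: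
  assumes S: "moment_order S 0" and Q: "moment_order Q (- 1 / 2)" and R: "moment_order R (- 1)"
    and a: "a \<in> O(\<lambda>n. real n powr (- 1 / 2))"
    and S1: "\<forall>\<^sub>F n in sequentially. (LINT y|P n. S n y) = 0"
    and S2: "\<forall>\<^sub>F n in sequentially. (LINT y|P n. S n y ^ 2) = 1"
    and S3: "(\<lambda>n. LINT y|P n. S n y ^ 3) \<in> O(\<lambda>n. real n powr (- 1 / 2))"
    and S4: "(\<lambda>n. (LINT y|P n. S n y ^ 4) - 3) \<in> O(\<lambda>n. real n powr (- 1 / 2))"
    and V: "\<And>n y. V n y = S n y + Q n y"
    and V': "\<And>n y. V' n y = V n y + a n * S n y ^ 2 + R n y"
  shows "(\<lambda>n. cumulant (P n) 1 (V n)) \<in> O(\<lambda>n. real n powr (- 1 / 2))"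
    and "(\<lambda>n. cumulant (P n) 2 (V n) - 1) \<in> O(\<lambda>n. real n powr (- 1 / 2))"
    and "(\<lambda>n. cumulant (P n) 3 (V n)) \<in> O(\<lambda>n. real n powr (- 1 / 2))"
    and "(\<lambda>n. cumulant (P n) 1 (V' n) - cumulant (P n) 1 (V n) - a n) \<in> O(\<lambda>n. real n powr (- 1))"
    and "(\<lambda>n. cumulant (P n) 2 (V' n) - cumulant (P n) 2 (V n)) \<in> O(\<lambda>n. real n powr (- 1))"
    and "(\<lambda>n. cumulant (P n) 3 (V' n) - cumulant (P n) 3 (V n) - 6 * a n) \<in> O(\<lambda>n. real n powr (- 1))"
proof -
  define D where "D n y = a n * S n y ^ 2 + R n y" for n y
  define m where "m k n = (LINT y|P n. V n y ^ k)" for k n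
  define m' where "m' k n = (LINT y|P n. V' n y ^ k)" for k n
  define s where "s k n = (LINT y|P n. S n y ^ k)" for k n
  let ?O = "\<lambda>\<alpha>. O(\<lambda>n. real n powr \<alpha>)"
  note mult = moment_order_weaken[OF moment_order_mult] and add = moment_order_add
  have Sk: "moment_order (\<lambda>n y. S n y ^ k) 0" for k
    using moment_order_power[OF S, of k] by (simp only: mult_zero_right)
  have two: "(\<lambda>n. c) \<in> ?O 0" for c :: real by (rule bigo_const_powr) simp
  have sc: "moment_order (\<lambda>n y. c * X n y) \<alpha>" if "moment_order X \<alpha>" for c X \<alpha>
    using moment_order_cmult[OF two that] by (simp only: add_0)
  have aS: "moment_order (\<lambda>n y. a n * S n y ^ 2) (- 1 / 2)"
    using moment_order_cmult[OF a Sk[of 2]] by (simp only: add_0_right)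
  have R': "moment_order R (- 1 / 2)" by (rule moment_order_weaken[OF R]) simp
  have D: "moment_order D (- 1 / 2)" unfolding D_def[abs_def] by (rule add[OF aS R'])
  have Q0: "moment_order Q 0" by (rule moment_order_weaken[OF Q]) simp
  have Vm: "moment_order V 0"
  proof -
    have "V = (\<lambda>n y. S n y + Q n y)" using V by blast
    then show ?thesis using add[OF S Q0] by simp
  qed
  have Vk: "moment_order (\<lambda>n y. V n y ^ k) 0" for k
    using moment_order_power[OF Vm, of k] by (simp only: mult_zero_right)
  have D2: "moment_order (\<lambda>n y. D n y * D n y) (- 1)" by (rule mult[OF D D]) simp
  have D3: "moment_order (\<lambda>n y. D n y * (D n y * D n y)) (- 1)" by (rule mult[OF D D2]) simp
  have SQ: "moment_order (\<lambda>n y. S n y * Q n y) (- 1 / 2)" by (rule mult[OF S Q]) simp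
  have QQ: "moment_order (\<lambda>n y. Q n y * Q n y) (- 1 / 2)" by (rule mult[OF Q Q]) simp
  have W: "moment_order (\<lambda>n y. 2 * (S n y * Q n y) + Q n y * Q n y) (- 1 / 2)"
    by (rule add[OF sc[OF SQ] QQ])
  have "(\<lambda>n. m 1 n) \<in> ?O (- 1 / 2)"
  proof (rule bigo_eventually_eq)
    show "\<forall>\<^sub>F n in sequentially. m 1 n = (m 1 n - s 1 n - 0 * s 1 n)"
      using S1 by eventually_elim (simp add: s_def)
    show "(\<lambda>n. m 1 n - s 1 n - 0 * s 1 n) \<in> ?O (- 1 / 2)"
      unfolding m_def s_def by (rule expectation_of_perturbation[OF Sk Sk Q]) (simp add: V)
  qed
  then have m1: "m 1 \<in> ?O (- 1 / 2)" .
  have m2: "(\<lambda>n. m 2 n - 1) \<in> ?O (- 1 / 2)"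
  proof (rule bigo_eventually_eq)
    show "\<forall>\<^sub>F n in sequentially. m 2 n - 1 = (m 2 n - s 2 n - 0 * s 1 n)"
      using S2 by eventually_elim (simp add: s_def)
    show "(\<lambda>n. m 2 n - s 2 n - 0 * s 1 n) \<in> ?O (- 1 / 2)"
      unfolding m_def s_def
      by (rule expectation_of_perturbation[OF Sk Sk W]) (simp add: V power2_eq_square algebra_simps)
  qed
  have m3: "m 3 \<in> ?O (- 1 / 2)"
  proof (rule bigo_eq)
    have "moment_order (\<lambda>n y. S n y * (2 * (S n y * Q n y) + Q n y * Q n y)) (- 1 / 2)" by (rule mult[OF S W]) simp
    moreover have "moment_order (\<lambda>n y. Q n y * V n y ^ 2) (- 1 / 2)" by (rule mult[OF Q Vk]) simp
    ultimately have r: "moment_order (\<lambda>n y. S n y * (2 * (S n y * Q n y) + Q n y * Q n y) + Q n y * V n y ^ 2) (- 1 / 2)"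
      by (rule add)
    have "(\<lambda>n. m 3 n - s 3 n - 0 * s 1 n) \<in> ?O (- 1 / 2)"
      unfolding m_def s_def
      by (rule expectation_of_perturbation[OF Sk Sk r])
         (simp add: V power2_eq_square power3_eq_cube algebra_simps)
    then show "(\<lambda>n. (m 3 n - s 3 n - 0 * s 1 n) + s 3 n) \<in> ?O (- 1 / 2)"
      using S3 unfolding s_def by (rule sum_in_bigo(1))
  qed simp
  have d1: "(\<lambda>n. m' 1 n - m 1 n - a n) \<in> ?O (- 1)"
  proof (rule bigo_eventually_eq)
    show "\<forall>\<^sub>F n in sequentially. m' 1 n - m 1 n - a n = (m' 1 n - m 1 n - a n * s 2 n)"
      using S2 by eventually_elim (simp add: s_def)
    show "(\<lambda>n. m' 1 n - m 1 n - a n * s 2 n) \<in> ?O (- 1)"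
      unfolding m_def m'_def s_def by (rule expectation_of_perturbation[OF Vk Sk R]) (simp add: V')
  qed
  have d2: "(\<lambda>n. m' 2 n - m 2 n) \<in> ?O (- 1)"
  proof (rule bigo_eq)
    have "moment_order (\<lambda>n y. S n y * R n y) (- 1)" by (rule mult[OF S R]) simp
    moreover have "moment_order (\<lambda>n y. Q n y * D n y) (- 1)" by (rule mult[OF Q D]) simp
    ultimately have r: "moment_order (\<lambda>n y. 2 * (S n y * R n y) + (2 * (Q n y * D n y) + D n y * D n y)) (- 1)"
      by (intro add[OF sc add[OF sc D2]])
    have "(\<lambda>n. m' 2 n - m 2 n - (2 * a n) * s 3 n) \<in> ?O (- 1)"
      unfolding m_def m'_def s_def
      by (rule expectation_of_perturbation[OF Vk Sk r])
         (simp add: V V' D_def power2_eq_square power3_eq_cube algebra_simps)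
    moreover have "(\<lambda>n. (2 * a n) * s 3 n) \<in> ?O (- 1)"
      by (rule bigo_powr_mult[of _ "- 1/2" _ "- 1/2"]) (use a S3 in \<open>simp_all add: s_def[abs_def]\<close>)
    ultimately show "(\<lambda>n. (m' 2 n - m 2 n - (2 * a n) * s 3 n) + (2 * a n) * s 3 n) \<in> ?O (- 1)"
      by (rule sum_in_bigo(1))
  qed simp
  have d3: "(\<lambda>n. m' 3 n - m 3 n - 9 * a n) \<in> ?O (- 1)"
  proof (rule bigo_eq)
    have "moment_order (\<lambda>n y. S n y ^ 2 * R n y) (- 1)" by (rule mult[OF Sk R]) simp
    moreover have "moment_order (\<lambda>n y. (2 * (S n y * Q n y) + Q n y * Q n y) * D n y) (- 1)" by (rule mult[OF W D]) simp
    moreover have "moment_order (\<lambda>n y. V n y * (D n y * D n y)) (- 1)" by (rule mult[OF Vm D2]) simp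
    ultimately have r: "moment_order (\<lambda>n y. 3 * (S n y ^ 2 * R n y) + (3 * ((2 * (S n y * Q n y) + Q n y * Q n y) * D n y)
        + (3 * (V n y * (D n y * D n y)) + D n y * (D n y * D n y)))) (- 1)"
      by (intro add[OF sc add[OF sc add[OF sc D3]]])
    have "(\<lambda>n. m' 3 n - m 3 n - (3 * a n) * s 4 n) \<in> ?O (- 1)"
      unfolding m_def m'_def s_def
    proof (rule expectation_of_perturbation[OF Vk Sk r])
      fix n y
      have e: "V' n y = V n y + D n y" by (simp add: V' D_def)
      have "V' n y ^ 3 = V n y ^ 3 + 3 * (V n y ^ 2 * D n y) + (3 * (V n y * (D n y * D n y)) + D n y * (D n y * D n y))"
        unfolding e by (simp add: power2_eq_square power3_eq_cube algebra_simps)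
      also have "V n y ^ 2 = S n y ^ 2 + (2 * (S n y * Q n y) + Q n y * Q n y)"
        by (simp add: V power2_eq_square algebra_simps)
      also have "3 * ((S n y ^ 2 + (2 * (S n y * Q n y) + Q n y * Q n y)) * D n y) =
          3 * a n * S n y ^ 4 + 3 * (S n y ^ 2 * R n y) + 3 * ((2 * (S n y * Q n y) + Q n y * Q n y) * D n y)"
        by (simp add: D_def eval_nat_numeral algebra_simps)
      finally show "V' n y ^ 3 = V n y ^ 3 + 3 * a n * S n y ^ 4 + (3 * (S n y ^ 2 * R n y) + (3 * ((2 * (S n y * Q n y) + Q n y * Q n y) * D n y)
        + (3 * (V n y * (D n y * D n y)) + D n y * (D n y * D n y))))" by linarith
    qed
    moreover have "(\<lambda>n. (3 * a n) * (s 4 n - 3)) \<in> ?O (- 1)"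
      by (rule bigo_powr_mult[of _ "- 1/2" _ "- 1/2"]) (use a S4 in \<open>simp_all add: s_def[abs_def]\<close>)
    ultimately show "(\<lambda>n. (m' 3 n - m 3 n - (3 * a n) * s 4 n) + (3 * a n) * (s 4 n - 3)) \<in> ?O (- 1)"
      by (rule sum_in_bigo(1))
  qed (simp add: algebra_simps)
  have dm: "(\<lambda>n. m' 1 n - m 1 n) \<in> ?O (- 1 / 2)"
  proof (rule bigo_eq)
    have "(\<lambda>n. m' 1 n - m 1 n - a n) \<in> ?O (- 1 / 2)" by (rule bigo_powr_weaken[OF d1]) simp
    then show "(\<lambda>n. (m' 1 n - m 1 n - a n) + a n) \<in> ?O (- 1 / 2)" using a by (rule sum_in_bigo(1))
  qed simp
  have m1': "m' 1 \<in> ?O (- 1 / 2)"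
    by (rule bigo_eq[OF sum_in_bigo(1)[OF dm m1]]) simp
  have k1: "cumulant (P n) 1 (V n) = m 1 n" "cumulant (P n) 1 (V' n) = m' 1 n" for n
    by (simp_all only: cumulant_1 m_def m'_def power_one_right)
  have k2: "cumulant (P n) 2 (V n) = m 2 n - m 1 n ^ 2" "cumulant (P n) 2 (V' n) = m' 2 n - m' 1 n ^ 2" for n
    by (simp_all only: cumulant_2 m_def m'_def power_one_right)
  have k3: "cumulant (P n) 3 (V n) = m 3 n - 3 * m 2 n * m 1 n + 2 * m 1 n ^ 3"
    "cumulant (P n) 3 (V' n) = m' 3 n - 3 * m' 2 n * m' 1 n + 2 * m' 1 n ^ 3" for n
    by (simp_all only: cumulant_3 m_def m'_def power_one_right)
  have cube: "(\<lambda>n. 2 * (x n * (x n * x n))) \<in> ?O (- 1)" if "x \<in> ?O (- 1 / 2)" for x :: "nat \<Rightarrow> real"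
  proof -
    have x2: "(\<lambda>n. x n * x n) \<in> ?O (- 1)" by (rule bigo_powr_mult[OF that that]) simp
    have "(\<lambda>n. x n * (x n * x n)) \<in> ?O (- 1)" by (rule bigo_powr_mult[OF that x2]) simp
    then show ?thesis by (rule bigo_powr_mult[OF two[of 2]]) simp
  qed
  have bm2: "m 2 \<in> ?O 0"
  proof (rule bigo_eq)
    have "(\<lambda>n. m 2 n - 1) \<in> ?O 0" by (rule bigo_powr_weaken[OF m2]) simp
    then show "(\<lambda>n. (m 2 n - 1) + 1) \<in> ?O 0" using two by (rule sum_in_bigo(1))
  qed simp
  show "(\<lambda>n. cumulant (P n) 1 (V n)) \<in> ?O (- 1 / 2)" unfolding k1 by (rule m1)
  show "(\<lambda>n. cumulant (P n) 2 (V n) - 1) \<in> ?O (- 1 / 2)"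
  proof (rule bigo_eq)
    have "(\<lambda>n. m 1 n * m 1 n) \<in> ?O (- 1 / 2)" by (rule bigo_powr_mult[OF m1 m1]) simp
    with m2 show "(\<lambda>n. (m 2 n - 1) - m 1 n * m 1 n) \<in> ?O (- 1 / 2)" by (rule sum_in_bigo(2))
  qed (simp add: k2 power2_eq_square)
  show "(\<lambda>n. cumulant (P n) 3 (V n)) \<in> ?O (- 1 / 2)"
  proof (rule bigo_eq)
    have "(\<lambda>n. m 2 n * m 1 n) \<in> ?O (- 1 / 2)" by (rule bigo_powr_mult[OF bm2 m1]) simp
    then have "(\<lambda>n. 3 * (m 2 n * m 1 n)) \<in> ?O (- 1 / 2)" by (rule bigo_powr_mult[OF two[of 3]]) simp
    with m3 have "(\<lambda>n. m 3 n - 3 * (m 2 n * m 1 n)) \<in> ?O (- 1 / 2)" by (rule sum_in_bigo(2))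
    moreover have "(\<lambda>n. 2 * (m 1 n * (m 1 n * m 1 n))) \<in> ?O (- 1 / 2)"
      by (rule bigo_powr_weaken[OF cube[OF m1]]) simp
    ultimately show "(\<lambda>n. (m 3 n - 3 * (m 2 n * m 1 n)) + 2 * (m 1 n * (m 1 n * m 1 n))) \<in> ?O (- 1 / 2)"
      by (rule sum_in_bigo(1))
  qed (simp add: k3 power3_eq_cube)
  show "(\<lambda>n. cumulant (P n) 1 (V' n) - cumulant (P n) 1 (V n) - a n) \<in> ?O (- 1)"
    unfolding k1 by (rule d1)
  show "(\<lambda>n. cumulant (P n) 2 (V' n) - cumulant (P n) 2 (V n)) \<in> ?O (- 1)"
  proof (rule bigo_eq)
    have "(\<lambda>n. (m' 1 n - m 1 n) * (m' 1 n + m 1 n)) \<in> ?O (- 1)"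
      by (rule bigo_powr_mult[OF dm sum_in_bigo(1)[OF m1' m1]]) simp
    with d2 show "(\<lambda>n. (m' 2 n - m 2 n) - (m' 1 n - m 1 n) * (m' 1 n + m 1 n)) \<in> ?O (- 1)"
      by (rule sum_in_bigo(2))
  qed (simp add: k2 power2_eq_square algebra_simps)
  show "(\<lambda>n. cumulant (P n) 3 (V' n) - cumulant (P n) 3 (V n) - 6 * a n) \<in> ?O (- 1)"
  proof (rule bigo_eq)
    have "(\<lambda>n. (m' 2 n - m 2 n) * m' 1 n) \<in> ?O (- 1)" by (rule bigo_powr_mult[OF d2 m1']) simp
    moreover have "(\<lambda>n. m 2 n * (m' 1 n - m 1 n - a n)) \<in> ?O (- 1)" by (rule bigo_powr_mult[OF bm2 d1]) simp
    moreover have "(\<lambda>n. (m 2 n - 1) * a n) \<in> ?O (- 1)" by (rule bigo_powr_mult[OF m2 a]) simp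
    ultimately have "(\<lambda>n. (m' 2 n - m 2 n) * m' 1 n + (m 2 n * (m' 1 n - m 1 n - a n) + (m 2 n - 1) * a n)) \<in> ?O (- 1)"
      by (intro sum_in_bigo(1))
    then have "(\<lambda>n. 3 * ((m' 2 n - m 2 n) * m' 1 n + (m 2 n * (m' 1 n - m 1 n - a n) + (m 2 n - 1) * a n))) \<in> ?O (- 1)"
      by (rule bigo_powr_mult[OF two[of 3]]) simp
    moreover have "(\<lambda>n. 2 * (m' 1 n * (m' 1 n * m' 1 n)) - 2 * (m 1 n * (m 1 n * m 1 n))) \<in> ?O (- 1)"
      by (rule sum_in_bigo(2)[OF cube[OF m1'] cube[OF m1]])
    ultimately show "(\<lambda>n. ((m' 3 n - m 3 n - 9 * a n)
       - 3 * ((m' 2 n - m 2 n) * m' 1 n + (m 2 n * (m' 1 n - m 1 n - a n) + (m 2 n - 1) * a n)))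
       + (2 * (m' 1 n * (m' 1 n * m' 1 n)) - 2 * (m 1 n * (m 1 n * m 1 n)))) \<in> ?O (- 1)"
      by (intro sum_in_bigo(1)[OF sum_in_bigo(2)[OF d3]])
  qed (simp add: k3 power3_eq_cube algebra_simps)
qed

end

section \<open>Edgeworth expansions and tail probabilities\<close>

lemma std_normal_density_bounds: "0 < std_normal_density x" "std_normal_density x \<le> 1" "\<bar>x * std_normal_density x\<bar> \<le> 1"
proof -
  have pi: "1 \<le> sqrt (2 * pi)" using pi_gt3 by simp
  have c: "0 < 1 / sqrt (2 * pi)" "1 / sqrt (2 * pi) \<le> 1" using pi by simp_all
  show "0 < std_normal_density x" unfolding std_normal_density_def using c by simp
  have "exp (- x\<^sup>2 / 2) \<le> 1" by simp
  then have "1 / sqrt (2 * pi) * exp (- x\<^sup>2 / 2) \<le> 1 * 1" using c by (intro mult_mono) auto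
  then show "std_normal_density x \<le> 1" unfolding std_normal_density_def by simp
  have "0 \<le> (\<bar>x\<bar> - 1)\<^sup>2" by simp
  then have "\<bar>x\<bar> \<le> 1 + x\<^sup>2 / 2" by (simp add: power2_diff)
  also have "\<dots> \<le> exp (x\<^sup>2 / 2)" by (rule exp_ge_add_one_self)
  finally have "\<bar>x\<bar> * exp (- x\<^sup>2 / 2) \<le> exp (x\<^sup>2 / 2) * exp (- x\<^sup>2 / 2)" by (intro mult_right_mono) auto
  also have "\<dots> = 1" by (simp flip: exp_add)
  finally have "1 / sqrt (2 * pi) * (\<bar>x\<bar> * exp (- x\<^sup>2 / 2)) \<le> 1 * 1" using c by (intro mult_mono) auto
  then show "\<bar>x * std_normal_density x\<bar> \<le> 1" unfolding std_normal_density_def using c by (simp add: abs_mult)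
qed

lemma std_normal_density_lipschitz: "\<bar>std_normal_density x - std_normal_density y\<bar> \<le> \<bar>x - y\<bar>"
proof -
  define c where "c = 1 / sqrt (2 * pi)"
  have "norm (std_normal_density x - std_normal_density y) \<le> 1 * norm (x - y)"
  proof (rule field_differentiable_bound[of UNIV _ "\<lambda>x. - x * std_normal_density x"])
    fix z :: real
    show "(std_normal_density has_field_derivative - z * std_normal_density z) (at z within UNIV)"
      unfolding std_normal_density_def[abs_def] c_def[symmetric] by (auto intro!: derivative_eq_intros)
    show "norm (- z * std_normal_density z) \<le> 1" using std_normal_density_bounds(3)[of z] by simp
  qed auto
  then show ?thesis by simp
qed

text \<open>
  The increment of the distribution function is the integral of the density, which is Lipschitz
  with constant 1 and hence within \<open>\<bar>b - a\<bar>\<close> of its value at \<open>a\<close> on the interval between \<open>a\<close> and \<open>b\<close>.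
\<close>

lemma std_normal_cdf_linear_approx:
  "\<bar>cdf std_normal_distribution b - cdf std_normal_distribution a - std_normal_density a * (b - a)\<bar> \<le> (b - a)\<^sup>2"
proof -
  interpret N: real_distribution std_normal_distribution by (rule real_dist_normal_dist)
  have *: "\<bar>cdf std_normal_distribution v - cdf std_normal_distribution u - std_normal_density c * (v - u)\<bar> \<le> (v - u)\<^sup>2"
    if uv: "u \<le> v" and c: "c \<in> {u..v}" for u v c
  proof (cases "u = v")
    case False
    then have uv: "u < v" using uv by simp
    have "cdf std_normal_distribution v - cdf std_normal_distribution u = measure std_normal_distribution {u<..v}"
      by (rule N.cdf_diff_eq[OF uv])
    also have "\<dots> = (LINT x|std_normal_distribution. indicator {u<..v} x)" by simp
    also have "\<dots> = (LINT x|lborel. std_normal_density x *\<^sub>R indicator {u<..v} x)"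
      by (intro integral_density) auto
    also have "\<dots> = (LINT x|lborel. indicator {u<..v} x * std_normal_density x)" by (simp add: mult.commute)
    finally have 1: "cdf std_normal_distribution v - cdf std_normal_distribution u = (LINT x|lborel. indicator {u<..v} x * std_normal_density x)" .
    have i0: "integrable lborel (\<lambda>x. indicator {u<..v} x :: real)" using uv by simp
    have i1: "integrable lborel (\<lambda>x. indicator {u<..v} x * std_normal_density x)"
    proof (rule Bochner_Integration.integrable_bound[OF i0])
      have "norm (indicator {u<..v} x * std_normal_density x) \<le> norm (indicator {u<..v} x :: real)" for x
        using std_normal_density_bounds(1,2)[of x] by (cases "x \<in> {u<..v}") (simp_all add: less_imp_le)
      then show "AE x in lborel. norm (indicator {u<..v} x * std_normal_density x) \<le> norm (indicator {u<..v} x :: real)"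
        by (intro AE_I2)
    qed measurable
    have i2: "integrable lborel (\<lambda>x. std_normal_density c * indicator {u<..v} x)"
      by (rule integrable_mult_right[OF i0])
    have "(LINT x|lborel. std_normal_density c * indicator {u<..v} x) = std_normal_density c * (v - u)"
      using uv by simp
    then have 2: "(LINT x|lborel. indicator {u<..v} x * std_normal_density x) - std_normal_density c * (v - u) =
      (LINT x|lborel. indicator {u<..v} x * std_normal_density x - std_normal_density c * indicator {u<..v} x)"
      by (simp only: Bochner_Integration.integral_diff[OF i1 i2])
    have "\<bar>LINT x|lborel. indicator {u<..v} x * std_normal_density x - std_normal_density c * indicator {u<..v} x\<bar>
        \<le> (LINT x|lborel. \<bar>indicator {u<..v} x * std_normal_density x - std_normal_density c * indicator {u<..v} x\<bar>)"
      by (rule integral_abs_bound)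
    also have "\<dots> \<le> (LINT x|lborel. (v - u) * indicator {u<..v} x)"
    proof (rule integral_mono)
      show "integrable lborel (\<lambda>x. \<bar>indicator {u<..v} x * std_normal_density x - std_normal_density c * indicator {u<..v} x\<bar>)"
        by (rule integrable_abs[OF Bochner_Integration.integrable_diff[OF i1 i2]])
      show "integrable lborel (\<lambda>x. (v - u) * indicator {u<..v} x)" by (rule integrable_mult_right[OF i0])
      fix x
      have "\<bar>std_normal_density x - std_normal_density c\<bar> \<le> v - u" if "x \<in> {u<..v}"
      proof -
        have "\<bar>x - c\<bar> \<le> v - u" using that c by (simp add: abs_le_iff)
        with std_normal_density_lipschitz[of x c] show ?thesis by linarith
      qed
      then show "\<bar>indicator {u<..v} x * std_normal_density x - std_normal_density c * indicator {u<..v} x\<bar> \<le> (v - u) * indicator {u<..v} x"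
        by (cases "x \<in> {u<..v}") simp_all
    qed
    also have "\<dots> = (v - u)\<^sup>2" using uv by (simp add: power2_eq_square)
    finally show ?thesis unfolding 1 2 .
  qed simp
  show ?thesis
  proof (cases "a \<le> b")
    case True
    then show ?thesis using *[of a b a] by simp
  next
    case False
    then have "\<bar>cdf std_normal_distribution a - cdf std_normal_distribution b - std_normal_density a * (a - b)\<bar> \<le> (a - b)\<^sup>2"
      using *[of b a a] by simp
    moreover have "(a - b)\<^sup>2 = (b - a)\<^sup>2" by (simp add: power2_commute)
    moreover have "cdf std_normal_distribution a - cdf std_normal_distribution b - std_normal_density a * (a - b) =
      - (cdf std_normal_distribution b - cdf std_normal_distribution a - std_normal_density a * (b - a))"
      by (simp add: algebra_simps)
    ultimately show ?thesis by (metis abs_minus_cancel)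
  qed
qed

lemma continuous_std_normal_cdf: "isCont (cdf std_normal_distribution) x"
proof -
  interpret N: real_distribution std_normal_distribution by (rule real_dist_normal_dist)
  have "emeasure std_normal_distribution {x} = 0"
    by (subst emeasure_density) (auto simp: nn_integral_indicator_singleton')
  then show ?thesis unfolding N.isCont_cdf by (simp add: measure_def)
qed

lemma continuous_std_normal_density: "isCont std_normal_density x"
  unfolding std_normal_density_def[abs_def] by (intro continuous_intros) auto

lemma continuous_edgeworth_cdf: "isCont (edgeworth_cdf k1 k2 k3) x"
  unfolding edgeworth_cdf_def[abs_def]
  by (intro continuous_intros continuous_std_normal_cdf continuous_std_normal_density)

text \<open>
  The right tail includes the atom at the observed value, so its complement is the left limit of
  the distribution function; the approximation passes to left limits because \<open>G\<close> is continuous.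
\<close>

lemma right_tail_approx:
  assumes "prob_space M" and X: "X \<in> borel_measurable M" and G: "\<And>x. isCont G x"
    and le: "\<And>x. \<bar>measure M {y \<in> space M. X y \<le> x} - G x\<bar> \<le> \<epsilon>"
  shows "\<bar>right_tail M X y - (1 - G (X y))\<bar> \<le> \<epsilon>"
proof -
  interpret prob_space M by fact
  note [measurable] = X
  let ?x = "X y"
  let ?L = "measure M {z \<in> space M. X z < ?x}"
  have "right_tail M X y = measure M (space M - {z \<in> space M. X z < ?x})"
    unfolding right_tail_def by (rule arg_cong[where f = "measure M"]) auto
  also have "\<dots> = 1 - ?L" by (rule prob_compl) measurable
  finally have rt: "right_tail M X y = 1 - ?L" .
  have "?L \<le> measure M {z \<in> space M. X z \<le> ?x}" by (intro finite_measure_mono) auto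
  then have up: "?L \<le> G ?x + \<epsilon>" using le[of ?x] by linarith
  have "G ?x \<le> ?L + \<epsilon>"
  proof (rule tendsto_upperbound)
    show "(G \<longlongrightarrow> G ?x) (at_left ?x)" using G[of ?x] by (simp add: isCont_def filterlim_at_split)
    show "\<forall>\<^sub>F z in at_left ?x. G z \<le> ?L + \<epsilon>"
      unfolding eventually_at_filter
    proof (intro always_eventually allI impI)
      fix z assume "z \<noteq> ?x" "z \<in> {..<?x}"
      then have "measure M {w \<in> space M. X w \<le> z} \<le> ?L" by (intro finite_measure_mono) auto
      then show "G z \<le> ?L + \<epsilon>" using le[of z] by linarith
    qed
  qed simp
  with up rt show ?thesis by linarith
qed

lemma right_tail_measurable:
  assumes "prob_space M" and X: "X \<in> borel_measurable M"
  shows "right_tail M X \<in> borel_measurable M"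
proof -
  interpret prob_space M by fact
  note [measurable] = X
  have "mono (\<lambda>x. - measure M {z \<in> space M. X z \<ge> x})"
    by (intro monoI) (auto intro!: finite_measure_mono)
  then have "(\<lambda>x. - measure M {z \<in> space M. X z \<ge> x}) \<in> borel_measurable borel"
    by (rule borel_measurable_mono)
  from borel_measurable_uminus[OF measurable_compose[OF X this]]
  show ?thesis by (simp only: right_tail_def[abs_def] minus_minus)
qed

context prob_sequence
begin

lemma OpP_right_tail_edgeworth:
  assumes X: "\<forall>\<^sub>F n in sequentially. X n \<in> borel_measurable (P n)" and ew: "admits_edgeworth P X"
  shows "OpP (\<lambda>n y. right_tail (P n) (X n) y -
    (1 - edgeworth_cdf (cumulant (P n) 1 (X n)) (cumulant (P n) 2 (X n)) (cumulant (P n) 3 (X n)) (X n y))) (- 1)"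
proof -
  let ?G = "\<lambda>n. edgeworth_cdf (cumulant (P n) 1 (X n)) (cumulant (P n) 2 (X n)) (cumulant (P n) 3 (X n))"
  obtain C where C: "\<forall>\<^sub>F n in sequentially. \<forall>x. \<bar>measure (P n) {y \<in> space (P n). X n y \<le> x} - ?G n x\<bar> \<le> C * real n powr (- 1)"
    using ew unfolding admits_edgeworth_def by blast
  have c: "(\<lambda>n. C * real n powr (- 1)) \<in> O(\<lambda>n. real n powr (- 1))"
    by (rule bigo_powr_mult[OF bigo_const_powr[OF order.refl] landau_o.big_refl]) simp
  show ?thesis
  proof (rule OpP_dominated[OF OpP_const[OF c]])
    show "\<forall>\<^sub>F n in sequentially. (\<lambda>y. right_tail (P n) (X n) y - (1 - ?G n (X n y))) \<in> borel_measurable (P n)"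
      using X ev_prob
    proof eventually_elim
      case (elim n)
      have "?G n \<in> borel_measurable borel"
        by (intro borel_measurable_continuous_onI continuous_at_imp_continuous_on ballI continuous_edgeworth_cdf)
      then have "(\<lambda>y. ?G n (X n y)) \<in> borel_measurable (P n)" by (rule measurable_compose[OF elim(1)])
      then show ?case using right_tail_measurable[OF elim(2,1)] by simp
    qed
    show "\<forall>\<^sub>F n in sequentially. \<forall>y\<in>space (P n). \<bar>right_tail (P n) (X n) y - (1 - ?G n (X n y))\<bar> \<le> \<bar>C * real n powr (- 1)\<bar>"
      using X ev_prob C
    proof eventually_elim
      case (elim n)
      show ?case
      proof
        fix y
        have "\<bar>right_tail (P n) (X n) y - (1 - ?G n (X n y))\<bar> \<le> C * real n powr (- 1)"
          by (rule right_tail_approx[OF elim(2,1) continuous_edgeworth_cdf]) (use elim(3) in blast)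
        then show "\<bar>right_tail (P n) (X n) y - (1 - ?G n (X n y))\<bar> \<le> \<bar>C * real n powr (- 1)\<bar>" by linarith
      qed
    qed
  qed
qed

text \<open>
  With \<open>\<Phi> - \<phi> q\<close> and \<open>\<Phi> - \<phi> q'\<close> the two expansions, the shifts of the cumulants give
  \<open>q'(t) = q(t) + a + a (t\<^sup>2 - 1) = q(t) + a t\<^sup>2\<close> up to \<open>O(n\<^sup>-\<^sup>1)\<close>, while passing from \<open>T\<close> to \<open>T'\<close> adds
  \<open>\<phi>(T) a T\<^sup>2\<close> to \<open>\<Phi>\<close>: the two changes cancel. All else is of second order, because \<open>q\<close>, \<open>q'\<close> and
  \<open>T' - T\<close> are of order \<open>n\<^sup>-\<^sup>1\<^sup>/\<^sup>2\<close>.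
\<close>

lemma edgeworth_invariant_under_quadratic_perturbation:
  fixes k1 k2 k3 k1' k2' k3' a :: "nat \<Rightarrow> real"
  assumes T: "OpP T 0" and W: "OpP (\<lambda>n y. T' n y - T n y - a n * T n y ^ 2) (- 1)"
    and a: "a \<in> O(\<lambda>n. real n powr (- 1 / 2))"
    and k: "k1 \<in> O(\<lambda>n. real n powr (- 1 / 2))" "(\<lambda>n. k2 n - 1) \<in> O(\<lambda>n. real n powr (- 1 / 2))" "k3 \<in> O(\<lambda>n. real n powr (- 1 / 2))"
    and d: "(\<lambda>n. k1' n - k1 n - a n) \<in> O(\<lambda>n. real n powr (- 1))" "(\<lambda>n. k2' n - k2 n) \<in> O(\<lambda>n. real n powr (- 1))"
      "(\<lambda>n. k3' n - k3 n - 6 * a n) \<in> O(\<lambda>n. real n powr (- 1))"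
  shows "OpP (\<lambda>n y. edgeworth_cdf (k1' n) (k2' n) (k3' n) (T' n y) - edgeworth_cdf (k1 n) (k2 n) (k3 n) (T n y)) (- 1)"
proof -
  let ?\<phi> = std_normal_density and ?F = "cdf std_normal_distribution"
  let ?O = "\<lambda>\<alpha>. O(\<lambda>n. real n powr \<alpha>)"
  define q where "q n x = k1 n + (k2 n - 1) / 2 * x + k3 n / 6 * (x\<^sup>2 - 1)" for n x
  define q' where "q' n x = k1' n + (k2' n - 1) / 2 * x + k3' n / 6 * (x\<^sup>2 - 1)" for n x
  define U where "U n y = T' n y - T n y - a n * T n y ^ 2" for n y
  define D where "D n y = T' n y - T n y" for n y
  note mult = OpP_weaken[OF OpP_mult]
  have const: "(\<lambda>n. c) \<in> ?O 0" for c :: real by (rule bigo_const_powr) simp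
  have div: "(\<lambda>n. f n / c) \<in> ?O \<alpha>" if "f \<in> ?O \<alpha>" for f :: "nat \<Rightarrow> real" and c \<alpha>
    unfolding divide_inverse by (rule bigo_powr_mult[OF that const]) simp
  have U: "OpP U (- 1)" using W unfolding U_def[abs_def] .
  have T2: "OpP (\<lambda>n y. T n y * T n y) 0" by (rule mult[OF T T]) simp
  have aT2: "OpP (\<lambda>n y. a n * (T n y * T n y)) (- 1 / 2)" by (rule OpP_cmult[OF a T2]) simp
  have U2: "OpP U (- 1 / 2)" by (rule OpP_weaken[OF U]) simp
  have "D = (\<lambda>n y. a n * (T n y * T n y) + U n y)"
    by (intro ext) (simp add: D_def U_def power2_eq_square)
  then have D: "OpP D (- 1 / 2)" using OpP_add[OF aT2 U2] by (simp only:)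
  have T'eq: "T' = (\<lambda>n y. T n y + D n y)" by (intro ext) (simp add: D_def)
  have D0: "OpP D 0" by (rule OpP_weaken[OF D]) simp
  have T': "OpP T' 0" unfolding T'eq by (rule OpP_add[OF T D0])
  note Tm = OpP_measurable[OF T] and T'm = OpP_measurable[OF T']
  have F_m: "?F \<in> borel_measurable borel"
    by (intro borel_measurable_continuous_onI continuous_at_imp_continuous_on ballI continuous_std_normal_cdf)
  have bk1': "k1' \<in> ?O (- 1 / 2)"
  proof -
    have "(\<lambda>n. (k1' n - k1 n - a n) + (k1 n + a n)) \<in> ?O (- 1 / 2)"
      by (rule sum_in_bigo(1)[OF bigo_powr_weaken[OF d(1)] sum_in_bigo(1)[OF k(1) a]]) simp
    then show ?thesis by (simp only: diff_add_cancel add.assoc diff_diff_eq)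
  qed
  have bk2': "(\<lambda>n. k2' n - 1) \<in> ?O (- 1 / 2)"
  proof -
    have "(\<lambda>n. (k2' n - k2 n) + (k2 n - 1)) \<in> ?O (- 1 / 2)"
      by (rule sum_in_bigo(1)[OF bigo_powr_weaken[OF d(2)] k(2)]) simp
    moreover have "(k2' n - k2 n) + (k2 n - 1) = k2' n - 1" for n by simp
    ultimately show ?thesis by (simp only:)
  qed
  have bk3': "k3' \<in> ?O (- 1 / 2)"
  proof -
    have a6: "(\<lambda>n. 6 * a n) \<in> ?O (- 1 / 2)" by (rule bigo_powr_mult[OF const a]) simp
    have "(\<lambda>n. (k3' n - k3 n - 6 * a n) + (k3 n + 6 * a n)) \<in> ?O (- 1 / 2)"
      by (rule sum_in_bigo(1)[OF bigo_powr_weaken[OF d(3)] sum_in_bigo(1)[OF k(3) a6]]) simp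
    moreover have "(k3' n - k3 n - 6 * a n) + (k3 n + 6 * a n) = k3' n" for n by simp
    ultimately show ?thesis by (simp only:)
  qed
  have one: "OpP (\<lambda>n y. 1) 0" by (rule OpP_const[OF const])
  have T2m: "OpP (\<lambda>n y. T n y * T n y - 1) 0" by (rule OpP_diff[OF T2 one])
  have T'2m: "OpP (\<lambda>n y. T' n y * T' n y - 1) 0" by (rule OpP_diff[OF mult[OF T' T'] one]) simp
  \<comment> \<open>first-order Taylor remainder of the normal distribution function\<close>
  define A1 where "A1 n y = ?F (T' n y) - ?F (T n y) - ?\<phi> (T n y) * (T' n y - T n y)" for n y
  have A1: "OpP A1 (- 1)"
  proof (rule OpP_dominated[OF mult[OF D D]])
    show "\<forall>\<^sub>F n in sequentially. A1 n \<in> borel_measurable (P n)"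
      using Tm T'm
    proof eventually_elim
      case (elim n)
      note [measurable] = elim F_m
      show ?case unfolding A1_def[abs_def] by measurable
    qed
    show "\<forall>\<^sub>F n in sequentially. \<forall>y\<in>space (P n). \<bar>A1 n y\<bar> \<le> \<bar>D n y * D n y\<bar>"
      using std_normal_cdf_linear_approx
      by (intro always_eventually allI ballI) (simp add: A1_def D_def power2_eq_square)
  qed simp
  have phi_mult: "OpP (\<lambda>n y. ?\<phi> (T n y) * Z n y) \<alpha>" if Z: "OpP Z \<alpha>" for Z \<alpha>
  proof (rule OpP_dominated[OF Z])
    show "\<forall>\<^sub>F n in sequentially. (\<lambda>y. ?\<phi> (T n y) * Z n y) \<in> borel_measurable (P n)"
      using Tm OpP_measurable[OF Z] by eventually_elim measurable
    have "\<bar>?\<phi> x * z\<bar> \<le> \<bar>z\<bar>" for x z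
      using std_normal_density_bounds(1,2)[of x] mult_right_mono[of "?\<phi> x" 1 "\<bar>z\<bar>"] by (simp add: abs_mult)
    then show "\<forall>\<^sub>F n in sequentially. \<forall>y\<in>space (P n). \<bar>?\<phi> (T n y) * Z n y\<bar> \<le> \<bar>Z n y\<bar>" by simp
  qed
  \<comment> \<open>the change of the Hermite correction at a fixed point, where \<open>a + a (t\<^sup>2 - 1) = a t\<^sup>2\<close> has been removed\<close>
  define A2 where "A2 n y = (k1' n - k1 n - a n) + ((k2' n - k2 n) / 2 * T n y + (k3' n - k3 n - 6 * a n) / 6 * (T n y * T n y - 1))" for n y
  have A2: "OpP A2 (- 1)" unfolding A2_def[abs_def]
    by (rule OpP_add[OF OpP_const[OF d(1)] OpP_add[OF OpP_cmult[OF div[OF d(2)] T] OpP_cmult[OF div[OF d(3)] T2m]]]) simp_all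
  \<comment> \<open>the change of the new Hermite correction when its argument moves from \<open>T\<close> to \<open>T'\<close>\<close>
  define A3 where "A3 n y = D n y * ((k2' n - 1) / 2 + k3' n / 6 * (T' n y + T n y))" for n y
  have A3: "OpP A3 (- 1)" unfolding A3_def[abs_def]
    by (rule mult[OF D OpP_add[OF OpP_const[OF div[OF bk2']] OpP_cmult[OF div[OF bk3'] OpP_add[OF T' T]]]]) simp_all
  have q'T': "OpP (\<lambda>n y. k1' n + ((k2' n - 1) / 2 * T' n y + k3' n / 6 * (T' n y * T' n y - 1))) (- 1 / 2)"
    by (rule OpP_add[OF OpP_const[OF bk1'] OpP_add[OF OpP_cmult[OF div[OF bk2'] T'] OpP_cmult[OF div[OF bk3'] T'2m]]]) simp_all
  \<comment> \<open>the change of the density that multiplies the correction\<close>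
  define A4 where "A4 n y = (?\<phi> (T' n y) - ?\<phi> (T n y)) * (k1' n + ((k2' n - 1) / 2 * T' n y + k3' n / 6 * (T' n y * T' n y - 1)))" for n y
  have A4: "OpP A4 (- 1)"
  proof (rule OpP_dominated[OF mult[OF D q'T']])
    show "\<forall>\<^sub>F n in sequentially. A4 n \<in> borel_measurable (P n)"
      using Tm T'm
    proof eventually_elim
      case (elim n)
      note [measurable] = elim
      show ?case unfolding A4_def[abs_def] by measurable
    qed
    show "\<forall>\<^sub>F n in sequentially. \<forall>y\<in>space (P n). \<bar>A4 n y\<bar> \<le> \<bar>D n y * (k1' n + ((k2' n - 1) / 2 * T' n y + k3' n / 6 * (T' n y * T' n y - 1)))\<bar>"
      by (intro always_eventually allI ballI)
         (unfold A4_def D_def abs_mult, intro mult_right_mono std_normal_density_lipschitz abs_ge_zero)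
  qed simp
  have eq: "edgeworth_cdf (k1' n) (k2' n) (k3' n) (T' n y) - edgeworth_cdf (k1 n) (k2 n) (k3 n) (T n y) =
     A1 n y + ?\<phi> (T n y) * (U n y - A2 n y - A3 n y) - A4 n y" for n y
  proof -
    have e2: "A2 n y = q' n (T n y) - q n (T n y) - a n * T n y ^ 2"
      by (simp add: A2_def q_def q'_def power2_eq_square field_simps)
    have e3: "A3 n y = q' n (T' n y) - q' n (T n y)"
      by (simp add: A3_def q'_def D_def power2_eq_square field_simps)
    have e4: "A4 n y = (?\<phi> (T' n y) - ?\<phi> (T n y)) * q' n (T' n y)"
      by (simp add: A4_def q'_def power2_eq_square)
    show ?thesis
      unfolding e2 e3 e4 edgeworth_cdf_def A1_def U_def q_def[symmetric] q'_def[symmetric] by (simp add: algebra_simps)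
  qed
  show ?thesis unfolding eq
    by (rule OpP_diff[OF OpP_add[OF A1 phi_mult[OF OpP_diff[OF OpP_diff[OF U A2] A3]]] A4])
qed

end

section \<open>The leading term of the pivots\<close>

text \<open>
  The function may be negative at places, where the square root is minus the root of the
  absolute value.
\<close>

lemma sqrt_bigo:
  assumes "f \<in> O(\<lambda>n. real n)"
  shows "(\<lambda>n. sqrt (f n)) \<in> O(\<lambda>n. real n powr (1 / 2))"
proof -
  obtain C where C: "\<forall>\<^sub>F n in sequentially. norm (f n) \<le> C * norm (real n)"
    using assms by (rule landau_o.bigE)
  have "\<forall>\<^sub>F n in sequentially. \<bar>sqrt (f n)\<bar> \<le> sqrt \<bar>C\<bar> * real n powr (1 / 2)"
    using C
  proof eventually_elim
    case (elim n)
    have "\<bar>sqrt (f n)\<bar> = sqrt \<bar>f n\<bar>" by (simp add: abs_if real_sqrt_minus)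
    also have "\<dots> \<le> sqrt (\<bar>C\<bar> * real n)"
    proof (rule real_sqrt_le_mono)
      have "C * real n \<le> \<bar>C\<bar> * real n" by (intro mult_right_mono) auto
      then show "\<bar>f n\<bar> \<le> \<bar>C\<bar> * real n" using elim by simp
    qed
    also have "\<dots> = sqrt \<bar>C\<bar> * real n powr (1 / 2)" by (simp add: real_sqrt_mult powr_half_sqrt)
    finally show ?case .
  qed
  then show ?thesis unfolding bigo_powr_iff by (intro exI[of _ "sqrt \<bar>C\<bar>"]) simp
qed

lemma row_of_inverse:
  assumes "invertible (lam_mat f \<theta> n)"
  shows "(\<Sum>r\<in>UNIV. lam_inv f \<theta> n i r * lam f \<theta> n [r, s]) = (if i = s then 1 else 0)"
proof -
  have "matrix_inv (lam_mat f \<theta> n) ** lam_mat f \<theta> n = mat 1"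
    unfolding matrix_inv_def using assms unfolding invertible_def by (rule someI2_ex) blast
  then have "(matrix_inv (lam_mat f \<theta> n) ** lam_mat f \<theta> n) $ i $ s = mat 1 $ i $ s" by simp
  then show ?thesis by (simp add: matrix_matrix_mult_def mat_def lam_inv_def lam_mat_def)
qed

locale regular_problem =
  fixes f :: "'d::finite model" and \<Theta> :: "(real^'d) set" and \<theta> :: "real^'d" and i1 :: 'd and K :: nat
  assumes K: "K \<ge> 3"
    and model: "regular_model f \<Theta> \<theta> K"
    and orders: "standing_orders f \<theta> i1 K"
begin

abbreviation l :: "'d list \<Rightarrow> nat \<Rightarrow> (nat \<Rightarrow> real) \<Rightarrow> real" where "l rs n \<equiv> lc f \<theta> n rs"
abbreviation rate :: "real \<Rightarrow> (nat \<Rightarrow> real) set" where "rate \<alpha> \<equiv> O(\<lambda>n. real n powr \<alpha>)"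

lemma eventually_prob_law: "\<forall>\<^sub>F n in sequentially. prob_space (law f \<theta> n)"
  using model unfolding regular_model_def by (intro eventually_sequentiallyI[of 1]) blast

sublocale prob_sequence "law f \<theta>"
  by unfold_locales (rule eventually_prob_law)

lemma cumulant_order:
  assumes "rss \<noteq> []" "\<And>rs. rs \<in> set rss \<Longrightarrow> 1 \<le> length rs \<and> length rs \<le> K"
  shows "\<forall>\<^sub>F n in sequentially. integrable (law f \<theta> n) (\<lambda>y. \<Prod>i<length rss. l (rss ! i) n y)"
    and "(\<lambda>n. joint_cumulant (law f \<theta> n) (map (lc f \<theta> n) rss)) \<in> O(\<lambda>n. real n)"
  using orders assms unfolding standing_orders_def by blast+

lemma expectation_l:
  assumes "1 \<le> length rs" "length rs \<le> K"
  shows "\<forall>\<^sub>F n in sequentially. (LINT y|law f \<theta> n. l rs n y) = 0"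
proof -
  have "\<forall>\<^sub>F n in sequentially. integrable (law f \<theta> n) (\<lambda>y. \<Prod>i<length [rs]. l ([rs] ! i) n y)"
    by (rule cumulant_order(1)) (use assms in auto)
  then show ?thesis using eventually_prob_law
    by eventually_elim (simp add: integrable_Ld_and_mean_lc(2))
qed

lemma moment_order_l:
  assumes rs: "1 \<le> length rs" "length rs \<le> K"
  shows "moment_order (l rs) (1 / 2)"
proof (rule moment_order_even)
  show "\<forall>\<^sub>F n in sequentially. l rs n \<in> borel_measurable (law f \<theta> n)"
    using orders rs unfolding standing_orders_def Op_def by blast
  fix k
  have pow: "(\<Prod>i<length (replicate (2 * k) rs). l (replicate (2 * k) rs ! i) n y) = l rs n y ^ (2 * k)" for n y
    by simp
  show "\<forall>\<^sub>F n in sequentially. integrable (law f \<theta> n) (\<lambda>y. l rs n y ^ (2 * k))"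
  proof (cases "k = 0")
    case True
    show ?thesis unfolding True using eventually_prob_law
      by eventually_elim (simp add: finite_measure.integrable_const prob_space_def)
  next
    case False
    then show ?thesis using cumulant_order(1)[of "replicate (2 * k) rs"] rs unfolding pow by simp
  qed
  show "(\<lambda>n. LINT y|law f \<theta> n. l rs n y ^ (2 * k)) \<in> O(\<lambda>n. real n powr (1 / 2 * (2 * real k)))"
  proof (cases "k = 0")
    case True
    have "\<forall>\<^sub>F n in sequentially. (LINT y|law f \<theta> n. l rs n y ^ (2 * k)) = 1"
      using eventually_prob_law by eventually_elim (simp add: True prob_space.prob_space)
    then show ?thesis by (rule bigo_eventually_eq[OF bigo_const_powr, rotated]) simp
  next
    case False
    have "(\<lambda>n. LINT y|law f \<theta> n. (\<Prod>i<length (replicate (2 * k) rs). l (replicate (2 * k) rs ! i) n y))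
       \<in> O(\<lambda>n. real n powr (real (length (replicate (2 * k) rs)) / 2))"
    proof (rule product_moments_from_cumulants[where I = "{rs. 1 \<le> length rs \<and> length rs \<le> K}"])
      fix rss :: "'d list list" assume "rss \<noteq> []" "set rss \<subseteq> {rs. 1 \<le> length rs \<and> length rs \<le> K}"
      then show "(\<lambda>n. joint_cumulant (law f \<theta> n) (map (\<lambda>rs. l rs n) rss)) \<in> O(\<lambda>n. real n)"
        by (intro cumulant_order(2)) blast+
    qed (use expectation_l False rs in auto)
    moreover have "real (length (replicate (2 * k) rs)) / 2 = 1 / 2 * (2 * real k)" by simp
    ultimately show ?thesis unfolding pow by (simp only:)
  qed
qed

lemma score: "moment_order (l [r]) (1 / 2)"
  and score_derivative: "moment_order (l [r, s]) (1 / 2)"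
  using K by (auto intro!: moment_order_l)

lemma lam_order: "(\<lambda>n. lam f \<theta> n [r, s]) \<in> rate 1"
proof -
  have "\<forall>rs. 1 \<le> length rs \<and> length rs \<le> K \<longrightarrow> (\<lambda>n. lam f \<theta> n rs) \<in> O(\<lambda>n. real n)"
    using orders unfolding standing_orders_def by (elim conjE)
  from this[rule_format, of "[r, s]"] have "(\<lambda>n. lam f \<theta> n [r, s]) \<in> O(\<lambda>n. real n)"
    using K by (simp only: list.size) linarith
  moreover have "(\<lambda>n. real n) \<in> rate 1" by (rule bigo_eq[OF landau_o.big_refl]) simp
  ultimately show ?thesis by (rule landau_o.big_trans)
qed

lemma lam_inv_order: "(\<lambda>n. lam_inv f \<theta> n r s) \<in> rate (- 1)"
  using orders unfolding standing_orders_def by blast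

lemma sqrt_eta_order: "(\<lambda>n. sqrt (eta f \<theta> i1 n)) \<in> rate (1 / 2)"
  using orders unfolding standing_orders_def by (intro sqrt_bigo) blast

text \<open>
  The scores have covariance matrix \<open>- \<lambda>\<close>, which ties the coefficients of the leading term to its
  variance.
\<close>

lemma score_covariance:
  "\<forall>\<^sub>F n in sequentially. \<forall>r s. (LINT y|law f \<theta> n. l [r] n y * l [s] n y) = - lam f \<theta> n [r, s]"
  by (intro eventually_all_finite second_bartlett_identity[OF model orders]) (use K in simp)

lemma eventually_invertible: "\<forall>\<^sub>F n in sequentially. invertible (lam_mat f \<theta> n)"
  using orders unfolding standing_orders_def by blast

lemma form_of_inverse_row:
  "\<forall>\<^sub>F n in sequentially. (\<Sum>r\<in>UNIV. \<Sum>s\<in>UNIV. lam_inv f \<theta> n i1 r * lam_inv f \<theta> n i1 s *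
      (LINT y|law f \<theta> n. l [r] n y * l [s] n y)) = - lam_inv f \<theta> n i1 i1"
  using score_covariance eventually_invertible
proof eventually_elim
  case (elim n)
  have "(\<Sum>r\<in>UNIV. \<Sum>s\<in>UNIV. lam_inv f \<theta> n i1 r * lam_inv f \<theta> n i1 s *
      (LINT y|law f \<theta> n. l [r] n y * l [s] n y)) =
     (\<Sum>s\<in>UNIV. \<Sum>r\<in>UNIV. - (lam_inv f \<theta> n i1 s * (lam_inv f \<theta> n i1 r * lam f \<theta> n [r, s])))"
    by (subst sum.swap) (simp add: elim(1) mult_ac)
  also have "\<dots> = - (\<Sum>s\<in>UNIV. lam_inv f \<theta> n i1 s * (\<Sum>r\<in>UNIV. lam_inv f \<theta> n i1 r * lam f \<theta> n [r, s]))"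
    by (simp only: sum_negf sum_distrib_left)
  also have "\<dots> = - lam_inv f \<theta> n i1 i1"
    unfolding row_of_inverse[OF elim(2)] by (simp add: if_distrib[where f = "\<lambda>x. _ * x"] cong: if_cong)
  finally show ?case .
qed

text \<open>
  With \<open>Z = \<Sum> \<lambda>\<^sup>1\<^sup>r l\<^sub>r\<close> one has \<open>E Z\<^sup>2 = - \<lambda>\<^sup>1\<^sup>1\<close> and \<open>E (Z l\<^sub>1) = - 1\<close>. The first gives \<open>\<lambda>\<^sup>1\<^sup>1 \<le> 0\<close>; by the second
  \<open>Z\<close> is not zero, so equality is impossible. The strict sign
  is what makes the squared square root of \<open>\<eta>\<close> equal to \<open>\<eta>\<close>.
\<close>

lemma eta_pos: "\<forall>\<^sub>F n in sequentially. eta f \<theta> i1 n > 0 \<and> lam_inv f \<theta> n i1 i1 < 0"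
proof -
  let ?u = "\<lambda>r n. lam_inv f \<theta> n i1 r"
  define Z where "Z n y = (\<Sum>r\<in>UNIV. ?u r n * l [r] n y)" for n y
  have Z: "moment_order Z (- 1 + 1 / 2)"
    unfolding Z_def[abs_def] by (intro moment_order_sum moment_order_cmult lam_inv_order score) simp
  have Z2: "\<forall>\<^sub>F n in sequentially. (LINT y|law f \<theta> n. Z n y ^ 2) = - ?u i1 n"
    using second_moment_of_linear_form[of "\<lambda>r. l [r]" ?u, OF score] form_of_inverse_row
    unfolding Z_def by eventually_elim simp
  have Zl: "\<forall>\<^sub>F n in sequentially. (LINT y|law f \<theta> n. Z n y * l [i1] n y) = - 1"
    using expectation_of_combination[of "\<lambda>r n y. l [r] n y * l [i1] n y" "1/2 + 1/2" ?u, OF moment_order_mult[OF score score]]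
      score_covariance eventually_invertible
  proof eventually_elim
    case (elim n)
    have "(LINT y|law f \<theta> n. Z n y * l [i1] n y) = (LINT y|law f \<theta> n. (\<Sum>r\<in>UNIV. ?u r n * (l [r] n y * l [i1] n y)))"
      unfolding Z_def by (simp only: sum_distrib_right mult.assoc)
    also have "\<dots> = (\<Sum>r\<in>UNIV. - (?u r n * lam f \<theta> n [r, i1]))" unfolding elim(1) by (simp add: elim(2))
    also have "\<dots> = - 1" using row_of_inverse[OF elim(3), of i1 i1] by (simp add: sum_negf)
    finally show ?case .
  qed
  show ?thesis
    using Z2 Zl moment_order_integrable[OF moment_order_power[OF Z, of 2]]
      moment_order_integrable[OF moment_order_mult[OF Z score[of i1]]]
      moment_order_integrable[OF moment_order_power[OF score[of i1], of 2]]
  proof eventually_elim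
    case (elim n)
    define v where "v = (LINT y|law f \<theta> n. l [i1] n y ^ 2)"
    have v: "v \<ge> 0" unfolding v_def by (intro integral_nonneg_AE) simp
    have quad: "0 \<le> - ?u i1 n - 2 * t + t ^ 2 * v" for t
    proof -
      have "0 \<le> (LINT y|law f \<theta> n. (Z n y + t * l [i1] n y) ^ 2)" by (intro integral_nonneg_AE) simp
      also have "(\<lambda>y. (Z n y + t * l [i1] n y) ^ 2) =
          (\<lambda>y. Z n y ^ 2 + ((2 * t) * (Z n y * l [i1] n y) + t ^ 2 * l [i1] n y ^ 2))"
        by (intro ext) (simp add: power2_eq_square algebra_simps)
      also have "(LINT y|law f \<theta> n. Z n y ^ 2 + ((2 * t) * (Z n y * l [i1] n y) + t ^ 2 * l [i1] n y ^ 2)) =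
          - ?u i1 n - 2 * t + t ^ 2 * v"
        using elim unfolding v_def by (simp add: Bochner_Integration.integral_add)
      finally show ?thesis .
    qed
    have "?u i1 n \<noteq> 0"
    proof
      assume u: "?u i1 n = 0"
      \<comment> \<open>the quadratic \<open>- 2 t + t\<^sup>2 v\<close> is negative here, as \<open>t v < 1\<close>\<close>
      define t where "t = 1 / (v + 1)"
      have t: "t > 0" "t * v = 1 - t" using v by (simp_all add: t_def field_simps)
      have "t ^ 2 * v = t * (t * v)" by (simp add: power2_eq_square)
      also have "\<dots> = t - t ^ 2" unfolding t(2) by (simp add: power2_eq_square algebra_simps)
      finally have "0 \<le> - t - t ^ 2" using quad[of t] u by simp
      then show False using t(1) zero_le_power2[of t] by linarith
    qed
    moreover have "?u i1 n \<le> 0" using quad[of 0] by simp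
    ultimately have "?u i1 n < 0" by simp
    then show ?case by (simp add: eta_def)
  qed
qed

definition leading :: "nat \<Rightarrow> (nat \<Rightarrow> real) \<Rightarrow> real" where
  "leading n y = sqrt (eta f \<theta> i1 n) * T1 f \<theta> i1 n y"

definition weight :: "'d \<Rightarrow> nat \<Rightarrow> real" where
  "weight r n = - sqrt (eta f \<theta> i1 n) * lam_inv f \<theta> n i1 r"

lemma weight_order: "weight r \<in> rate (- 1 / 2)"
proof (rule bigo_eq)
  have "(\<lambda>n. sqrt (eta f \<theta> i1 n) * lam_inv f \<theta> n i1 r) \<in> rate (- 1 / 2)"
    by (rule bigo_powr_mult[OF sqrt_eta_order lam_inv_order]) simp
  then show "(\<lambda>n. (- 1) * (sqrt (eta f \<theta> i1 n) * lam_inv f \<theta> n i1 r)) \<in> rate (- 1 / 2)"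
    by (rule bigo_powr_mult[OF bigo_const_powr[OF order.refl]]) simp
qed (simp add: weight_def)

lemma leading_eq: "leading n y = (\<Sum>r\<in>UNIV. weight r n * l [r] n y)"
  by (simp add: leading_def T1_def weight_def sum_distrib_left sum_negf mult.assoc)

lemma moment_order_leading: "moment_order leading 0"
proof -
  have "moment_order (\<lambda>n y. weight r n * l [r] n y) 0" for r
    by (rule moment_order_weaken[OF moment_order_cmult[OF weight_order score]]) simp
  then show ?thesis unfolding leading_eq[abs_def] by (intro moment_order_sum) simp_all
qed

lemma leading_square:
  "\<forall>\<^sub>F n in sequentially. \<forall>y. leading n y ^ 2 = (\<Sum>r\<in>UNIV. \<Sum>s\<in>UNIV. tau f \<theta> i1 n r s * l [r] n y * l [s] n y)"
  using eta_pos
proof eventually_elim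
  case (elim n)
  have e: "weight r n * weight s n = tau f \<theta> i1 n r s" for r s
    using elim by (simp add: weight_def tau_def)
  show ?case
  proof
    fix y
    have "leading n y ^ 2 = (\<Sum>r\<in>UNIV. \<Sum>s\<in>UNIV. (weight r n * weight s n) * l [r] n y * l [s] n y)"
      by (simp add: leading_eq power2_eq_square sum_product mult_ac)
    then show "leading n y ^ 2 = (\<Sum>r\<in>UNIV. \<Sum>s\<in>UNIV. tau f \<theta> i1 n r s * l [r] n y * l [s] n y)"
      unfolding e .
  qed
qed

lemma variance_form_of_leading:
  "\<forall>\<^sub>F n in sequentially. (\<Sum>r\<in>UNIV. \<Sum>s\<in>UNIV. weight r n * weight s n * (LINT y|law f \<theta> n. l [r] n y * l [s] n y)) = 1"
  using eta_pos form_of_inverse_row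
proof eventually_elim
  case (elim n)
  have e: "weight r n * weight s n = eta f \<theta> i1 n * (lam_inv f \<theta> n i1 r * lam_inv f \<theta> n i1 s)" for r s
    using elim(1) by (simp add: weight_def)
  have "(\<Sum>r\<in>UNIV. \<Sum>s\<in>UNIV. weight r n * weight s n * (LINT y|law f \<theta> n. l [r] n y * l [s] n y)) =
     eta f \<theta> i1 n * (\<Sum>r\<in>UNIV. \<Sum>s\<in>UNIV. lam_inv f \<theta> n i1 r * lam_inv f \<theta> n i1 s * (LINT y|law f \<theta> n. l [r] n y * l [s] n y))"
    unfolding e by (simp only: sum_distrib_left mult.assoc)
  also have "\<dots> = 1" unfolding elim(2) using elim(1) by (simp add: eta_def)
  finally show ?case .
qed

lemma moments_of_leading:
  shows "\<forall>\<^sub>F n in sequentially. (LINT y|law f \<theta> n. leading n y) = 0"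
    and "\<forall>\<^sub>F n in sequentially. (LINT y|law f \<theta> n. leading n y ^ 2) = 1"
    and "(\<lambda>n. LINT y|law f \<theta> n. leading n y ^ 3) \<in> rate (- 1 / 2)"
    and "(\<lambda>n. (LINT y|law f \<theta> n. leading n y ^ 4) - 3) \<in> rate (- 1 / 2)"
proof -
  have mean: "\<forall>\<^sub>F n in sequentially. (LINT y|law f \<theta> n. l [r] n y) = 0" for r
    using K by (intro expectation_l) auto
  have "\<forall>\<^sub>F n in sequentially. \<forall>r. (LINT y|law f \<theta> n. l [r] n y) = 0"
    using mean by (rule eventually_all_finite)
  then show "\<forall>\<^sub>F n in sequentially. (LINT y|law f \<theta> n. leading n y) = 0"
    using expectation_of_combination[of "\<lambda>r. l [r]" "1/2" weight, OF score]
    by eventually_elim (simp add: leading_eq)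
  show "\<forall>\<^sub>F n in sequentially. (LINT y|law f \<theta> n. leading n y ^ 2) = 1"
    using second_moment_of_linear_form[of "\<lambda>r. l [r]" weight, OF score] variance_form_of_leading
    by eventually_elim (simp add: leading_eq)
  have cum3: "(\<lambda>n. joint_cumulant (law f \<theta> n) [l [r] n, l [s] n, l [t] n]) \<in> O(\<lambda>n. real n)" for r s t
    by (rule cumulant_order(2)[of "[[r], [s], [t]]", unfolded list.map]) (use K in auto)
  have cum4: "(\<lambda>n. joint_cumulant (law f \<theta> n) [l [r] n, l [s] n, l [t] n, l [u] n]) \<in> O(\<lambda>n. real n)" for r s t u
    by (rule cumulant_order(2)[of "[[r], [s], [t], [u]]", unfolded list.map]) (use K in auto)
  show "(\<lambda>n. LINT y|law f \<theta> n. leading n y ^ 3) \<in> rate (- 1 / 2)"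
    unfolding leading_eq by (rule third_moment_of_linear_form[OF weight_order score mean cum3])
  show "(\<lambda>n. (LINT y|law f \<theta> n. leading n y ^ 4) - 3) \<in> rate (- 1 / 2)"
  proof (rule bigo_eventually_eq)
    show "(\<lambda>n. (LINT y|law f \<theta> n. leading n y ^ 4) - 3 *
        (\<Sum>r\<in>UNIV. \<Sum>s\<in>UNIV. weight r n * weight s n * (LINT y|law f \<theta> n. l [r] n y * l [s] n y)) ^ 2) \<in> rate (- 1 / 2)"
      unfolding leading_eq
      by (rule bigo_powr_weaken[OF fourth_moment_of_linear_form[OF weight_order score mean cum4]]) simp
    show "\<forall>\<^sub>F n in sequentially. (LINT y|law f \<theta> n. leading n y ^ 4) - 3 = (LINT y|law f \<theta> n. leading n y ^ 4) - 3 *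
        (\<Sum>r\<in>UNIV. \<Sum>s\<in>UNIV. weight r n * weight s n * (LINT y|law f \<theta> n. l [r] n y * l [s] n y)) ^ 2"
      using variance_form_of_leading by eventually_elim simp
  qed
qed

text \<open>
  A product of two centred loglikelihood derivatives is of order \<open>n\<close>, and the square root of \<open>\<eta>\<close>
  contributes \<open>n\<^sup>1\<^sup>/\<^sup>2\<close>.
\<close>

lemma moment_order_quadratic_forms:
  assumes "\<And>r s t. (\<lambda>n. w3 n r s t) \<in> rate \<alpha>" and "\<And>r s. (\<lambda>n. w2 n r s) \<in> rate \<alpha>"
  shows "moment_order (\<lambda>n y. sqrt (eta f \<theta> i1 n) * T2 f \<theta> w3 w2 n y) (\<alpha> + 3 / 2)"
proof -
  have 3: "moment_order (\<lambda>n y. w3 n r s t * l [r, s] n y * l [t] n y) (\<alpha> + 1)" for r s t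
    by (rule moment_order_weaken[OF moment_order_mult[OF moment_order_cmult[OF assms(1) score_derivative] score]]) simp
  have 2: "moment_order (\<lambda>n y. w2 n r s * l [r] n y * l [s] n y) (\<alpha> + 1)" for r s
    by (rule moment_order_weaken[OF moment_order_mult[OF moment_order_cmult[OF assms(2) score] score]]) simp
  have "moment_order (T2 f \<theta> w3 w2) (\<alpha> + 1)"
    unfolding T2_def[abs_def] by (intro moment_order_diff moment_order_sum 2 3) simp_all
  from moment_order_cmult[OF sqrt_eta_order this] show ?thesis
    by (rule moment_order_weaken) simp
qed

lemma expansion_eq: "expansion f \<theta> i1 \<xi>3 \<xi>2 n y = leading n y + sqrt (eta f \<theta> i1 n) * T2 f \<theta> \<xi>3 \<xi>2 n y"
  by (simp add: expansion_def leading_def distrib_left)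

text \<open>
  The coefficient \<open>a\<close> of the squared leading term in the difference of two expansions whose
  quadratic coefficients differ by \<open>\<delta>\<close>.
\<close>

definition quadratic_coefficient :: "(nat \<Rightarrow> 'd \<Rightarrow> 'd \<Rightarrow> real) \<Rightarrow> nat \<Rightarrow> real" where
  "quadratic_coefficient \<delta> n = sqrt (eta f \<theta> i1 n) * (\<Sum>t\<in>UNIV. \<Sum>u\<in>UNIV. \<delta> n t u * lam f \<theta> n [t, u])"

lemma quadratic_coefficient_order:
  assumes "\<And>r s. (\<lambda>n. \<delta> n r s) \<in> rate (- 2)"
  shows "quadratic_coefficient \<delta> \<in> rate (- 1 / 2)"
proof -
  have "(\<lambda>n. \<Sum>t\<in>UNIV. \<Sum>u\<in>UNIV. \<delta> n t u * lam f \<theta> n [t, u]) \<in> rate (- 1)"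
    by (intro big_sum_in_bigo bigo_powr_mult[OF assms lam_order]) simp
  then show ?thesis unfolding quadratic_coefficient_def[abs_def] by (rule bigo_powr_mult[OF sqrt_eta_order]) simp
qed

text \<open>
  By the second condition the difference \<open>\<delta>\<^sup>r\<^sup>s\<close> of the quadratic coefficients is \<open>- (\<Sum> \<delta>\<^sup>t\<^sup>u \<lambda>\<^sub>t\<^sub>u) \<tau>\<^sup>r\<^sup>s\<close>
  up to \<open>O(n\<^sup>-\<^sup>5\<^sup>/\<^sup>2)\<close>. Since these coefficients enter with a minus sign, the main part contributes
  \<open>a S\<^sup>2\<close>, by \<open>\<Sum> \<tau>\<^sup>r\<^sup>s l\<^sub>r l\<^sub>s = S\<^sup>2\<close>. The rest is a quadratic form with coefficients of
  order \<open>n\<^sup>-\<^sup>5\<^sup>/\<^sup>2\<close>, hence of order \<open>n\<^sup>-\<^sup>1\<close>.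
\<close>

lemma expansion_difference:
  assumes d3: "\<And>r s t. (\<lambda>n. \<xi>3' n r s t - \<xi>3 n r s t) \<in> rate (- 5 / 2)"
    and d2: "\<And>r s. (\<lambda>n.
          (\<xi>2' n r s + (\<Sum>t\<in>UNIV. \<Sum>u\<in>UNIV. \<xi>2' n t u * lam f \<theta> n [t, u]) * tau f \<theta> i1 n r s) -
          (\<xi>2 n r s + (\<Sum>t\<in>UNIV. \<Sum>u\<in>UNIV. \<xi>2 n t u * lam f \<theta> n [t, u]) * tau f \<theta> i1 n r s))
        \<in> rate (- 5 / 2)"
  shows "moment_order (\<lambda>n y. expansion f \<theta> i1 \<xi>3' \<xi>2' n y - expansion f \<theta> i1 \<xi>3 \<xi>2 n y
      - quadratic_coefficient (\<lambda>n r s. \<xi>2' n r s - \<xi>2 n r s) n * leading n y ^ 2) (- 1)"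
proof (rule moment_order_cong)
  let ?w3 = "\<lambda>n r s t. \<xi>3' n r s t - \<xi>3 n r s t"
  let ?w2 = "\<lambda>n r s. (\<xi>2' n r s + (\<Sum>t\<in>UNIV. \<Sum>u\<in>UNIV. \<xi>2' n t u * lam f \<theta> n [t, u]) * tau f \<theta> i1 n r s) -
          (\<xi>2 n r s + (\<Sum>t\<in>UNIV. \<Sum>u\<in>UNIV. \<xi>2 n t u * lam f \<theta> n [t, u]) * tau f \<theta> i1 n r s)"
  show "moment_order (\<lambda>n y. sqrt (eta f \<theta> i1 n) * T2 f \<theta> ?w3 ?w2 n y) (- 1)"
    by (rule moment_order_weaken[OF moment_order_quadratic_forms[OF d3 d2]]) simp
  show "\<forall>\<^sub>F n in sequentially. \<forall>y. expansion f \<theta> i1 \<xi>3' \<xi>2' n y - expansion f \<theta> i1 \<xi>3 \<xi>2 n y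
      - quadratic_coefficient (\<lambda>n r s. \<xi>2' n r s - \<xi>2 n r s) n * leading n y ^ 2 = sqrt (eta f \<theta> i1 n) * T2 f \<theta> ?w3 ?w2 n y"
    using leading_square
  proof eventually_elim
    case (elim n)
    show ?case
    proof
      fix y
      let ?c = "\<Sum>t\<in>UNIV. \<Sum>u\<in>UNIV. (\<xi>2' n t u - \<xi>2 n t u) * lam f \<theta> n [t, u]"
      have w2: "?w2 n r s = (\<xi>2' n r s - \<xi>2 n r s) + ?c * tau f \<theta> i1 n r s" for r s
        by (simp add: left_diff_distrib sum_subtractf)
      have 3: "(\<Sum>r\<in>UNIV. \<Sum>s\<in>UNIV. \<Sum>t\<in>UNIV. ?w3 n r s t * l [r, s] n y * l [t] n y) =
        (\<Sum>r\<in>UNIV. \<Sum>s\<in>UNIV. \<Sum>t\<in>UNIV. \<xi>3' n r s t * l [r, s] n y * l [t] n y) -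
        (\<Sum>r\<in>UNIV. \<Sum>s\<in>UNIV. \<Sum>t\<in>UNIV. \<xi>3 n r s t * l [r, s] n y * l [t] n y)"
        by (simp only: left_diff_distrib sum_subtractf)
      have "(\<Sum>r\<in>UNIV. \<Sum>s\<in>UNIV. ((\<xi>2' n r s - \<xi>2 n r s) + ?c * tau f \<theta> i1 n r s) * l [r] n y * l [s] n y) =
        (\<Sum>r\<in>UNIV. \<Sum>s\<in>UNIV. \<xi>2' n r s * l [r] n y * l [s] n y) -
        (\<Sum>r\<in>UNIV. \<Sum>s\<in>UNIV. \<xi>2 n r s * l [r] n y * l [s] n y) +
        ?c * (\<Sum>r\<in>UNIV. \<Sum>s\<in>UNIV. tau f \<theta> i1 n r s * l [r] n y * l [s] n y)"
        unfolding sum_distrib_left[of ?c]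
        by (simp only: distrib_right left_diff_distrib sum_subtractf sum.distrib mult.assoc)
      also have "(\<Sum>r\<in>UNIV. \<Sum>s\<in>UNIV. tau f \<theta> i1 n r s * l [r] n y * l [s] n y) = leading n y ^ 2"
        using elim by simp
      finally have 2: "(\<Sum>r\<in>UNIV. \<Sum>s\<in>UNIV. ?w2 n r s * l [r] n y * l [s] n y) =
        (\<Sum>r\<in>UNIV. \<Sum>s\<in>UNIV. \<xi>2' n r s * l [r] n y * l [s] n y) -
        (\<Sum>r\<in>UNIV. \<Sum>s\<in>UNIV. \<xi>2 n r s * l [r] n y * l [s] n y) + ?c * leading n y ^ 2"
        unfolding w2 .
      show "expansion f \<theta> i1 \<xi>3' \<xi>2' n y - expansion f \<theta> i1 \<xi>3 \<xi>2 n y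
        - quadratic_coefficient (\<lambda>n r s. \<xi>2' n r s - \<xi>2 n r s) n * leading n y ^ 2 = sqrt (eta f \<theta> i1 n) * T2 f \<theta> ?w3 ?w2 n y"
        unfolding expansion_eq quadratic_coefficient_def T2_def 2 3 by (simp only: algebra_simps)
    qed
  qed
qed

end

section \<open>Agreement of the p-values\<close>

theorem theorem3:
  fixes f :: "'d::finite model"
    and \<Theta> :: "(real^'d) set" and \<theta> :: "real^'d" and i1 :: 'd and \<psi> :: real and K :: nat
    and T T' :: "nat \<Rightarrow> real \<Rightarrow> (nat \<Rightarrow> real) \<Rightarrow> real"
    and \<xi>3 \<xi>3' :: "nat \<Rightarrow> 'd \<Rightarrow> 'd \<Rightarrow> 'd \<Rightarrow> real"
    and \<xi>2 \<xi>2' :: "nat \<Rightarrow> 'd \<Rightarrow> 'd \<Rightarrow> real"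
    and p p' :: "nat \<Rightarrow> (nat \<Rightarrow> real) \<Rightarrow> real"
  assumes K: "K \<ge> 3"
    and psi: "\<psi> = \<theta> $ i1"
    and model: "regular_model f \<Theta> \<theta> K"
    and orders: "standing_orders f \<theta> i1 K"
    and xi_order:
      "\<And>r s t. (\<lambda>n. \<xi>3 n r s t) \<in> O(\<lambda>n. real n powr (- 2))"
      "\<And>r s. (\<lambda>n. \<xi>2 n r s) \<in> O(\<lambda>n. real n powr (- 2))"
      "\<And>r s t. (\<lambda>n. \<xi>3' n r s t) \<in> O(\<lambda>n. real n powr (- 2))"
      "\<And>r s. (\<lambda>n. \<xi>2' n r s) \<in> O(\<lambda>n. real n powr (- 2))"
    and normal:
      "asymptotically_standard_normal (law f \<theta>) (\<lambda>n. T n \<psi>)"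
      "asymptotically_standard_normal (law f \<theta>) (\<lambda>n. T' n \<psi>)"
    and form:
      "Op (law f \<theta>) (\<lambda>n y. T n \<psi> y - expansion f \<theta> i1 \<xi>3 \<xi>2 n y) (\<lambda>n. real n powr (- 1))"
      "Op (law f \<theta>) (\<lambda>n y. T' n \<psi> y - expansion f \<theta> i1 \<xi>3' \<xi>2' n y) (\<lambda>n. real n powr (- 1))"
    and cumulants:
      "cumulants_preserved (law f \<theta>) (\<lambda>n. T n \<psi>) (expansion f \<theta> i1 \<xi>3 \<xi>2)"
      "cumulants_preserved (law f \<theta>) (\<lambda>n. T' n \<psi>) (expansion f \<theta> i1 \<xi>3' \<xi>2')"
    and edgeworth:
      "admits_edgeworth (law f \<theta>) (\<lambda>n. T n \<psi>)"
      "admits_edgeworth (law f \<theta>) (\<lambda>n. T' n \<psi>)"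
    and xi3_cond:
      "\<And>r s t. (\<lambda>n. \<xi>3' n r s t - \<xi>3 n r s t) \<in> O(\<lambda>n. real n powr (- 5/2))"
    and xi2_cond:
      "\<And>r s. (\<lambda>n.
          (\<xi>2' n r s + (\<Sum>t\<in>UNIV. \<Sum>u\<in>UNIV. \<xi>2' n t u * lam f \<theta> n [t, u]) * tau f \<theta> i1 n r s) -
          (\<xi>2 n r s + (\<Sum>t\<in>UNIV. \<Sum>u\<in>UNIV. \<xi>2 n t u * lam f \<theta> n [t, u]) * tau f \<theta> i1 n r s))
        \<in> O(\<lambda>n. real n powr (- 5/2))"
    and p_values:
      "is_p_value (law f \<theta>) (\<lambda>n. T n \<psi>) p"
      "is_p_value (law f \<theta>) (\<lambda>n. T' n \<psi>) p'"
  shows "Op (law f \<theta>) (\<lambda>n y. p n y - p' n y) (\<lambda>n. real n powr (- 1))"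
proof -
  interpret regular_problem f \<Theta> \<theta> i1 K
    using K model orders by unfold_locales
  let ?P = "law f \<theta>" and ?V = "expansion f \<theta> i1 \<xi>3 \<xi>2" and ?V' = "expansion f \<theta> i1 \<xi>3' \<xi>2'"
  let ?T = "\<lambda>n. T n \<psi>" and ?T' = "\<lambda>n. T' n \<psi>"
  define a where "a = quadratic_coefficient (\<lambda>n r s. \<xi>2' n r s - \<xi>2 n r s)"
  define Q where "Q n y = sqrt (eta f \<theta> i1 n) * T2 f \<theta> \<xi>3 \<xi>2 n y" for n y
  define R where "R n y = ?V' n y - ?V n y - a n * leading n y ^ 2" for n y
  define E where "E n y = ?T n y - ?V n y" for n y
  define E' where "E' n y = ?T' n y - ?V' n y" for n y
  define k where "k j n = cumulant (?P n) j (?T n)" for j n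
  define k' where "k' j n = cumulant (?P n) j (?T' n)" for j n
  have a: "a \<in> rate (- 1 / 2)" unfolding a_def
    by (rule quadratic_coefficient_order) (rule sum_in_bigo(2)[OF xi_order(4) xi_order(2)])
  have Q: "moment_order Q (- 1 / 2)" unfolding Q_def[abs_def]
    by (rule moment_order_weaken[OF moment_order_quadratic_forms[OF xi_order(1,2)]]) simp
  have R: "moment_order R (- 1)" unfolding R_def[abs_def] a_def
    by (rule expansion_difference[OF xi3_cond xi2_cond])
  have V: "?V n y = leading n y + Q n y" for n y by (simp add: expansion_eq Q_def)
  have V': "?V' n y = ?V n y + a n * leading n y ^ 2 + R n y" for n y by (simp add: R_def)
  note kV = cumulants_of_quadratic_perturbation[OF moment_order_leading Q R a moments_of_leading V V']
  have pres: "(\<lambda>n. k j n - cumulant (?P n) j (?V n)) \<in> rate (- 1)"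
      "(\<lambda>n. k' j n - cumulant (?P n) j (?V' n)) \<in> rate (- 1)" if "j \<in> {1, 2, 3}" for j
    using cumulants that unfolding cumulants_preserved_def k_def k'_def by blast+
  have k1: "k 1 \<in> rate (- 1 / 2)"
  proof (rule bigo_eq)
    show "(\<lambda>n. (k 1 n - cumulant (?P n) 1 (?V n)) + cumulant (?P n) 1 (?V n)) \<in> rate (- 1 / 2)"
      by (rule sum_in_bigo(1)[OF bigo_powr_weaken[OF pres(1)] kV(1)]) simp_all
  qed simp
  have k2: "(\<lambda>n. k 2 n - 1) \<in> rate (- 1 / 2)"
  proof (rule bigo_eq)
    show "(\<lambda>n. (k 2 n - cumulant (?P n) 2 (?V n)) + (cumulant (?P n) 2 (?V n) - 1)) \<in> rate (- 1 / 2)"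
      by (rule sum_in_bigo(1)[OF bigo_powr_weaken[OF pres(1)] kV(2)]) simp_all
  qed simp
  have k3: "k 3 \<in> rate (- 1 / 2)"
  proof (rule bigo_eq)
    show "(\<lambda>n. (k 3 n - cumulant (?P n) 3 (?V n)) + cumulant (?P n) 3 (?V n)) \<in> rate (- 1 / 2)"
      by (rule sum_in_bigo(1)[OF bigo_powr_weaken[OF pres(1)] kV(3)]) simp_all
  qed simp
  have diff: "(\<lambda>n. k' j n - k j n - c n) \<in> rate (- 1)"
    if j: "j \<in> {1, 2, 3}" and d: "(\<lambda>n. cumulant (?P n) j (?V' n) - cumulant (?P n) j (?V n) - c n) \<in> rate (- 1)" for j c
  proof (rule bigo_eq)
    show "(\<lambda>n. ((k' j n - cumulant (?P n) j (?V' n)) - (k j n - cumulant (?P n) j (?V n)))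
        + (cumulant (?P n) j (?V' n) - cumulant (?P n) j (?V n) - c n)) \<in> rate (- 1)"
      by (rule sum_in_bigo(1)[OF sum_in_bigo(2)[OF pres(2)[OF j] pres(1)[OF j]] d])
  qed simp
  have d1: "(\<lambda>n. k' 1 n - k 1 n - a n) \<in> rate (- 1)" by (rule diff[OF _ kV(4)]) simp
  have d2: "(\<lambda>n. k' 2 n - k 2 n) \<in> rate (- 1)"
    using diff[of 2 "\<lambda>_. 0"] kV(5) by (simp only: diff_zero) blast
  have d3: "(\<lambda>n. k' 3 n - k 3 n - 6 * a n) \<in> rate (- 1)" by (rule diff[OF _ kV(6)]) simp
  have E: "OpP E (- 1)" "OpP E' (- 1)" using form unfolding E_def[abs_def] E'_def[abs_def] .
  have S: "OpP leading 0" by (rule moment_order_imp_OpP[OF moment_order_leading])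
  have QO: "OpP Q (- 1 / 2)" by (rule moment_order_imp_OpP[OF Q])
  have QE: "OpP (\<lambda>n y. Q n y + E n y) (- 1 / 2)"
    by (rule OpP_add[OF QO OpP_weaken[OF E(1)]]) simp
  have Teq: "?T = (\<lambda>n y. leading n y + (Q n y + E n y))" by (intro ext) (simp add: E_def V)
  have TO: "OpP ?T 0" unfolding Teq by (rule OpP_add[OF S OpP_weaken[OF QE]]) simp
  \<comment> \<open>for the replacement of \<open>S\<^sup>2\<close> by \<open>T\<^sup>2\<close>, as \<open>T\<^sup>2 - S\<^sup>2 = (T - S) (S + T)\<close>\<close>
  have ST: "OpP (\<lambda>n y. a n * ((Q n y + E n y) * (leading n y + ?T n y))) (- 1)"
    by (rule OpP_cmult[OF a OpP_mult[OF QE OpP_add[OF S TO]]]) simp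
  have Weq: "(\<lambda>n y. ?T' n y - ?T n y - a n * ?T n y ^ 2) =
     (\<lambda>n y. (E' n y - E n y) + (R n y - a n * ((Q n y + E n y) * (leading n y + ?T n y))))"
  proof (intro ext)
    fix n y
    have "(Q n y + E n y) * (leading n y + ?T n y) = ?T n y ^ 2 - leading n y ^ 2"
    proof -
      have q: "Q n y + E n y = ?T n y - leading n y" by (simp add: E_def V)
      show ?thesis unfolding q by (simp add: power2_eq_square algebra_simps)
    qed
    then show "?T' n y - ?T n y - a n * ?T n y ^ 2 =
      (E' n y - E n y) + (R n y - a n * ((Q n y + E n y) * (leading n y + ?T n y)))"
      by (simp add: E_def E'_def R_def right_diff_distrib)
  qed
  have W: "OpP (\<lambda>n y. ?T' n y - ?T n y - a n * ?T n y ^ 2) (- 1)"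
    unfolding Weq by (rule OpP_add[OF OpP_diff[OF E(2,1)] OpP_diff[OF moment_order_imp_OpP[OF R] ST]])
  define G where "G n y = edgeworth_cdf (k 1 n) (k 2 n) (k 3 n) (?T n y)" for n y
  define G' where "G' n y = edgeworth_cdf (k' 1 n) (k' 2 n) (k' 3 n) (?T' n y)" for n y
  have GG: "OpP (\<lambda>n y. G' n y - G n y) (- 1)" unfolding G_def G'_def
    by (rule edgeworth_invariant_under_quadratic_perturbation[OF TO W a k1 k2 k3 d1 d2 d3])
  have meas: "\<forall>\<^sub>F n in sequentially. ?T n \<in> borel_measurable (?P n)" "\<forall>\<^sub>F n in sequentially. ?T' n \<in> borel_measurable (?P n)"
    using normal unfolding asymptotically_standard_normal_def by (auto intro: eventually_sequentiallyI[of 1])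
  have rt: "OpP (\<lambda>n y. right_tail (?P n) (?T n) y - (1 - G n y)) (- 1)" "OpP (\<lambda>n y. right_tail (?P n) (?T' n) y - (1 - G' n y)) (- 1)"
    unfolding G_def G'_def k_def k'_def
    by (rule OpP_right_tail_edgeworth[OF meas(1) edgeworth(1)], rule OpP_right_tail_edgeworth[OF meas(2) edgeworth(2)])
  have peq: "(\<lambda>n y. p n y - p' n y) = (\<lambda>n y. ((p n y - right_tail (?P n) (?T n) y) - (p' n y - right_tail (?P n) (?T' n) y))
      + (((right_tail (?P n) (?T n) y - (1 - G n y)) - (right_tail (?P n) (?T' n) y - (1 - G' n y))) + (G' n y - G n y)))"
    by (intro ext) simp
  show ?thesis unfolding peq
    by (rule OpP_add[OF OpP_diff[OF p_values[unfolded is_p_value_def]] OpP_add[OF OpP_diff[OF rt] GG]])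
qed

end
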